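(* Let $H:[0,T]\times\mathbb{R}^n\times\mathbb{R}^n\to\mathbb{R}$ satisfy (H1)–(H4) and (HLC), with $c(\cdot)$, each $k_R(\cdot)$ and $t\mapsto H(t,0,0)$ integrable on $[0,T]$, and let $(\mathbb{R}^{n+1},f,l)$ be the Steiner representation of $H$. Let $g:\mathbb{R}^n\to\mathbb{R}$ be locally Lipschitz. Then for every $M>0$ there exists $\lambda_M\in L^1([0,T],\mathbb{R})$ such that for all $(t_0,x_0)\in[0,T]\times\bar B_M$ there exists an optimal pair $(x,a)(\cdot)$ for the problem $$\text{minimize } g(x(T))+\int_{t_0}^T l(t,x(t),a(t))\,dt\ \text{ subject to } \dot x(t)=f(t,x(t),a(t))\text{ a.e. } t\in[t_0,T],\ x(t_0)=x_0,$$ (over $x(\cdot)\in\mathcal{A}([t_0,T],\mathbb{R}^n)$, $a(\cdot)\in L^1([t_0,T],\mathbb{R}^{n+1})$) which satisfies $|(\dot x(t),a(t))|\le\lambda_M(t)$ for a.e. $t\in[t_0,T]$. Additionally, if $H$, the functions $k_R(\cdot)$ and $c(\cdot)$ are continuous, then $\lambda_M$ can be taken continuous.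
   Context: Hypotheses: (H1) $H(\cdot,x,p)$ Lebesgue measurable; (H2) $H(t,\cdot,\cdot)$ continuous; (H3) $H(t,x,\cdot)$ convex; (H4) there is measurable $c\ge0$ with $|H(t,x,p)-H(t,x,q)|\le c(t)(1+|x|)|p-q|$; (HLC) for each $R>0$ there is measurable $k_R\ge0$ with $|H(t,x,p)-H(t,y,p)|\le k_R(t)(1+|p|)|x-y|$ for $x,y\in\bar B_R$ (closed ball radius $R$ about $0$), all $p$. $H^*(t,x,v)=\sup_p\{\langle v,p\rangle-H(t,x,p)\}$. $\mathcal{A}$ denotes absolutely continuous functions. Steiner representation: $E(t,x)=\mathrm{epi}\,H^*(t,x,\cdot)\subset\mathbb{R}^{n+1}$; $\Phi(t,x,a)=E(t,x)\cap\bar B(a,2d(a,E(t,x)))$; Steiner point $s_m(K)=m\int_{S^{m-1}}p\max_{y\in K}\langle p,y\rangle\,\mu(dp)$ ($\mu$ normalized rotation-invariant measure on the unit sphere); $(f,l)(t,x,a)=s_{n+1}(\Phi(t,x,a))$ with $f\in\mathbb{R}^n$, $l\in\mathbb{R}$. *)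

theory Defs
  imports "HOL-Analysis.Analysis"
begin

definition abs_cont_on :: "real set \<Rightarrow> (real \<Rightarrow> 'b::real_normed_vector) \<Rightarrow> bool" where
  "abs_cont_on S x \<longleftrightarrow>
     (\<forall>e>0. \<exists>d>0. \<forall>N::nat. \<forall>u v :: nat \<Rightarrow> real.
        (\<forall>i<N. u i \<in> S \<and> v i \<in> S \<and> u i \<le> v i) \<and>
        (\<forall>i<N. \<forall>j<N. i \<noteq> j \<longrightarrow> {u i<..<v i} \<inter> {u j<..<v j} = {}) \<and>
        (\<Sum>i<N. v i - u i) < d
        \<longrightarrow> (\<Sum>i<N. norm (x (v i) - x (u i))) < e)"

definition loc_lipschitz :: "('b::metric_space \<Rightarrow> 'c::metric_space) \<Rightarrow> bool" where
  "loc_lipschitz g \<longleftrightarrow> (\<forall>z. \<exists>e>0. \<exists>L. L-lipschitz_on (cball z e) g)"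

definition Hconj :: "(real \<Rightarrow> 'a::euclidean_space \<Rightarrow> 'a \<Rightarrow> real) \<Rightarrow> real \<Rightarrow> 'a \<Rightarrow> 'a \<Rightarrow> ereal" where
  "Hconj H t x v = (SUP p. ereal (v \<bullet> p - H t x p))"

definition Eepi :: "(real \<Rightarrow> 'a::euclidean_space \<Rightarrow> 'a \<Rightarrow> real) \<Rightarrow> real \<Rightarrow> 'a \<Rightarrow> ('a \<times> real) set" where
  "Eepi H t x = {(v, r). Hconj H t x v \<le> ereal r}"

definition support_fn :: "'b::euclidean_space set \<Rightarrow> 'b \<Rightarrow> real" where
  "support_fn K p = (SUP y\<in>K. p \<bullet> y)"

text \<open>Normalized rotation-invariant measure on the unit sphere: push-forward of the
  normalized Lebesgue measure on the unit ball under radial projection.\<close>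
definition sphere_measure :: "'b::euclidean_space measure" where
  "sphere_measure = distr (uniform_measure lborel (ball 0 1)) borel (\<lambda>q. q /\<^sub>R norm q)"

definition steiner_point :: "'b::euclidean_space set \<Rightarrow> 'b" where
  "steiner_point K = real DIM('b) *\<^sub>R (\<integral>p. support_fn K p *\<^sub>R p \<partial>sphere_measure)"

definition Phi :: "(real \<Rightarrow> 'a::euclidean_space \<Rightarrow> 'a \<Rightarrow> real) \<Rightarrow> real \<Rightarrow> 'a \<Rightarrow> ('a \<times> real) \<Rightarrow> ('a \<times> real) set" where
  "Phi H t x a = Eepi H t x \<inter> cball a (2 * infdist a (Eepi H t x))"

definition steiner_f :: "(real \<Rightarrow> 'a::euclidean_space \<Rightarrow> 'a \<Rightarrow> real) \<Rightarrow> real \<Rightarrow> 'a \<Rightarrow> ('a \<times> real) \<Rightarrow> 'a" where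
  "steiner_f H t x a = fst (steiner_point (Phi H t x a))"

definition steiner_l :: "(real \<Rightarrow> 'a::euclidean_space \<Rightarrow> 'a \<Rightarrow> real) \<Rightarrow> real \<Rightarrow> 'a \<Rightarrow> ('a \<times> real) \<Rightarrow> real" where
  "steiner_l H t x a = snd (steiner_point (Phi H t x a))"

definition admissible ::
  "(real \<Rightarrow> 'a::euclidean_space \<Rightarrow> 'a \<Rightarrow> real) \<Rightarrow> real \<Rightarrow> real \<Rightarrow> 'a \<Rightarrow> (real \<Rightarrow> 'a) \<Rightarrow> (real \<Rightarrow> 'a \<times> real) \<Rightarrow> bool" where
  "admissible H T t0 x0 x a \<longleftrightarrow>
     abs_cont_on {t0..T} x \<and> x t0 = x0 \<and>
     integrable (lebesgue_on {t0..T}) a \<and>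
     integrable (lebesgue_on {t0..T}) (\<lambda>t. steiner_l H t (x t) (a t)) \<and>
     (AE t in lebesgue_on {t0..T}.
        (x has_vector_derivative steiner_f H t (x t) (a t)) (at t within {t0..T}))"

definition cost ::
  "(real \<Rightarrow> 'a::euclidean_space \<Rightarrow> 'a \<Rightarrow> real) \<Rightarrow> ('a \<Rightarrow> real) \<Rightarrow> real \<Rightarrow> real \<Rightarrow> (real \<Rightarrow> 'a) \<Rightarrow> (real \<Rightarrow> 'a \<times> real) \<Rightarrow> real" where
  "cost H g T t0 x a = g (x T) + (\<integral>t. steiner_l H t (x t) (a t) \<partial>lebesgue_on {t0..T})"

definition optimal_pair ::
  "(real \<Rightarrow> 'a::euclidean_space \<Rightarrow> 'a \<Rightarrow> real) \<Rightarrow> ('a \<Rightarrow> real) \<Rightarrow> real \<Rightarrow> real \<Rightarrow> 'a \<Rightarrow> (real \<Rightarrow> 'a) \<Rightarrow> (real \<Rightarrow> 'a \<times> real) \<Rightarrow> bool" where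
  "optimal_pair H g T t0 x0 x a \<longleftrightarrow>
     admissible H T t0 x0 x a \<and>
     (\<forall>y b. admissible H T t0 x0 y b \<longrightarrow> cost H g T t0 x a \<le> cost H g T t0 y b)"

end

theory Submission
  imports Defs "HOL-Probability.Probability_Measure" "HOL-Complex_Analysis.Great_Picard"
begin

text \<open>
  The Steiner representation is Lipschitz in the state with constant proportional to \<open>k R t\<close>, and
  the control \<open>0\<close> has running cost bounded by an integrable function. Given any admissible pair,
  replace its control by \<open>0\<close> wherever the running cost exceeds a threshold \<open>\<lambda>(t)\<close>. By Gronwall the
  trajectory moves by at most a constant times the integral of \<open>c\<close> over the switching set, so for a
  suitable integrable \<open>\<lambda>\<close> the saving there outweighs the change of cost elsewhere. Hence the
  infimum is not affected by restricting to trajectories whose velocity and running cost are bounded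
  by one integrable function; no adjoint equation is needed. Along a minimizing sequence the
  primitives of velocity and running cost are then equicontinuous, and the limit of a uniformly
  convergent subsequence has a density \<open>\<phi>\<close> which takes values in the epigraph of the conjugate.
  Points of the epigraph are fixed by the Steiner selection, so \<open>\<phi>\<close> itself is an optimal control.
\<close>

section \<open>The Steiner point\<close>

text \<open>Velocities are bounded by \<open>c t * (1 + |x|)\<close> whatever the control, and
  running costs are bounded below by \<open>- H t x 0\<close>. What is missing for compactness is an
  upper bound for the running cost, which a control can make arbitrarily large. Paying a high cost
  on a small set might be worthwhile because it steers the state. The threshold rules this out by a
  balance: switching moves the state at speed at most \<open>2 * (1 + R) * c t\<close> on the
  switching set, later propagation multiplies the displacement by at most \<open>exp K\<close>, with
  \<open>K\<close> the integral of the Lipschitz constant of the representation, and a unit of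
  displacement changes the total cost by at most \<open>L + K\<close>, with \<open>L\<close> the
  Lipschitz constant of \<open>g\<close>. The threshold is the product of these factors plus a bound
  for the cost of the control \<open>0\<close>. It is built from \<open>c\<close>,
  \<open>k R\<close> and \<open>|H t 0 0|\<close> with constant coefficients, so it inherits
  integrability and continuity from them. Velocities and costs of a minimizing sequence need not
  converge pointwise, only their primitives do; the epigraph survives this weak limit because it is
  an intersection of halfspaces.\<close>

lemma lborel_distr_translate: "distr lborel borel (\<lambda>x. c + x) = (lborel :: 'b::euclidean_space measure)"
  using lborel_affine[of 1 c] by (simp add: density_1)

lemma lborel_distr_reflect: "distr lborel borel (\<lambda>x. c - x) = (lborel :: 'b::euclidean_space measure)"
  using lborel_affine[of "-1" c] by (simp add: density_1)

lemma nn_integral_lborel_translate: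
  fixes f :: "'b::euclidean_space \<Rightarrow> ennreal"
  assumes [measurable]: "f \<in> borel_measurable borel"
  shows "(\<integral>\<^sup>+x. f (c + x) \<partial>lborel) = (\<integral>\<^sup>+x. f x \<partial>lborel)"
  by (subst (2) lborel_distr_translate[of c, symmetric]) (simp add: nn_integral_distr)

lemma nn_integral_lborel_reflect:
  fixes f :: "'b::euclidean_space \<Rightarrow> ennreal"
  assumes [measurable]: "f \<in> borel_measurable borel"
  shows "(\<integral>\<^sup>+x. f (c - x) \<partial>lborel) = (\<integral>\<^sup>+x. f x \<partial>lborel)"
  by (subst (2) lborel_distr_reflect[of c, symmetric]) (simp add: nn_integral_distr)

lemma orthogonal_transformation_borel_measurable:
  fixes f :: "'b::euclidean_space \<Rightarrow> 'b"
  shows "orthogonal_transformation f \<Longrightarrow> f \<in> borel_measurable borel"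
  by (intro borel_measurable_continuous_onI linear_continuous_on)
     (auto simp: orthogonal_transformation_def linear_linear)

text \<open>Integrating \<open>indicator A (f x) * indicator B y\<close> over both variables, \<open>B\<close> the unit ball,
  and substituting translations shows that the image measure is a multiple of Lebesgue measure;
  the factor is 1 because \<open>f\<close> preserves \<open>B\<close>.\<close>
lemma lborel_distr_orthogonal_transformation:
  fixes f :: "'b::euclidean_space \<Rightarrow> 'b"
  assumes f: "orthogonal_transformation f"
  shows "distr lborel borel f = lborel"
proof (rule measure_eqI)
  have [measurable]: "f \<in> borel_measurable borel"
    by (rule orthogonal_transformation_borel_measurable[OF f])
  have lin: "linear f" and nf: "norm (f x) = norm x" for x
    using f by (auto simp: orthogonal_transformation)
  obtain g where g: "f (g y) = y" for y
    using orthogonal_transformation_surj[OF f] by (metis surj_def)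
  fix A assume "A \<in> sets (distr lborel borel f)"
  then have [measurable]: "A \<in> sets borel" by simp
  define B :: "'b set" where "B = ball 0 1"
  have [measurable]: "B \<in> sets borel" by (simp add: B_def)
  have Bf: "f x \<in> B \<longleftrightarrow> x \<in> B" for x by (simp add: B_def nf)
  have s: "f x + y = f (g y + x)" for x y
    using lin g by (simp add: linear_add)
  have s2: "y - f x = f (g y - x)" for x y
    using lin g by (simp add: linear_diff)
  have "emeasure lborel (f -` A) * emeasure lborel B
      = (\<integral>\<^sup>+y. \<integral>\<^sup>+x. indicator B y * indicator A (f x) \<partial>lborel \<partial>lborel)"
    proof -
    have "f -` A \<in> sets borel"
      using measurable_sets_borel[of f borel A] by simp
    then show ?thesis
      by (simp add: nn_integral_cmult nn_integral_multc mult.commute flip: indicator_vimage)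
  qed
  also have "\<dots> = (\<integral>\<^sup>+y. \<integral>\<^sup>+x. indicator B y * indicator A (f (g y + x)) \<partial>lborel \<partial>lborel)"
    by (intro nn_integral_cong nn_integral_lborel_translate[symmetric]) measurable
  also have "\<dots> = (\<integral>\<^sup>+y. \<integral>\<^sup>+x. indicator B y * indicator A (f x + y) \<partial>lborel \<partial>lborel)"
    by (simp add: s)
  also have "\<dots> = (\<integral>\<^sup>+x. \<integral>\<^sup>+y. indicator B y * indicator A (f x + y) \<partial>lborel \<partial>lborel)"
    by (rule lborel_pair.Fubini') measurable
  also have "\<dots> = (\<integral>\<^sup>+x. \<integral>\<^sup>+y. indicator B (y - f x) * indicator A y \<partial>lborel \<partial>lborel)"
  proof (rule nn_integral_cong)
    fix x
    show "(\<integral>\<^sup>+y. indicator B y * indicator A (f x + y) \<partial>lborel) = (\<integral>\<^sup>+y. indicator B (y - f x) * indicator A y \<partial>lborel)"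
      by (subst nn_integral_lborel_translate[where c="f x", symmetric]) auto
  qed
  also have "\<dots> = (\<integral>\<^sup>+y. \<integral>\<^sup>+x. indicator B (y - f x) * indicator A y \<partial>lborel \<partial>lborel)"
    by (rule lborel_pair.Fubini') measurable
  also have "\<dots> = (\<integral>\<^sup>+y. \<integral>\<^sup>+x. indicator B (g y - x) * indicator A y \<partial>lborel \<partial>lborel)"
    by (simp add: s2 Bf indicator_def)
  also have "\<dots> = emeasure lborel A * emeasure lborel B"
    by (simp add: nn_integral_multc nn_integral_lborel_reflect nn_integral_cmult mult.commute)
  finally have "emeasure lborel (f -` A) * emeasure lborel B = emeasure lborel A * emeasure lborel B" .
  moreover have "emeasure lborel B \<noteq> 0"
    using content_ball_pos[of 1 "0::'b"] by (auto simp: B_def measure_def)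
  moreover have "emeasure lborel B \<noteq> \<infinity>"
    using emeasure_lborel_ball_finite[of "0::'b" 1] by (auto simp: B_def)
  ultimately show "emeasure (distr lborel borel f) A = emeasure lborel A"
    by (auto simp: emeasure_distr mult.commute[of _ "emeasure lborel B"] ennreal_mult_cancel_left)
qed simp

section \<open>The normalized measure on the unit sphere and its orthogonal invariance\<close>

lemma sets_sphere_measure [simp, measurable_cong]: "sets sphere_measure = sets borel"
  and space_sphere_measure [simp]: "space sphere_measure = UNIV"
  by (auto simp: sphere_measure_def)

lemma prob_space_uniform_unit_ball: "prob_space (uniform_measure lborel (ball (0::'b::euclidean_space) 1))"
proof (rule prob_space_uniform_measure)
  show "emeasure lborel (ball (0::'b) 1) \<noteq> 0"
    using content_ball_pos[of 1 "0::'b"] by (auto simp: measure_def)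
  show "emeasure lborel (ball (0::'b) 1) \<noteq> \<infinity>"
    using emeasure_lborel_ball_finite[of "0::'b" 1] by auto
qed

lemma prob_space_sphere_measure: "prob_space (sphere_measure :: 'b::euclidean_space measure)"
  unfolding sphere_measure_def
  by (rule prob_space.prob_space_distr[OF prob_space_uniform_unit_ball]) measurable

lemma AE_sphere_measure_norm: "AE p in (sphere_measure :: 'b::euclidean_space measure). norm p = 1"
proof -
  have "AE q in uniform_measure lborel (ball (0::'b) 1). q \<noteq> 0"
  proof (rule AE_uniform_measureI)
    show "AE x in lborel. x \<in> ball (0::'b) 1 \<longrightarrow> x \<noteq> 0"
      using AE_lborel_singleton[of "0::'b"] by auto
  qed simp
  then show ?thesis
    unfolding sphere_measure_def
    by (subst AE_distr_iff) (auto elim!: eventually_mono)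
qed

text \<open>A linear isometry preserves the uniform measure on the ball and commutes with the radial
  projection.\<close>

lemma distr_sphere_measure_orthogonal_transformation:
  fixes f :: "'b::euclidean_space \<Rightarrow> 'b"
  assumes f: "orthogonal_transformation f"
  shows "distr sphere_measure borel f = sphere_measure"
proof -
  have [measurable]: "f \<in> borel_measurable borel"
    by (rule orthogonal_transformation_borel_measurable[OF f])
  have lin: "linear f" and nf: "norm (f x) = norm x" for x
    using f by (auto simp: orthogonal_transformation)
  let ?U = "uniform_measure lborel (ball (0::'b) 1)"
  have U: "distr ?U borel f = ?U"
  proof (rule measure_eqI)
    fix A assume "A \<in> sets (distr ?U borel f)"
    then have [measurable]: "A \<in> sets borel" by simp
    have "emeasure (distr ?U borel f) A = emeasure lborel (f -` (ball 0 1 \<inter> A)) / emeasure lborel (ball (0::'b) 1)"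
    proof -
      have "f -` A \<in> sets borel"
      using measurable_sets_borel[of f borel A] by simp
      moreover have "ball 0 1 \<inter> f -` A = f -` (ball 0 1 \<inter> A)" by (auto simp: nf)
      ultimately show ?thesis by (subst emeasure_distr) auto
    qed
    also have "emeasure lborel (f -` (ball 0 1 \<inter> A)) = emeasure (distr lborel borel f) (ball 0 1 \<inter> A)"
      by (subst emeasure_distr) auto
    also have "\<dots> = emeasure lborel (ball 0 1 \<inter> A)"
      by (simp add: lborel_distr_orthogonal_transformation[OF f])
    finally show "emeasure (distr ?U borel f) A = emeasure ?U A" by simp
  qed simp
  have "distr sphere_measure borel f = distr ?U borel (\<lambda>q. f q /\<^sub>R norm (f q))"
    unfolding sphere_measure_def
    by (subst distr_distr) (auto simp: nf linear_scale[OF lin] comp_def)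
  also have "\<dots> = distr (distr ?U borel f) borel (\<lambda>q. q /\<^sub>R norm q)"
    by (subst distr_distr) (auto simp: comp_def)
  also have "\<dots> = sphere_measure" unfolding U sphere_measure_def ..
  finally show ?thesis .
qed

lemma integral_sphere_measure_orthogonal_transformation:
  fixes f :: "'b::euclidean_space \<Rightarrow> 'b" and h :: "'b \<Rightarrow> 'c::{banach,second_countable_topology}"
  assumes f: "orthogonal_transformation f" and [measurable]: "h \<in> borel_measurable borel"
  shows "(\<integral>p. h (f p) \<partial>sphere_measure) = (\<integral>p. h p \<partial>sphere_measure)"
proof -
  have [measurable]: "f \<in> borel_measurable borel"
    by (rule orthogonal_transformation_borel_measurable[OF f])
  show ?thesis
    by (subst (2) distr_sphere_measure_orthogonal_transformation[OF f, symmetric])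
       (subst integral_distr, auto)
qed

lemma integrable_sphere_measure_bounded:
  fixes h :: "'b::euclidean_space \<Rightarrow> 'c::{banach,second_countable_topology}"
  assumes "h \<in> borel_measurable borel" "\<And>p. norm p = 1 \<Longrightarrow> norm (h p) \<le> B"
  shows "integrable sphere_measure h"
proof -
  interpret prob_space "sphere_measure :: 'b measure" by (rule prob_space_sphere_measure)
  show ?thesis
    using AE_sphere_measure_norm assms by (intro integrable_const_bound[where B=B]) (auto elim!: eventually_mono)
qed

section \<open>Reflections and the second moments of the sphere measure\<close>

definition hyperplane_reflection :: "'b::euclidean_space \<Rightarrow> 'b \<Rightarrow> 'b" where
  "hyperplane_reflection u p = p - (2 * (p \<bullet> u)) *\<^sub>R u"

lemma orthogonal_transformation_hyperplane_reflection:
  assumes "norm u = 1"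
  shows "orthogonal_transformation (hyperplane_reflection u)"
proof -
  have "u \<bullet> u = 1" using assms by (simp add: norm_eq_1)
  then show ?thesis
    unfolding orthogonal_transformation_def hyperplane_reflection_def
    by (auto intro!: linearI simp: algebra_simps inner_simps inner_commute)
qed

text \<open>The reflection along \<open>u - v\<close> exchanges the unit vectors \<open>u\<close>
  and \<open>v\<close> and preserves the measure.\<close>

lemma sphere_measure_second_moment_eq:
  fixes u v :: "'b::euclidean_space"
  assumes "norm u = 1" "norm v = 1"
  shows "(\<integral>p. (p \<bullet> u)\<^sup>2 \<partial>sphere_measure) = (\<integral>p. (p \<bullet> v)\<^sup>2 \<partial>sphere_measure)"
proof (cases "u = v")
  case False
  have uu: "u \<bullet> u = 1" "v \<bullet> v = 1" using assms by (auto simp: norm_eq_1)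
  define w where "w = (u - v) /\<^sub>R norm (u - v)"
  have w: "norm w = 1" using False by (simp add: w_def)
  have "hyperplane_reflection w p \<bullet> u = p \<bullet> v" for p
  proof -
    have n: "(norm (u - v))\<^sup>2 = 2 - 2 * (u \<bullet> v)"
      using uu by (simp add: power2_norm_eq_inner inner_simps inner_commute)
    have "2 * (p \<bullet> w) * (w \<bullet> u) = 2 * (p \<bullet> (u - v)) * ((u - v) \<bullet> u) / (norm (u - v))\<^sup>2"
      by (simp add: w_def power2_eq_square divide_inverse)
    also have "(u - v) \<bullet> u = (norm (u - v))\<^sup>2 / 2"
      using uu n by (simp add: inner_simps inner_commute)
    finally have "2 * (p \<bullet> w) * (w \<bullet> u) = p \<bullet> (u - v)" using False by simp
    then show ?thesis by (simp add: hyperplane_reflection_def inner_simps)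
  qed
  then show ?thesis
    using integral_sphere_measure_orthogonal_transformation[OF orthogonal_transformation_hyperplane_reflection[OF w], of "\<lambda>p. (p \<bullet> u)\<^sup>2"]
    by simp
qed simp

lemma integrable_sphere_measure_moment [simp]:
  "integrable sphere_measure (\<lambda>p :: 'b::euclidean_space. (p \<bullet> u) * (p \<bullet> v))"
proof (rule integrable_sphere_measure_bounded[where B="norm u * norm v"])
  fix p :: 'b assume "norm p = 1"
  then have "\<bar>p \<bullet> u\<bar> \<le> norm u" "\<bar>p \<bullet> v\<bar> \<le> norm v"
    using Cauchy_Schwarz_ineq2[of p u] Cauchy_Schwarz_ineq2[of p v] by auto
  then show "norm ((p \<bullet> u) * (p \<bullet> v)) \<le> norm u * norm v"
    by (auto simp: abs_mult intro!: mult_mono)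
qed measurable

text \<open>All coordinate directions have the same second moment, and together these integrate
  \<open>|p|\<^sup>2\<close>, which is 1 almost everywhere.\<close>

lemma sphere_measure_second_moment:
  fixes u :: "'b::euclidean_space"
  assumes "norm u = 1"
  shows "(\<integral>p. (p \<bullet> u)\<^sup>2 \<partial>sphere_measure) = 1 / DIM('b)"
proof -
  interpret prob_space "sphere_measure :: 'b measure" by (rule prob_space_sphere_measure)
  have "real DIM('b) * (\<integral>p. (p \<bullet> u)\<^sup>2 \<partial>sphere_measure) = (\<Sum>b\<in>Basis. \<integral>p. (p \<bullet> b)\<^sup>2 \<partial>(sphere_measure :: 'b measure))"
    using sphere_measure_second_moment_eq[OF _ assms] by simp
  also have "\<dots> = (\<integral>p. (\<Sum>b\<in>Basis. (p \<bullet> b)\<^sup>2) \<partial>(sphere_measure :: 'b measure))"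
    by (subst Bochner_Integration.integral_sum) (auto simp: power2_eq_square)
  also have "\<dots> = (\<integral>p. 1 \<partial>(sphere_measure :: 'b measure))"
  proof (rule integral_cong_AE)
    show "AE p :: 'b in sphere_measure. (\<Sum>b\<in>Basis. (p \<bullet> b)\<^sup>2) = 1"
      using AE_sphere_measure_norm
    proof (eventually_elim)
      case (elim p)
      then have "p \<bullet> p = 1" by (simp add: norm_eq_1)
      then show ?case by (subst (asm) euclidean_inner) (simp add: power2_eq_square)
    qed
  qed auto
  also have "\<dots> = 1" using prob_space by simp
  finally show ?thesis by (simp add: field_simps)
qed

text \<open>Polarization of the second moment: isotropy of the sphere measure as a bilinear
  identity.\<close>

lemma sphere_measure_moment:
  fixes u v :: "'b::euclidean_space"
  shows "(\<integral>p. (p \<bullet> u) * (p \<bullet> v) \<partial>sphere_measure) = (u \<bullet> v) / DIM('b)"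
proof -
  have Q: "(\<integral>p. (p \<bullet> w) * (p \<bullet> w) \<partial>sphere_measure) = (w \<bullet> w) / DIM('b)" for w :: 'b
  proof (cases "w = 0")
    case False
    have "(\<integral>p. (p \<bullet> w) * (p \<bullet> w) \<partial>sphere_measure) = (\<integral>p. (norm w)\<^sup>2 * (p \<bullet> (w /\<^sub>R norm w))\<^sup>2 \<partial>sphere_measure)"
      using False by (intro Bochner_Integration.integral_cong) (auto simp: power2_eq_square field_simps)
    also have "\<dots> = (w \<bullet> w) / DIM('b)"
      using False sphere_measure_second_moment[of "w /\<^sub>R norm w"]
      by (simp del: inner_scaleR_right add: power2_norm_eq_inner)
    finally show ?thesis .
  qed simp
  have "(\<integral>p. (p \<bullet> u) * (p \<bullet> v) \<partial>sphere_measure)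
      = (\<integral>p. ((p \<bullet> (u + v)) * (p \<bullet> (u + v)) - (p \<bullet> (u - v)) * (p \<bullet> (u - v))) / 4 \<partial>sphere_measure)"
    by (intro Bochner_Integration.integral_cong) (auto simp: inner_simps algebra_simps)
  also have "\<dots> = ((u + v) \<bullet> (u + v) / DIM('b) - (u - v) \<bullet> (u - v) / DIM('b)) / 4"
    by (simp add: Q)
  also have "\<dots> = (u \<bullet> v) / DIM('b)"
    by (simp add: inner_simps inner_commute field_simps)
  finally show ?thesis .
qed

text \<open>The support function of a point is linear, so isotropy applies; the factor
  \<open>DIM('b)\<close> in the definition is the normalization that makes this an identity.\<close>

lemma steiner_point_singleton:
  fixes a :: "'b::euclidean_space"
  shows "steiner_point {a} = a"
proof (rule euclidean_eqI)
  fix b :: 'b assume "b \<in> Basis"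
  have int: "integrable sphere_measure (\<lambda>p :: 'b. (p \<bullet> a) *\<^sub>R p)"
  proof (rule integrable_sphere_measure_bounded[where B="norm a"])
    fix p :: 'b assume "norm p = 1"
    then show "norm ((p \<bullet> a) *\<^sub>R p) \<le> norm a"
      using Cauchy_Schwarz_ineq2[of p a] by simp
  qed measurable
  have "steiner_point {a} \<bullet> b = real DIM('b) * (\<integral>p. (p \<bullet> a) * (p \<bullet> b) \<partial>sphere_measure)"
    unfolding steiner_point_def support_fn_def
    by (simp add: int flip: integral_inner_left)
  also have "\<dots> = a \<bullet> b"
    by (simp add: sphere_measure_moment)
  finally show "steiner_point {a} \<bullet> b = a \<bullet> b" .
qed

section \<open>Support functions and the position of the Steiner point\<close>

lemma support_fn_upper:
  fixes K :: "'b::euclidean_space set"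
  assumes "bounded K" "y \<in> K"
  shows "p \<bullet> y \<le> support_fn K p"
  unfolding support_fn_def
proof (rule cSUP_upper[OF assms(2)])
  obtain B where "\<And>y. y \<in> K \<Longrightarrow> norm y \<le> B" using assms(1) by (auto simp: bounded_iff)
  then have "\<And>y. y \<in> K \<Longrightarrow> p \<bullet> y \<le> norm p * B"
    by (meson norm_cauchy_schwarz mult_left_mono norm_ge_zero order_trans)
  then show "bdd_above ((\<bullet>) p ` K)" by (intro bdd_aboveI2)
qed

lemma support_fn_least:
  assumes "K \<noteq> {}" "\<And>y. y \<in> K \<Longrightarrow> p \<bullet> y \<le> r"
  shows "support_fn K p \<le> r"
  unfolding support_fn_def using assms by (intro cSUP_least) auto

lemma support_fn_hausdorff:
  fixes K :: "'b::euclidean_space set"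
  assumes "bounded K'" "K \<noteq> {}" "\<And>u. u \<in> K \<Longrightarrow> \<exists>v\<in>K'. norm (u - v) \<le> d"
  shows "support_fn K p \<le> support_fn K' p + norm p * d"
proof (rule support_fn_least[OF assms(2)])
  fix u assume "u \<in> K"
  then obtain v where v: "v \<in> K'" "norm (u - v) \<le> d" using assms(3) by blast
  have "p \<bullet> u = p \<bullet> v + p \<bullet> (u - v)" by (simp add: inner_simps)
  also have "\<dots> \<le> support_fn K' p + norm p * d"
    by (intro add_mono support_fn_upper[OF assms(1) v(1)] order_trans[OF norm_cauchy_schwarz] mult_left_mono v(2)) auto
  finally show "p \<bullet> u \<le> support_fn K' p + norm p * d" .
qed

lemma continuous_support_fn:
  fixes K :: "'b::euclidean_space set"
  assumes "bounded K" "K \<noteq> {}"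
  shows "continuous_on UNIV (support_fn K)"
proof -
  obtain B where B: "\<And>y. y \<in> K \<Longrightarrow> norm y \<le> B" using assms(1) by (auto simp: bounded_iff)
  then have "0 \<le> B" using assms(2) by (metis ex_in_conv norm_ge_zero order_trans)
  have *: "support_fn K p \<le> support_fn K q + B * norm (p - q)" for p q
  proof (rule support_fn_least[OF assms(2)])
    fix y assume y: "y \<in> K"
    have "p \<bullet> y = q \<bullet> y + (p - q) \<bullet> y" by (simp add: inner_simps)
    also have "\<dots> \<le> support_fn K q + norm (p - q) * B"
      by (intro add_mono support_fn_upper[OF assms(1) y] order_trans[OF norm_cauchy_schwarz] mult_left_mono B y) auto
    finally show "p \<bullet> y \<le> support_fn K q + B * norm (p - q)" by (simp add: mult.commute)
  qed
  have "B-lipschitz_on UNIV (support_fn K)"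
  proof (rule lipschitz_onI)
    fix p q show "dist (support_fn K p) (support_fn K q) \<le> B * dist p q"
      using *[of p q] *[of q p] by (simp add: dist_norm abs_le_iff norm_minus_commute)
  qed (fact \<open>0 \<le> B\<close>)
  then show ?thesis by (rule lipschitz_on_continuous_on)
qed

lemma integrable_support_fn_scaleR:
  fixes K :: "'b::euclidean_space set"
  assumes "bounded K" "K \<noteq> {}"
  shows "integrable sphere_measure (\<lambda>p. support_fn K p *\<^sub>R p)"
proof -
  obtain B where B: "\<And>y. y \<in> K \<Longrightarrow> norm y \<le> B" using assms(1) by (auto simp: bounded_iff)
  obtain y0 where y0: "y0 \<in> K" using assms by auto
  have [measurable]: "support_fn K \<in> borel_measurable borel"
    using continuous_support_fn[OF assms] by (rule borel_measurable_continuous_onI)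
  show ?thesis
  proof (rule integrable_sphere_measure_bounded[where B=B])
    fix p :: 'b assume p: "norm p = 1"
    have "support_fn K p \<le> B"
      using B p norm_cauchy_schwarz[of p] by (intro support_fn_least[OF assms(2)]) (metis mult_1 order_trans)
    moreover have "- B \<le> p \<bullet> y0"
      using B[OF y0] p Cauchy_Schwarz_ineq2[of p y0] by simp
    ultimately show "norm (support_fn K p *\<^sub>R p) \<le> B"
      using support_fn_upper[OF assms(1) y0, of p] p by auto
  qed measurable
qed

text \<open>Support functions of sets at Hausdorff distance \<open>d\<close> differ by at most
  \<open>d\<close> on the unit sphere, and the sphere measure has mass 1. The constant
  \<open>DIM('b)\<close> is the normalizing factor of the Steiner point.\<close>

lemma steiner_point_hausdorff:
  fixes K :: "'b::euclidean_space set" and d :: real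
  assumes "bounded K" "bounded K'" "K \<noteq> {}" "K' \<noteq> {}"
    and "\<And>u. u \<in> K \<Longrightarrow> \<exists>v\<in>K'. norm (u - v) \<le> d"
    and "\<And>u. u \<in> K' \<Longrightarrow> \<exists>v\<in>K. norm (u - v) \<le> d"
  shows "norm (steiner_point K - steiner_point K') \<le> DIM('b) * d"
proof -
  interpret prob_space "sphere_measure :: 'b measure" by (rule prob_space_sphere_measure)
  let ?h = "\<lambda>p. (support_fn K p - support_fn K' p) *\<^sub>R p"
  have int: "integrable sphere_measure ?h"
    using integrable_support_fn_scaleR[of K] integrable_support_fn_scaleR[of K'] assms
    by (simp add: scaleR_left_diff_distrib)
  have "norm (\<integral>p. ?h p \<partial>sphere_measure) \<le> (\<integral>p. norm (?h p) \<partial>sphere_measure)"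
    by (rule integral_norm_bound)
  also have "\<dots> \<le> (\<integral>p. d \<partial>(sphere_measure :: 'b measure))"
  proof (rule integral_mono_AE)
    show "AE p :: 'b in sphere_measure. norm (?h p) \<le> d"
      using AE_sphere_measure_norm
    proof eventually_elim
      case (elim p)
      then show ?case
        using support_fn_hausdorff[OF assms(2,3,5), of p] support_fn_hausdorff[OF assms(1,4,6), of p] by auto
    qed
  qed (use integrable_norm[OF int] in auto)
  also have "\<dots> = d" using prob_space by simp
  finally have "norm (\<integral>p. ?h p \<partial>sphere_measure) \<le> d" .
  moreover have "steiner_point K - steiner_point K' = real DIM('b) *\<^sub>R (\<integral>p. ?h p \<partial>sphere_measure)"
    using integrable_support_fn_scaleR[of K] integrable_support_fn_scaleR[of K'] assms
    by (simp add: steiner_point_def scaleR_left_diff_distrib scaleR_diff_right)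
  ultimately show ?thesis by (simp add: mult_left_mono)
qed

text \<open>Averaging \<open>p\<close> with its mirror image in the hyperplane orthogonal to \<open>q\<close> turns the integrand
  into a pointwise inequality.\<close>
lemma steiner_point_inner_le:
  fixes K :: "'b::euclidean_space set"
  assumes K: "bounded K" "K \<noteq> {}" and q: "norm q = 1"
  shows "q \<bullet> steiner_point K \<le> support_fn K q"
proof -
  let ?r = "hyperplane_reflection q" and ?h = "support_fn K"
  have [measurable]: "?h \<in> borel_measurable borel"
    using continuous_support_fn[OF K] by (rule borel_measurable_continuous_onI)
  have orth: "orthogonal_transformation ?r"
    by (rule orthogonal_transformation_hyperplane_reflection[OF q])
  have [measurable]: "?r \<in> borel_measurable borel"
    by (rule orthogonal_transformation_borel_measurable[OF orth])
  have qq: "q \<bullet> q = 1" using q by (simp add: norm_eq_1)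
  have rq: "?r p \<bullet> q = - (p \<bullet> q)" for p by (simp add: hyperplane_reflection_def inner_simps qq)
  have rr: "?r (?r p) = p" for p
    by (simp add: hyperplane_reflection_def inner_simps qq algebra_simps)
  have int: "integrable sphere_measure (\<lambda>p. ?h p * (p \<bullet> q))"
    using integrable_inner_left[of q, OF integrable_support_fn_scaleR[OF K]] by simp
  have intr: "integrable sphere_measure (\<lambda>p. ?h (?r p) * (p \<bullet> q))"
  proof -
    have "integrable (distr sphere_measure borel ?r) (\<lambda>p. ?h p * (p \<bullet> q))"
      using int by (simp add: distr_sphere_measure_orthogonal_transformation[OF orth])
    then have "integrable sphere_measure (\<lambda>p. ?h (?r p) * (?r p \<bullet> q))"
      by (subst (asm) integrable_distr_eq) auto
    then show ?thesis by (simp add: rq)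
  qed
  \<comment> \<open>Subadditivity of the support function along
    \<open>p = ?r p + 2 * (p \<bullet> q) * q\<close>; the sign condition makes the coefficient of
    \<open>q\<close> nonnegative, so that it can be pulled out.\<close>
  have pw: "?h p - ?h (?r p) \<le> 2 * (p \<bullet> q) * ?h q" if "0 \<le> p \<bullet> q" for p
  proof -
    have "?h p \<le> ?h (?r p) + 2 * (p \<bullet> q) * ?h q"
    proof (rule support_fn_least[OF K(2)])
      fix y assume y: "y \<in> K"
      have "p \<bullet> y = ?r p \<bullet> y + 2 * (p \<bullet> q) * (q \<bullet> y)"
        by (simp add: hyperplane_reflection_def inner_simps)
      also have "\<dots> \<le> ?h (?r p) + 2 * (p \<bullet> q) * ?h q"
        by (intro add_mono mult_left_mono support_fn_upper K y) (use that in auto)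
      finally show "p \<bullet> y \<le> ?h (?r p) + 2 * (p \<bullet> q) * ?h q" .
    qed
    then show ?thesis by simp
  qed
  \<comment> \<open>Exchanging \<open>p\<close> and \<open>?r p\<close> flips the sign of both
    factors on the left and leaves the right side unchanged, so the case of negative
    \<open>p \<bullet> q\<close> follows from the other one.\<close>
  have le: "(?h p - ?h (?r p)) * (p \<bullet> q) \<le> 2 * ?h q * ((p \<bullet> q) * (p \<bullet> q))" for p
  proof (cases "0 \<le> p \<bullet> q")
    case True
    then show ?thesis using mult_right_mono[OF pw[OF True] True] by (simp add: algebra_simps)
  next
    case False
    then have "0 \<le> ?r p \<bullet> q" by (simp add: rq)
    from mult_right_mono[OF pw[OF this] this] show ?thesis by (simp add: algebra_simps rr rq)
  qed
  have eq: "(\<integral>p. ?h p * (p \<bullet> q) \<partial>sphere_measure) = - (\<integral>p. ?h (?r p) * (p \<bullet> q) \<partial>sphere_measure)"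
    using integral_sphere_measure_orthogonal_transformation[OF orth, of "\<lambda>p. ?h p * (p \<bullet> q)"]
    by (simp add: rq)
  have "2 * (\<integral>p. ?h p * (p \<bullet> q) \<partial>sphere_measure) = (\<integral>p. (?h p - ?h (?r p)) * (p \<bullet> q) \<partial>sphere_measure)"
    using eq by (simp add: left_diff_distrib int intr)
  also have "\<dots> \<le> (\<integral>p. 2 * ?h q * ((p \<bullet> q) * (p \<bullet> q)) \<partial>sphere_measure)"
    using int intr by (intro integral_mono le) (auto simp: left_diff_distrib)
  also have "\<dots> = 2 * ?h q / DIM('b)"
    by (simp add: sphere_measure_moment qq)
  finally have "real DIM('b) * (\<integral>p. ?h p * (p \<bullet> q) \<partial>sphere_measure) \<le> ?h q"
    by (simp add: field_simps)
  also have "(\<integral>p. ?h p * (p \<bullet> q) \<partial>sphere_measure) = (\<integral>p. ?h p *\<^sub>R p \<partial>sphere_measure) \<bullet> q"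
    using integral_inner_left[of q, OF integrable_support_fn_scaleR[OF K]] by simp
  finally show ?thesis
    by (simp add: steiner_point_def inner_commute)
qed

text \<open>If the point were outside, a separating hyperplane would provide a unit direction
  \<open>q\<close> in which it exceeds the support function, against
  \<open>steiner_point_inner_le\<close>.\<close>

lemma steiner_point_mem:
  fixes K :: "'b::euclidean_space set"
  assumes K: "compact K" "convex K" "K \<noteq> {}"
  shows "steiner_point K \<in> K"
proof (rule ccontr)
  assume "steiner_point K \<notin> K"
  then obtain a b where ab: "a \<bullet> steiner_point K < b" "\<And>y. y \<in> K \<Longrightarrow> b < a \<bullet> y"
    using separating_hyperplane_closed_point[OF K(2) compact_imp_closed[OF K(1)]] by blast
  then have "a \<noteq> 0" using K(3) by force
  define q where "q = - (a /\<^sub>R norm a)"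
  have "norm q = 1" using \<open>a \<noteq> 0\<close> by (simp add: q_def)
  then have "q \<bullet> steiner_point K \<le> support_fn K q"
    using K by (intro steiner_point_inner_le compact_imp_bounded)
  also have "\<dots> \<le> - (b / norm a)"
    using ab(2) \<open>a \<noteq> 0\<close> K(3)
    by (intro support_fn_least) (auto simp: q_def field_simps less_imp_le)
  finally show False using ab(1) \<open>a \<noteq> 0\<close> by (simp add: q_def field_simps)
qed

section \<open>Intersection with a ball of twice the distance, and Lipschitz dependence of its
  Steiner point\<close>

definition local_part :: "'b::euclidean_space set \<Rightarrow> 'b \<Rightarrow> 'b set" where
  "local_part E a = E \<inter> cball a (2 * infdist a E)"

lemma compact_local_part: "closed E \<Longrightarrow> compact (local_part E a)"
  unfolding local_part_def by (simp add: closed_Int_compact)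

lemma convex_local_part: "convex E \<Longrightarrow> convex (local_part E a)"
  unfolding local_part_def by (simp add: convex_Int)

lemma local_part_nonempty:
  assumes "closed E" "E \<noteq> {}"
  shows "local_part E a \<noteq> {}"
proof -
  obtain z where "z \<in> E" "infdist a E = dist a z" using infdist_attains_inf[OF assms] by blast
  then show ?thesis using infdist_nonneg[of a E] by (force simp: local_part_def)
qed

text \<open>The distance is zero, so the ball shrinks to its centre. This is the source of the fixed
  points of the representation.\<close>

lemma local_part_member:
  assumes "closed E" "a \<in> E"
  shows "local_part E a = {a}"
  using assms by (auto simp: local_part_def)

lemma steiner_point_local_part_mem:
  assumes "closed E" "convex E" "E \<noteq> {}"
  shows "steiner_point (local_part E a) \<in> local_part E a"
  using assms by (intro steiner_point_mem compact_local_part convex_local_part local_part_nonempty)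

lemma infdist_hausdorff:
  fixes E :: "'b::euclidean_space set"
  assumes "E \<noteq> {}" "closed E" "\<And>u. u \<in> E \<Longrightarrow> \<exists>v\<in>E'. norm (u - v) \<le> d"
  shows "infdist b E' \<le> infdist a E + d + norm (a - b)"
proof -
  obtain z where z: "z \<in> E" "infdist a E = dist a z" using infdist_attains_inf[OF assms(2,1)] by blast
  obtain v where v: "v \<in> E'" "norm (z - v) \<le> d" using assms(3)[OF z(1)] by blast
  have "infdist b E' \<le> dist b v" using v(1) by (rule infdist_le)
  also have "\<dots> \<le> dist b a + dist a z + dist z v"
    using dist_triangle[of b v a] dist_triangle[of a v z] by simp
  finally show ?thesis using z(2) v(2) by (simp add: dist_norm norm_minus_commute)
qed

text \<open>A point of \<open>E'\<close> close to the given one may leave the ball by \<open>O(d + e)\<close>; moving it towards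
  the projection of \<open>b\<close>, where there is slack \<open>infdist b E'\<close>, brings it back.\<close>
lemma local_part_hausdorff:
  fixes E :: "'b::euclidean_space set"
  assumes E: "closed E" "E \<noteq> {}" and E': "closed E'" "convex E'" "E' \<noteq> {}"
    and EE': "\<And>u. u \<in> E \<Longrightarrow> \<exists>v\<in>E'. norm (u - v) \<le> d"
    and E'E: "\<And>u. u \<in> E' \<Longrightarrow> \<exists>v\<in>E. norm (u - v) \<le> d"
    and u: "u \<in> local_part E a"
  shows "\<exists>v\<in>local_part E' b. norm (u - v) \<le> 10 * (d + norm (a - b))"
proof -
  define e where "e = d + norm (a - b)"
  have "0 \<le> d" using E'(3) E'E by (metis all_not_in_conv norm_ge_zero order_trans)
  then have e0: "0 \<le> e" by (simp add: e_def)
  define D where "D = infdist b E'"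
  have D0: "0 \<le> D" by (simp add: D_def infdist_nonneg)
  have aD: "infdist a E \<le> D + e"
    using infdist_hausdorff[OF E'(3,1) E'E, of a b] by (simp add: D_def e_def norm_minus_commute)
  have uE: "u \<in> E" and ua: "norm (u - a) \<le> 2 * infdist a E"
    using u by (auto simp: local_part_def dist_norm norm_minus_commute)
  obtain w where w: "w \<in> E'" "norm (u - w) \<le> d" using EE'[OF uE] by blast
  obtain z where z: "z \<in> E'" "D = dist b z" using infdist_attains_inf[OF E'(1,3)] unfolding D_def by blast
  have "norm (w - b) \<le> norm (u - w) + norm (u - a) + norm (a - b)"
    using norm_triangle_ineq[of "w - u" "u - b"] norm_triangle_ineq[of "u - a" "a - b"]
    by (simp add: norm_minus_commute)
  then have wb: "norm (w - b) \<le> 2 * D + 3 * e"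
    using w(2) ua aD by (simp add: e_def)
  show ?thesis
  proof (cases "D + 3 * e = 0")
    case True
    then have "D = 0" "e = 0" using D0 e0 by auto
    then have "w = b" "d = 0" using wb \<open>0 \<le> d\<close> e_def
      by (auto simp: add_nonneg_eq_0_iff)
    then show ?thesis using w infdist_nonneg[of b E']
      by (intro bexI[of _ w]) (auto simp: local_part_def)
  next
    case False
    then have pos: "D + 3 * e > 0" using D0 e0 by auto
    \<comment> \<open>Chosen so that \<open>(1 - \<theta>) * (2 * D + 3 * e) + \<theta> * D\<close>
      equals exactly \<open>2 * D\<close>, the radius of the target ball. The move costs
      \<open>\<theta> * 3 * (D + 3 * e) = 9 * e\<close>, and together with the distance
      \<open>d\<close> from \<open>u\<close> to \<open>w\<close> this stays below
      \<open>10 * e\<close>.\<close>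
    define \<theta> where "\<theta> = 3 * e / (D + 3 * e)"
    have th: "0 \<le> \<theta>" "\<theta> \<le> 1" using D0 e0 pos by (auto simp: \<theta>_def field_simps)
    define v where "v = (1 - \<theta>) *\<^sub>R w + \<theta> *\<^sub>R z"
    have vE: "v \<in> E'" unfolding v_def using th w z E'(2) by (auto intro: convexD_alt)
    have zb: "norm (z - b) = D" using z(2) by (simp add: dist_norm norm_minus_commute)
    have "v - b = (1 - \<theta>) *\<^sub>R (w - b) + \<theta> *\<^sub>R (z - b)" by (simp add: v_def algebra_simps)
    then have "norm (v - b) \<le> (1 - \<theta>) * norm (w - b) + \<theta> * norm (z - b)"
      using th by (metis norm_triangle_le norm_scaleR abs_of_nonneg diff_ge_0_iff_ge order_refl)
    also have "\<dots> \<le> (1 - \<theta>) * (2 * D + 3 * e) + \<theta> * D"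
      using th wb zb by (intro add_mono mult_left_mono) auto
    also have "\<dots> = 2 * D"
      proof -
      have "\<theta> * (D + 3 * e) = 3 * e" using pos by (simp add: \<theta>_def)
      then show ?thesis by (simp add: algebra_simps)
    qed
    finally have "norm (v - b) \<le> 2 * D" .
    then have vl: "v \<in> local_part E' b"
      using vE by (simp add: local_part_def D_def dist_norm norm_minus_commute)
    have "w - v = \<theta> *\<^sub>R (w - z)" by (simp add: v_def algebra_simps)
    then have "norm (w - v) = \<theta> * norm (w - z)" using th by simp
    also have "\<dots> \<le> \<theta> * (3 * (D + 3 * e))"
    proof (rule mult_left_mono)
      have "norm (w - z) \<le> norm (w - b) + norm (z - b)"
        by (metis dist_norm dist_triangle2)
      then show "norm (w - z) \<le> 3 * (D + 3 * e)" using wb zb e0 by simp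
    qed (use th in auto)
    also have "\<dots> = 9 * e"
    proof -
      have "\<theta> * (D + 3 * e) = 3 * e" using pos by (simp add: \<theta>_def)
      then show ?thesis by (simp add: algebra_simps)
    qed
    finally have "norm (u - v) \<le> d + 9 * e"
      using w(2) norm_triangle_ineq[of "u - w" "w - v"] by simp
    then show ?thesis using vl e_def e0 \<open>0 \<le> d\<close> by (intro bexI[of _ v]) (smt (verit) norm_ge_zero)+
  qed
qed

lemma steiner_point_local_part_lipschitz:
  fixes E :: "'b::euclidean_space set"
  assumes "closed E" "convex E" "E \<noteq> {}" "closed E'" "convex E'" "E' \<noteq> {}"
    and "\<And>u. u \<in> E \<Longrightarrow> \<exists>v\<in>E'. norm (u - v) \<le> d"
    and "\<And>u. u \<in> E' \<Longrightarrow> \<exists>v\<in>E. norm (u - v) \<le> d"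
  shows "norm (steiner_point (local_part E a) - steiner_point (local_part E' b))
     \<le> DIM('b) * (10 * (d + norm (a - b)))"
proof (rule steiner_point_hausdorff)
  show "bounded (local_part E a)" "bounded (local_part E' b)"
    using assms by (auto intro!: compact_imp_bounded compact_local_part)
  show "local_part E a \<noteq> {}" "local_part E' b \<noteq> {}"
    using local_part_nonempty assms by blast+
  show "\<exists>v\<in>local_part E' b. norm (u - v) \<le> 10 * (d + norm (a - b))" if "u \<in> local_part E a" for u
    using assms that by (intro local_part_hausdorff[where E=E]) auto
  show "\<exists>v\<in>local_part E a. norm (u - v) \<le> 10 * (d + norm (a - b))" if "u \<in> local_part E' b" for u
    using assms that local_part_hausdorff[where E=E' and E'=E and a=b and b=a and u=u and d=d]
    by (auto simp: norm_minus_commute)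
qed

section \<open>Conjugate epigraphs\<close>

definition conj_epi :: "('a::euclidean_space \<Rightarrow> real) \<Rightarrow> ('a \<times> real) set" where
  "conj_epi h = {(v, r). \<forall>p. v \<bullet> p - h p \<le> r}"

lemma Eepi_eq_conj_epi: "Eepi H t x = conj_epi (H t x)"
  unfolding Eepi_def conj_epi_def Hconj_def by (auto simp: SUP_le_iff)

lemma Phi_eq_local_part: "Phi H t x a = local_part (conj_epi (H t x)) a"
  unfolding Phi_def local_part_def Eepi_eq_conj_epi ..

text \<open>The conjugate is a supremum of affine functions, one for each \<open>p\<close>.
  Closedness, convexity, measurability and stability under limits are all derived from this
  description.\<close>

lemma conj_epi_eq_halfspaces: "conj_epi h = (\<Inter>p. {u. (p, -1) \<bullet> u \<le> h p})"
  by (auto simp: conj_epi_def inner_commute algebra_simps)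

lemma closed_conj_epi: "closed (conj_epi h)"
  unfolding conj_epi_eq_halfspaces by (intro closed_INT ballI closed_halfspace_le)

lemma convex_conj_epi: "convex (conj_epi h)"
  unfolding conj_epi_eq_halfspaces by (intro convex_INT ballI convex_halfspace_le)

lemma conj_epiD: "(v, r) \<in> conj_epi h \<Longrightarrow> v \<bullet> p - h p \<le> r"
  by (auto simp: conj_epi_def)

lemma conj_epi_mono: "(v, r) \<in> conj_epi h \<Longrightarrow> r \<le> s \<Longrightarrow> (v, s) \<in> conj_epi h"
  unfolding conj_epi_def by (auto intro: order_trans)

text \<open>Testing with \<open>p = l * v / |v|\<close> for large \<open>l\<close>: the linear term
  \<open>l * |v|\<close> would outgrow the Lipschitz bound \<open>\<kappa> * l\<close> if
  \<open>|v|\<close> exceeded \<open>\<kappa>\<close>. Hence the conjugate is infinite outside a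
  ball, which bounds every velocity.\<close>

lemma conj_epi_norm_le:
  assumes lip: "\<And>p q. \<bar>h p - h q\<bar> \<le> \<kappa> * norm (p - q)" and "(v, r) \<in> conj_epi h"
  shows "norm v \<le> \<kappa>"
proof (rule field_le_epsilon)
  fix e :: real assume e: "0 < e"
  \<comment> \<open>Large enough for the constants \<open>|h 0| + |r|\<close> to be absorbed by
    \<open>l * e\<close>; the summand 1 keeps \<open>l\<close> positive.\<close>
  define l where "l = (\<bar>h 0\<bar> + \<bar>r\<bar>) / e + 1"
  have l0: "0 < l" using e by (simp add: l_def add_nonneg_pos)
  show "norm v \<le> \<kappa> + e"
  proof (cases "v = 0")
    \<comment> \<open>The claim reduces to \<open>0 \<le> \<kappa> + e\<close>; the sign of
      \<open>\<kappa>\<close> comes from the Lipschitz bound between a basis vector and the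
      origin.\<close>
    case True
    obtain b :: 'a where b: "b \<in> Basis" using nonempty_Basis by blast
    have "0 \<le> \<bar>h b - h 0\<bar>" by simp
    also have "\<dots> \<le> \<kappa> * norm (b - 0)" by (rule lip)
    finally show ?thesis using True e b by simp
  next
    case False
    define p where "p = l *\<^sub>R (v /\<^sub>R norm v)"
    have np: "norm p = l" using False l0 by (simp add: p_def)
    have vp: "v \<bullet> p = l * norm v" using False by (simp add: p_def dot_square_norm power2_eq_square)
    have "l * norm v - h p \<le> r" using conj_epiD[OF assms(2), of p] by (simp only: vp)
    moreover have "h p \<le> h 0 + \<kappa> * l" using lip[of p 0] np by simp
    moreover have "h 0 + r \<le> l * e"
    proof -
      have "l * e = \<bar>h 0\<bar> + \<bar>r\<bar> + e" using e unfolding l_def distrib_right by simp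
      then show ?thesis using e by simp
    qed
    ultimately have "l * norm v \<le> l * (\<kappa> + e)" by (simp add: algebra_simps)
    then show ?thesis using l0 by (rule mult_left_le_imp_le)
  qed
qed

text \<open>The vector \<open>v\<close> is a subgradient of \<open>h\<close> at \<open>q\<close>,
  giving equality in the Fenchel inequality. It is the slope of a supporting hyperplane of the
  epigraph of \<open>h\<close> at \<open>(q, h q)\<close>; continuity gives that epigraph interior
  points, so its relative boundary is its boundary.\<close>

lemma conj_epi_subgradient:
  fixes h :: "'a::euclidean_space \<Rightarrow> real"
  assumes conv: "convex_on UNIV h" and cont: "continuous_on UNIV h"
  shows "\<exists>v. (v, v \<bullet> q - h q) \<in> conj_epi h"
proof -
  have cl: "closed (epigraph UNIV h)"
  proof -
    have "epigraph UNIV h = {z. h (fst z) \<le> snd z}" by (auto simp: epigraph_def)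
    also have "closed \<dots>"
      by (intro closed_Collect_le continuous_intros continuous_on_compose2[OF cont]) auto
    finally show ?thesis .
  qed
  have cv: "convex (epigraph UNIV h)" using conv by (simp add: convex_epigraph)
  have nz: "(q, h q) \<notin> interior (epigraph UNIV h)"
  proof
    assume "(q, h q) \<in> interior (epigraph UNIV h)"
    then obtain e where "e > 0" "ball (q, h q) e \<subseteq> epigraph UNIV h" by (auto simp: mem_interior)
    moreover have "(q, h q - e / 2) \<in> ball (q, h q) e" using \<open>e > 0\<close> by (simp add: dist_prod_def dist_real_def)
    ultimately show False using \<open>e > 0\<close> by (auto simp: epigraph_def)
  qed
  have ne: "(q, h q) \<in> epigraph UNIV h" by (simp add: epigraph_def)
  have "interior (epigraph UNIV h) \<noteq> {}"
  proof -
    have "open {z :: 'a \<times> real. h (fst z) < snd z}"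
      by (intro open_Collect_less continuous_intros continuous_on_compose2[OF cont]) auto
    then have "{z. h (fst z) < snd z} \<subseteq> interior (epigraph UNIV h)"
      by (intro interior_maximal) (auto simp: epigraph_def)
    moreover have "(q, h q + 1) \<in> {z. h (fst z) < snd z}" by simp
    ultimately show ?thesis by blast
  qed
  then have ri: "rel_interior (epigraph UNIV h) = interior (epigraph UNIV h)"
    by (rule rel_interior_nonempty_interior)
  obtain A where A: "A \<noteq> 0" "\<And>y. y \<in> epigraph UNIV h \<Longrightarrow> A \<bullet> (q, h q) \<le> A \<bullet> y"
  proof (rule supporting_hyperplane_rel_boundary[OF cv ne])
    show "(q, h q) \<notin> rel_interior (epigraph UNIV h)" using nz ri by simp
  qed (rule that)
  obtain w s where As: "A = (w, s)" by (rule prod.exhaust)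
  have ineq: "w \<bullet> q + s * h q \<le> w \<bullet> p + s * r" if "h p \<le> r" for p r
    using A(2)[of "(p, r)"] that by (simp add: As epigraph_def)
  have s0: "0 \<le> s" using ineq[of q "h q + 1"] by (simp add: algebra_simps)
  \<comment> \<open>A vertical hyperplane would bound \<open>w \<bullet> p\<close> from below over
    the whole space, which forces \<open>w = 0\<close>.\<close>
  have "s \<noteq> 0"
  proof
    assume "s = 0"
    then have "w \<bullet> q \<le> w \<bullet> p" for p using ineq[of p "h p"] by simp
    from this[of "q - w"] have "w \<bullet> w \<le> 0" by (simp add: inner_simps)
    then have "w = 0" by (metis inner_eq_zero_iff inner_ge_zero order_antisym)
    then show False using A(1) As \<open>s = 0\<close> by (simp add: zero_prod_def)
  qed
  then have sp: "0 < s" using s0 by simp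
  have "(- w /\<^sub>R s) \<bullet> p - h p \<le> (- w /\<^sub>R s) \<bullet> q - h q" for p
  proof -
    have "(- w /\<^sub>R s) \<bullet> x - h x = - ((w \<bullet> x + s * h x) / s)" for x
      using sp by (simp add: field_simps)
    then show ?thesis using ineq[of p "h p"] sp by (simp add: divide_right_mono)
  qed
  then show ?thesis by (intro exI[of _ "- w /\<^sub>R s"]) (auto simp: conj_epi_def)
qed

text \<open>Let \<open>y\<close> be the projection of \<open>u\<close> to the second epigraph and
  write \<open>u - y = (p, -s)\<close>. If \<open>s > 0\<close>, this is a multiple of
  \<open>(q, -1)\<close> with \<open>q = p / s\<close>, the support value in that direction is
  \<open>h' q\<close>, and \<open>u\<close> exceeds it by at most
  \<open>\<kappa> * (1 + |q|)\<close>. After scaling back,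
  \<open>n * n \<le> \<kappa> * (s + |p|) \<le> 2 * \<kappa> * n\<close> for the distance
  \<open>n\<close>. This weighted bound on the difference is what (HLC) provides.\<close>

lemma conj_epi_hausdorff:
  fixes h :: "'a::euclidean_space \<Rightarrow> real"
  assumes conv: "convex_on UNIV h'" and cont: "continuous_on UNIV h'"
    and close: "\<And>p. \<bar>h p - h' p\<bar> \<le> \<kappa> * (1 + norm p)" and k0: "0 \<le> \<kappa>"
    and u: "u \<in> conj_epi h"
  shows "\<exists>u'\<in>conj_epi h'. norm (u - u') \<le> 2 * \<kappa>"
proof -
  obtain v r where vr: "u = (v, r)" by (cases u)
  have vrh: "v \<bullet> p - r \<le> h p" for p using u by (auto simp: conj_epi_def vr algebra_simps)
  have ne: "conj_epi h' \<noteq> {}" using conj_epi_subgradient[OF conv cont, of 0] by blast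
  obtain y where y: "y \<in> conj_epi h'" "infdist u (conj_epi h') = dist u y"
    using infdist_attains_inf[OF closed_conj_epi ne] by blast
  obtain v1 r1 where yv: "y = (v1, r1)" by (cases y)
  define n where "n = norm (u - y)"
  obtain p s where ps: "u - y = (p, - s)" by (metis prod.exhaust add.inverse_inverse)
  have p: "p = v - v1" and s: "s = r1 - r" using ps by (auto simp: vr yv)
  have n2: "n * n = p \<bullet> p + s * s"
    using power2_norm_eq_inner[of "u - y"] by (simp add: n_def ps power2_eq_square)
  have proj: "(u - y) \<bullet> (z - y) \<le> 0" if "z \<in> conj_epi h'" for z
  proof -
    have "y = closest_point (conj_epi h') u"
      using y infdist_le[of _ "conj_epi h'" u]
      by (intro closest_point_unique[OF convex_conj_epi closed_conj_epi]) simp_all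
    then show ?thesis
      using closest_point_dot[OF convex_conj_epi closed_conj_epi that, of u] by simp
  qed
  have proj': "(w - v1) \<bullet> p \<le> s * (\<rho> - r1)" if "(w, \<rho>) \<in> conj_epi h'" for w \<rho>
    using proj[OF that] unfolding ps by (simp add: yv inner_commute)
  \<comment> \<open>The epigraph is closed upwards, so \<open>y + (0, 1)\<close> may be used in the
    projection inequality.\<close>
  have "0 \<le> s"
    using proj'[of v1 "r1 + 1"] y(1) by (auto simp: yv dest: conj_epi_mono[of _ _ _ "r1 + 1"])
  have "n \<le> 2 * \<kappa>"
  proof (cases "s = 0")
    case False
    then have sp: "0 < s" using \<open>0 \<le> s\<close> by simp
    \<comment> \<open>The direction whose halfspace touches the second epigraph at \<open>y\<close>:
      the subgradient at \<open>q\<close> turns the projection inequality into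
      \<open>h' q \<le> v1 \<bullet> q - r1\<close>.\<close>
    define q where "q = p /\<^sub>R s"
    obtain w where w: "(w, w \<bullet> q - h' q) \<in> conj_epi h'" using conj_epi_subgradient[OF conv cont] by blast
    have "(w - v1) \<bullet> q \<le> w \<bullet> q - h' q - r1"
    proof -
      have "(w - v1) \<bullet> p = s * ((w - v1) \<bullet> q)" using sp by (simp add: q_def)
      then show ?thesis using proj'[OF w] sp by simp
    qed
    then have "h' q \<le> v1 \<bullet> q - r1" by (simp add: inner_simps)
    moreover have "v \<bullet> q - r \<le> h' q + \<kappa> * (1 + norm q)" using vrh[of q] close[of q] by simp
    ultimately have "(v - v1) \<bullet> q + (r1 - r) \<le> \<kappa> * (1 + norm q)" by (simp add: inner_simps)
    then have "s * (p \<bullet> q + s) \<le> s * (\<kappa> * (1 + norm q))" using sp by (simp add: p s)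
    also have "s * (\<kappa> * (1 + norm q)) = \<kappa> * (s + norm p)" using sp by (simp add: q_def field_simps)
    also have "s * (p \<bullet> q + s) = n * n" using sp by (simp add: q_def n2 field_simps)
    also have "s + norm p \<le> 2 * n"
    proof -
      have "norm p \<le> n" "norm (- s) \<le> n"
        unfolding n_def ps by (rule norm_fst_le norm_snd_le)+
      then show ?thesis by simp
    qed
    finally have "n * n \<le> (2 * \<kappa>) * n" using k0 by (simp add: mult_left_mono)
    then show ?thesis using k0 by (cases "n = 0") (auto simp: n_def)
  next
    case True
    \<comment> \<open>The normal is horizontal and corresponds to no single \<open>q\<close>. Large
      multiples \<open>l * p\<close> take its place, with an error \<open>e\<close> that
      \<open>l\<close> makes as small as desired.\<close>
    have "norm p * norm p \<le> \<kappa> * norm p + e" if "e > 0" for e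
    proof -
      define l where "l = (\<bar>h' 0\<bar> + \<bar>r\<bar> + \<kappa>) / e + 1"
      have lp: "0 < l" using that k0 by (simp add: l_def add_nonneg_pos)
      obtain w where w: "(w, w \<bullet> (l *\<^sub>R p) - h' (l *\<^sub>R p)) \<in> conj_epi h'"
        using conj_epi_subgradient[OF conv cont] by blast
      have "w \<bullet> p \<le> v1 \<bullet> p" using proj'[OF w] True by (simp add: inner_simps)
      moreover have "- (w \<bullet> (l *\<^sub>R p) - h' (l *\<^sub>R p)) \<le> h' 0"
        using conj_epiD[OF w, of 0] by simp
      ultimately have "h' (l *\<^sub>R p) \<le> l * (v1 \<bullet> p) + h' 0"
        using lp by (simp) (smt (verit) mult_left_mono)
      have "v \<bullet> (l *\<^sub>R p) - r \<le> h' (l *\<^sub>R p) + \<kappa> * (1 + norm (l *\<^sub>R p))"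
        using vrh[of "l *\<^sub>R p"] close[of "l *\<^sub>R p"] by simp
      have "l * (p \<bullet> p) \<le> \<bar>h' 0\<bar> + \<bar>r\<bar> + \<kappa> + l * (\<kappa> * norm p)"
      proof -
        have "p \<bullet> p = v \<bullet> p - v1 \<bullet> p" by (simp add: p inner_simps)
        then have "l * (p \<bullet> p) = l * (v \<bullet> p) - l * (v1 \<bullet> p)" by (simp add: right_diff_distrib)
        moreover have "\<kappa> * (1 + norm (l *\<^sub>R p)) = \<kappa> + l * (\<kappa> * norm p)"
          using lp by (simp add: algebra_simps)
        ultimately show ?thesis
          using \<open>h' (l *\<^sub>R p) \<le> l * (v1 \<bullet> p) + h' 0\<close> \<open>v \<bullet> (l *\<^sub>R p) - r \<le> h' (l *\<^sub>R p) + \<kappa> * (1 + norm (l *\<^sub>R p))\<close>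
          unfolding inner_scaleR_right by linarith
      qed
      also have "\<bar>h' 0\<bar> + \<bar>r\<bar> + \<kappa> \<le> l * e" using that by (simp add: l_def field_simps)
      finally have "l * (p \<bullet> p) \<le> l * (\<kappa> * norm p + e)" by (simp add: algebra_simps)
      then have "p \<bullet> p \<le> \<kappa> * norm p + e" using lp by simp
      then show ?thesis by (simp add: dot_square_norm power2_eq_square)
    qed
    then have "norm p * norm p \<le> \<kappa> * norm p" by (rule field_le_epsilon)
    then have "norm p \<le> \<kappa>" using k0 by (cases "p = 0") auto
    moreover have "n = norm p" using ps True by (simp add: n_def norm_Pair)
    ultimately show ?thesis using k0 by simp
  qed
  then show ?thesis using y(1) by (intro bexI[of _ y]) (simp_all add: n_def)
qed

text \<open>A subgradient at the origin gives an explicit point \<open>(v, - h 0)\<close> of the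
  epigraph, and \<open>v\<close> is bounded by the Lipschitz constant.\<close>

lemma infdist_conj_epi_zero_le:
  fixes h :: "'a::euclidean_space \<Rightarrow> real"
  assumes conv: "convex_on UNIV h" and cont: "continuous_on UNIV h"
    and lip: "\<And>p q. \<bar>h p - h q\<bar> \<le> \<kappa> * norm (p - q)"
  shows "infdist 0 (conj_epi h) \<le> \<kappa> + \<bar>h 0\<bar>"
proof -
  obtain v where v: "(v, - h 0) \<in> conj_epi h" using conj_epi_subgradient[OF conv cont, of 0] by auto
  have "infdist 0 (conj_epi h) \<le> dist 0 (v, - h 0)" using v by (rule infdist_le)
  also have "\<dots> \<le> norm v + \<bar>h 0\<bar>" using norm_Pair_le[of v "- h 0"] by simp
  also have "norm v \<le> \<kappa>" using conj_epi_norm_le[OF lip v] .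
  finally show ?thesis by simp
qed

section \<open>Measurability\<close>

text \<open>For a simple function \<open>u\<close> the composition is glued from countably many
  measurable pieces; continuity in the second argument carries this to the limit.\<close>

lemma borel_measurable_caratheodory:
  fixes F :: "'t \<Rightarrow> 'p::{metric_space, second_countable_topology} \<Rightarrow> 'q::metric_space"
  assumes meas: "\<And>p. (\<lambda>t. F t p) \<in> borel_measurable M"
    and cont: "\<And>t. t \<in> space M \<Longrightarrow> continuous_on UNIV (F t)"
    and u: "u \<in> borel_measurable M"
  shows "(\<lambda>t. F t (u t)) \<in> borel_measurable M"
proof -
  obtain s where s: "\<And>i. simple_function M (s i)" "\<And>t. t \<in> space M \<Longrightarrow> (\<lambda>i. s i t) \<longlonglongrightarrow> u t"
    using borel_measurable_implies_sequence_metric[OF u, of undefined] by metis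
  show ?thesis
  proof (rule borel_measurable_LIMSEQ_metric)
    fix i
    show "(\<lambda>t. F t (s i t)) \<in> borel_measurable M"
    proof (rule measurable_compose_countable'[where f="\<lambda>p t. F t p" and I="s i ` space M"])
      show "s i \<in> measurable M (count_space (s i ` space M))"
        using s(1)[of i] by (auto simp: simple_function_def intro!: measurable_count_space_eq2[THEN iffD2])
      show "countable (s i ` space M)"
        using s(1)[of i] by (auto simp: simple_function_def intro: countable_finite)
    qed (rule meas)
  next
    fix t assume t: "t \<in> space M"
    show "(\<lambda>i. F t (s i t)) \<longlonglongrightarrow> F t (u t)"
      using continuous_on_tendsto_compose[OF cont[OF t] s(2)[OF t]] by simp
  qed
qed

text \<open>By compactness, feasibility of countably many constraints on \<open>C\<close> is equivalent to
  approximate feasibility of finitely many of them on a countable dense subset.\<close>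
lemma sets_compact_feasible:
  fixes G :: "nat \<Rightarrow> 't \<Rightarrow> 'b::euclidean_space \<Rightarrow> real"
  assumes C: "compact C"
    and meas: "\<And>i u. (\<lambda>t. G i t u) \<in> borel_measurable M"
    and cont: "\<And>i t. t \<in> space M \<Longrightarrow> continuous_on UNIV (G i t)"
  shows "{t \<in> space M. \<exists>u\<in>C. \<forall>i. G i t u \<le> 0} \<in> sets M"
proof -
  note [measurable] = meas
  obtain D where D: "countable D" "D \<subseteq> C" "C \<subseteq> closure D" using separable[of C] by blast
  have "(\<exists>u\<in>C. \<forall>i. G i t u \<le> 0) \<longleftrightarrow> (\<forall>k::nat. \<exists>d\<in>D. \<forall>i\<in>{..k}. G i t d < 1 / Suc k)"
    if t: "t \<in> space M" for t
  proof safe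
    fix u k assume u: "u \<in> C" "\<forall>i. G i t u \<le> 0"
    define U where "U = (\<Inter>i\<in>{..k}. {d. G i t d < 1 / Suc k})"
    have "open U" unfolding U_def
      by (intro open_INT ballI open_Collect_less cont[OF t] continuous_on_const) auto
    moreover have "u \<in> U" using u(2) by (auto simp: U_def intro: le_less_trans)
    moreover have "u \<in> closure D" using u(1) D(3) by auto
    ultimately obtain d where "d \<in> D" "d \<in> U"
      by (meson closure_iff_nhds_not_empty disjoint_iff order_refl)
    then show "\<exists>d\<in>D. \<forall>i\<in>{..k}. G i t d < 1 / Suc k" by (auto simp: U_def)
  next
    assume "\<forall>k::nat. \<exists>d\<in>D. \<forall>i\<in>{..k}. G i t d < 1 / Suc k"
    then obtain d where d: "\<And>k. d k \<in> D" "\<And>k i. i \<le> k \<Longrightarrow> G i t (d k) < 1 / Suc k"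
      by (metis atMost_iff)
    then have "\<forall>k. d k \<in> C" using D by auto
    then obtain u r where u: "u \<in> C" "strict_mono r" "(d \<circ> r) \<longlonglongrightarrow> u"
      using C[unfolded compact_def] by blast
    have "G i t u \<le> 0" for i
    proof (rule LIMSEQ_le)
      show "(\<lambda>k. G i t ((d \<circ> r) k)) \<longlonglongrightarrow> G i t u"
        using continuous_on_tendsto_compose[OF cont[OF t] u(3)] by simp
      show "(\<lambda>k. 1 / real (Suc k)) \<longlonglongrightarrow> 0" by (rule LIMSEQ_Suc[OF lim_1_over_n])
      show "\<exists>N. \<forall>k\<ge>N. G i t ((d \<circ> r) k) \<le> 1 / real (Suc k)"
      proof (intro exI[of _ i] allI impI)
        fix k assume "i \<le> k"
        moreover have "k \<le> r k" using u(2) by (rule seq_suble)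
        ultimately have "G i t (d (r k)) < 1 / Suc (r k)" by (intro d) simp
        also have "\<dots> \<le> 1 / Suc k" using \<open>k \<le> r k\<close> by (simp add: frac_le)
        finally show "G i t ((d \<circ> r) k) \<le> 1 / real (Suc k)" by simp
      qed
    qed
    then show "\<exists>u\<in>C. \<forall>i. G i t u \<le> 0" using u(1) by blast
  qed
  then have "{t \<in> space M. \<exists>u\<in>C. \<forall>i. G i t u \<le> 0}
      = {t \<in> space M. \<forall>k::nat. \<exists>d\<in>D. \<forall>i\<in>{..k}. G i t d < 1 / Suc k}"
    by blast
  also have "\<dots> \<in> sets M"
    using D(1) by (intro sets.sets_Collect_countable_All sets.sets_Collect_countable_Bex sets.sets_Collect_finite_All')
      (auto intro!: borel_measurable_less meas)
  finally show ?thesis .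
qed

lemma dense_sequence_exists:
  obtains q :: "nat \<Rightarrow> 'a::{second_countable_topology, topological_space}"
  where "\<forall>U. open U \<longrightarrow> U \<noteq> {} \<longrightarrow> (\<exists>i. q i \<in> U)"
proof -
  obtain D :: "'a set" where D: "countable D" "\<And>U. open U \<Longrightarrow> U \<noteq> {} \<Longrightarrow> \<exists>d\<in>D. d \<in> U"
    using countable_dense_exists by blast
  have "D \<noteq> {}" using D(2)[of UNIV] by auto
  show ?thesis
  proof (intro that allI impI)
    fix U :: "'a set" assume "open U" "U \<noteq> {}"
    then obtain d where "d \<in> D" "d \<in> U" using D(2) by blast
    then show "\<exists>i. from_nat_into D i \<in> U"
      using from_nat_into_surj[OF D(1)] by metis
  qed
qed

text \<open>A violated halfspace inequality is violated on an open set of \<open>p\<close>, hence at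
  some \<open>q i\<close>. The constraints have the form that \<open>sets_compact_feasible\<close>
  expects.\<close>

lemma conj_epi_dense_sequence:
  assumes q: "\<forall>U. open U \<longrightarrow> U \<noteq> {} \<longrightarrow> (\<exists>i::nat. q i \<in> U)" and cont: "continuous_on UNIV h"
  shows "u \<in> conj_epi h \<longleftrightarrow> (\<forall>i. (q i, -1) \<bullet> u - h (q i) \<le> 0)"
proof -
  obtain v r where u: "u = (v, r)" by (cases u)
  have "v \<bullet> p - h p \<le> r" if *: "\<forall>i. (q i, -1) \<bullet> u - h (q i) \<le> 0" for p
  proof (rule ccontr)
    assume "\<not> v \<bullet> p - h p \<le> r"
    then have "p \<in> {p. r < v \<bullet> p - h p}" by simp
    moreover have "open {p. r < v \<bullet> p - h p}"
      by (intro open_Collect_less continuous_intros cont)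
    ultimately obtain i where "r < v \<bullet> q i - h (q i)" using q by blast
    then show False using spec[OF *, of i] by (simp add: u inner_commute)
  qed
  moreover have "(q i, -1) \<bullet> u - h (q i) \<le> 0" if "u \<in> conj_epi h" for i
    using conj_epiD[of v r h "q i"] that by (simp add: u inner_commute)
  ultimately show ?thesis by (auto simp: u conj_epi_def)
qed

section \<open>Measurable dependence of distances, support functions and Steiner points on a
  parameter\<close>

context
  fixes h :: "'t \<Rightarrow> 'a::euclidean_space \<Rightarrow> real" and M :: "'t measure"
  assumes meas: "\<And>p. (\<lambda>t. h t p) \<in> borel_measurable M"
    and cont: "\<And>t. t \<in> space M \<Longrightarrow> continuous_on UNIV (h t)"
    and conv: "\<And>t. t \<in> space M \<Longrightarrow> convex_on UNIV (h t)"
begin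

lemma conj_epi_nonempty: "t \<in> space M \<Longrightarrow> conj_epi (h t) \<noteq> {}"
  using conj_epi_subgradient[OF conv cont] by blast

text \<open>The distance is attained, so a sublevel set asks for a common point of countably many
  halfspaces in the fixed compact set \<open>cball a \<alpha>\<close>.\<close>

lemma borel_measurable_infdist_conj_epi: "(\<lambda>t. infdist a (conj_epi (h t))) \<in> borel_measurable M"
  unfolding borel_measurable_iff_le
proof
  fix \<alpha>
  obtain q :: "nat \<Rightarrow> 'a" where q: "\<forall>U. open U \<longrightarrow> U \<noteq> {} \<longrightarrow> (\<exists>i. q i \<in> U)"
    using dense_sequence_exists by blast
  have "infdist a (conj_epi (h t)) \<le> \<alpha> \<longleftrightarrow> (\<exists>u\<in>cball a \<alpha>. \<forall>i. (q i, -1) \<bullet> u - h t (q i) \<le> 0)"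
    if t: "t \<in> space M" for t
  proof -
    have "infdist a (conj_epi (h t)) \<le> \<alpha> \<longleftrightarrow> (\<exists>u\<in>conj_epi (h t). dist a u \<le> \<alpha>)"
      using infdist_attains_inf[OF closed_conj_epi conj_epi_nonempty[OF t], of a] infdist_le
      by (metis order_trans)
    also have "\<dots> \<longleftrightarrow> (\<exists>u\<in>cball a \<alpha>. u \<in> conj_epi (h t))" by auto
    finally show ?thesis by (simp only: conj_epi_dense_sequence[OF q cont[OF t]])
  qed
  then have "{t \<in> space M. infdist a (conj_epi (h t)) \<le> \<alpha>}
      = {t \<in> space M. \<exists>u\<in>cball a \<alpha>. \<forall>i. (q i, -1) \<bullet> u - h t (q i) \<le> 0}"
    by blast
  also have "\<dots> \<in> sets M"
    using meas by (intro sets_compact_feasible) (auto intro!: continuous_intros)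
  finally show "{t \<in> space M. infdist a (conj_epi (h t)) \<le> \<alpha>} \<in> sets M" .
qed

text \<open>The maximum is attained, so a superlevel set is again a feasibility problem. The radius
  of the local part varies with \<open>t\<close>, while feasibility is decided on fixed compact
  sets; hence the union over the balls \<open>cball a N\<close>.\<close>

lemma borel_measurable_support_fn_local_part:
  "(\<lambda>t. support_fn (local_part (conj_epi (h t)) a) p) \<in> borel_measurable M"
  unfolding borel_measurable_iff_ge
proof
  fix \<alpha>
  obtain q :: "nat \<Rightarrow> 'a" where q: "\<forall>U. open U \<longrightarrow> U \<noteq> {} \<longrightarrow> (\<exists>i. q i \<in> U)"
    using dense_sequence_exists by blast
  \<comment> \<open>Index 0 is the ball of the local part, index 1 the level
    \<open>\<alpha>\<close>, and index \<open>i + 2\<close> the halfspace of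
    \<open>q i\<close>.\<close>
  define G where "G = (\<lambda>i t (u :: 'a \<times> real).
    case i of 0 \<Rightarrow> dist a u - 2 * infdist a (conj_epi (h t)) | Suc j \<Rightarrow>
    (case j of 0 \<Rightarrow> \<alpha> - p \<bullet> u | Suc i \<Rightarrow> (q i, -1) \<bullet> u - h t (q i)))"
  have G: "(\<forall>i. G i t u \<le> 0) \<longleftrightarrow> u \<in> local_part (conj_epi (h t)) a \<and> \<alpha> \<le> p \<bullet> u" if t: "t \<in> space M" for t u
  proof -
    have "(\<forall>i. G i t u \<le> 0) \<longleftrightarrow> G 0 t u \<le> 0 \<and> G (Suc 0) t u \<le> 0 \<and> (\<forall>i. G (Suc (Suc i)) t u \<le> 0)"
      by (metis not0_implies_Suc)
    then show ?thesis
      using conj_epi_dense_sequence[OF q cont[OF t]] by (auto simp: G_def local_part_def)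
  qed
  have *: "\<alpha> \<le> support_fn (local_part (conj_epi (h t)) a) p
      \<longleftrightarrow> (\<exists>N::nat. \<exists>u\<in>cball a N. \<forall>i. G i t u \<le> 0)"
    if t: "t \<in> space M" for t
  proof -
    let ?K = "local_part (conj_epi (h t)) a"
    have K: "compact ?K" "?K \<noteq> {}"
      using compact_local_part[OF closed_conj_epi] local_part_nonempty[OF closed_conj_epi conj_epi_nonempty[OF t]]
      by blast+
    obtain u where u: "u \<in> ?K" "\<And>y. y \<in> ?K \<Longrightarrow> p \<bullet> y \<le> p \<bullet> u"
      using continuous_attains_sup[OF K continuous_on_inner[OF continuous_on_const continuous_on_id], of p] by blast
    have sup: "support_fn ?K p = p \<bullet> u"
      using u K by (intro antisym support_fn_least support_fn_upper compact_imp_bounded) auto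
    show ?thesis
    proof
      assume "\<alpha> \<le> support_fn ?K p"
      moreover obtain N :: nat where "dist a u \<le> N" using real_arch_simple by blast
      ultimately show "\<exists>N::nat. \<exists>u\<in>cball a N. \<forall>i. G i t u \<le> 0"
        using sup u(1) G[OF t] by (intro exI[of _ N] bexI[of _ u]) auto
    next
      assume "\<exists>N::nat. \<exists>u\<in>cball a N. \<forall>i. G i t u \<le> 0"
      then obtain y where "y \<in> ?K" "\<alpha> \<le> p \<bullet> y" using G[OF t] by blast
      then show "\<alpha> \<le> support_fn ?K p" using sup u(2)[of y] by linarith
    qed
  qed
  have "{t \<in> space M. \<alpha> \<le> support_fn (local_part (conj_epi (h t)) a) p}
      = (\<Union>N::nat. {t \<in> space M. \<exists>u\<in>cball a N. \<forall>i. G i t u \<le> 0})"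
    using * by auto
  also have "\<dots> \<in> sets M"
  proof (intro sets.countable_UN image_subsetI sets_compact_feasible compact_cball)
    note [measurable] = meas borel_measurable_infdist_conj_epi
    show "(\<lambda>t. G i t u) \<in> borel_measurable M" for i u
      unfolding G_def by (simp split: nat.split)
    show "continuous_on UNIV (G i t)" for i t
    proof (cases i)
      case (Suc j)
      then show ?thesis by (cases j) (auto simp: G_def intro!: continuous_intros)
    qed (auto simp: G_def intro!: continuous_intros)
  qed
  finally show "{t \<in> space M. \<alpha> \<le> support_fn (local_part (conj_epi (h t)) a) p} \<in> sets M" .
qed

text \<open>The support function is measurable in \<open>t\<close> and continuous in the direction,
  hence jointly measurable; integrating over the direction leaves a measurable function of
  \<open>t\<close>.\<close>

lemma borel_measurable_steiner_point_local_part: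
  "(\<lambda>t. steiner_point (local_part (conj_epi (h t)) a)) \<in> borel_measurable M"
proof -
  interpret prob_space "sphere_measure :: ('a \<times> real) measure" by (rule prob_space_sphere_measure)
  let ?h = "\<lambda>t. support_fn (local_part (conj_epi (h t)) a)"
  note [measurable] = borel_measurable_support_fn_local_part
  have "(\<lambda>z. ?h (fst z) (snd z)) \<in> borel_measurable (M \<Otimes>\<^sub>M sphere_measure)"
  proof (rule borel_measurable_caratheodory[where F="\<lambda>z. ?h (fst z)" and u=snd])
    show "continuous_on UNIV (?h (fst z))" if "z \<in> space (M \<Otimes>\<^sub>M sphere_measure)" for z
    proof -
      have "fst z \<in> space M" using that by (auto simp: space_pair_measure)
      then show ?thesis
        using conj_epi_nonempty closed_conj_epi
        by (intro continuous_support_fn compact_imp_bounded compact_local_part local_part_nonempty)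
    qed
  qed measurable
  then have [measurable]: "case_prod ?h \<in> borel_measurable (M \<Otimes>\<^sub>M sphere_measure)"
    by (simp add: case_prod_beta')
  show ?thesis
    unfolding steiner_point_def
    by (intro borel_measurable_scaleR borel_measurable_const borel_measurable_lebesgue_integral) measurable
qed

end

section \<open>Absolutely continuous functions\<close>

lemma AE_lebesgue_on_iff_negligible:
  assumes "S \<in> sets lebesgue"
  shows "(AE t in lebesgue_on S. P t) \<longleftrightarrow> (\<exists>N. negligible N \<and> (\<forall>t\<in>S - N. P t))"
proof -
  have "(AE t in lebesgue_on S. P t) \<longleftrightarrow> (\<exists>N. negligible N \<and> {t. \<not> (t \<in> S \<longrightarrow> P t)} \<subseteq> N)"
    using assms by (simp add: AE_restrict_space_iff eventually_ae_filter_negligible)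
  moreover have "{t. \<not> (t \<in> S \<longrightarrow> P t)} \<subseteq> N \<longleftrightarrow> (\<forall>t\<in>S - N. P t)" for N by auto
  ultimately show ?thesis by simp
qed

lemma abs_cont_on_subset:
  assumes ac: "abs_cont_on S y" and sub: "S' \<subseteq> S"
  shows "abs_cont_on S' y"
  using ac unfolding abs_cont_on_def
  by (elim ex_forward all_forward conj_forward imp_forward) (use sub in \<open>auto dest: subsetD\<close>)

text \<open>Absolute continuity speaks of intervals indexed by numbers, tagged divisions are sets of
  pairs. Enumerating the division carries the estimate over.\<close>

lemma abs_cont_on_tagged_sum:
  fixes y :: "real \<Rightarrow> 'b::real_normed_vector"
  assumes d: "\<And>(N::nat) u v. (\<forall>i<N. u i \<in> S \<and> v i \<in> S \<and> u i \<le> v i) \<Longrightarrow>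
        (\<forall>i<N. \<forall>j<N. i \<noteq> j \<longrightarrow> {u i<..<v i} \<inter> {u j<..<v j} = {}) \<Longrightarrow>
        (\<Sum>i<N. v i - u i) < d \<Longrightarrow> (\<Sum>i<N. norm (y (v i) - y (u i))) < e"
    and p: "finite p" "\<And>x K. (x, K) \<in> p \<Longrightarrow> Inf K \<in> S \<and> Sup K \<in> S \<and> Inf K \<le> Sup K"
    and disj: "\<And>x K x' K'. (x, K) \<in> p \<Longrightarrow> (x', K') \<in> p \<Longrightarrow> (x, K) \<noteq> (x', K') \<Longrightarrow>
      {Inf K<..<Sup K} \<inter> {Inf K'<..<Sup K'} = {}"
    and small: "(\<Sum>(x, K)\<in>p. Sup K - Inf K) < d"
  shows "(\<Sum>(x, K)\<in>p. norm (y (Sup K) - y (Inf K))) < e"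
proof -
  obtain n and f :: "nat \<Rightarrow> _" where f: "bij_betw f {..<n} p"
    using ex_bij_betw_nat_finite[OF p(1)] by (auto simp: atLeast0LessThan)
  have fp: "f i \<in> p" if "i < n" for i using f that by (auto simp: bij_betw_def)
  have inj: "f i \<noteq> f j" if "i < n" "j < n" "i \<noteq> j" for i j
    using f that by (auto simp: bij_betw_def inj_on_def)
  have "(\<Sum>i<n. norm (y (Sup (snd (f i))) - y (Inf (snd (f i))))) < e"
  proof (rule d)
    show "\<forall>i<n. Inf (snd (f i)) \<in> S \<and> Sup (snd (f i)) \<in> S \<and> Inf (snd (f i)) \<le> Sup (snd (f i))"
      using fp p(2) by (metis prod.collapse)
    show "\<forall>i<n. \<forall>j<n. i \<noteq> j \<longrightarrow> {Inf (snd (f i))<..<Sup (snd (f i))} \<inter> {Inf (snd (f j))<..<Sup (snd (f j))} = {}"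
      using fp disj inj by (metis prod.collapse)
    show "(\<Sum>i<n. Sup (snd (f i)) - Inf (snd (f i))) < d"
      using small sum.reindex_bij_betw[OF f, of "\<lambda>(x, K). Sup K - Inf K"] by (simp add: case_prod_beta')
  qed
  then show ?thesis
    using sum.reindex_bij_betw[OF f, of "\<lambda>(x, K). norm (y (Sup K) - y (Inf K))"] by (simp add: case_prod_beta')
qed

text \<open>Tags in the exceptional null set are confined to an open set of small measure, on which
  absolute continuity controls the increments; the other tags are handled as for the classical
  fundamental theorem.\<close>
lemma fundamental_theorem_of_calculus_abs_cont:
  fixes y :: "real \<Rightarrow> 'b::euclidean_space"
  assumes ab: "a \<le> b" and ac: "abs_cont_on {a..b} y"
    and der: "AE t in lebesgue_on {a..b}. (y has_vector_derivative \<phi> t) (at t within {a..b})"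
  shows "(\<phi> has_integral (y b - y a)) {a..b}"
proof -
  obtain N where N: "negligible N" "\<And>t. t \<in> {a..b} - N \<Longrightarrow> (y has_vector_derivative \<phi> t) (at t within {a..b})"
    using der by (auto simp: AE_lebesgue_on_iff_negligible)
  \<comment> \<open>With the value 0 on \<open>N\<close>, a tag in \<open>N\<close> adds nothing but
    the increment of \<open>y\<close> to the error.\<close>
  define \<psi> where "\<psi> t = (if t \<in> N then 0 else \<phi> t)" for t
  have "(\<psi> has_integral (y b - y a)) {a..b}"
    unfolding has_integral_real
  proof safe
    fix e :: real assume e: "e > 0"
    \<comment> \<open>Half of \<open>e\<close> is spent on the tags outside \<open>N\<close>, the
      other half on those inside; the summand 1 keeps the denominator positive when
      \<open>a = b\<close>.\<close>
    define e' where "e' = e / (2 * (b - a + 1))"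
    have e': "e' > 0" using e ab by (simp add: e'_def)
    have "\<forall>x. \<exists>d>0. x \<in> {a..b} - N \<longrightarrow>
         (\<forall>z\<in>{a..b}. norm (z - x) < d \<longrightarrow> norm (y z - y x - (z - x) *\<^sub>R \<phi> x) \<le> e' * norm (z - x))"
      using N(2)[unfolded has_vector_derivative_def has_derivative_within_alt] e' by (metis zero_less_one)
    then obtain d where d: "\<And>x. 0 < d x"
        "\<And>x z. \<lbrakk>x \<in> {a..b} - N; z \<in> {a..b}; norm (z-x) < d x\<rbrakk>
                        \<Longrightarrow> norm (y z - y x - (z-x) *\<^sub>R \<phi> x) \<le> e' * norm (z-x)"
      by metis
    obtain r where r: "r > 0" "\<And>(n::nat) u v. (\<forall>i<n. u i \<in> {a..b} \<and> v i \<in> {a..b} \<and> u i \<le> v i) \<Longrightarrow>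
        (\<forall>i<n. \<forall>j<n. i \<noteq> j \<longrightarrow> {u i<..<v i} \<inter> {u j<..<v j} = {}) \<Longrightarrow>
        (\<Sum>i<n. v i - u i) < r \<Longrightarrow> (\<Sum>i<n. norm (y (v i) - y (u i))) < e / 2"
    proof -
      have "0 < e / 2" using e by simp
      from ac[unfolded abs_cont_on_def, rule_format, OF this] show ?thesis
        using that by blast
    qed
    obtain U where U: "open U" "N \<subseteq> U" "U \<in> lmeasurable" "measure lebesgue U < r"
    proof -
      have "N \<in> sets lebesgue" using N(1) by (rule negligible_imp_sets)
      then obtain T where T: "open T" "N \<subseteq> T" "T - N \<in> lmeasurable" "emeasure lebesgue (T - N) < ennreal r"
        using sets_lebesgue_outer_open r(1) by metis
      have N0: "N \<in> lmeasurable" "measure lebesgue N = 0"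
        using N(1) negligible_iff_measure by auto
      have eq: "T = (T - N) \<union> N" using T(2) by auto
      have "T \<in> lmeasurable" using T(3) N0(1) eq by (metis fmeasurable.Un)
      moreover have "measure lebesgue T \<le> measure lebesgue (T - N) + measure lebesgue N"
        by (subst eq) (rule measure_Un_le, use T N0 in auto)
      moreover have "measure lebesgue (T - N) < r"
        using T(4) r(1) by (metis T(3) emeasure_eq_measure2 ennreal_less_iff measure_nonneg)
      ultimately show ?thesis using that T N0 by auto
    qed
    have "\<exists>\<rho>>0. x \<in> N \<longrightarrow> ball x \<rho> \<subseteq> U" for x
      using U(1,2) by (metis openE subset_eq zero_less_one)
    then obtain \<rho> where \<rho>: "\<And>x. 0 < \<rho> x" "\<And>x. x \<in> N \<Longrightarrow> ball x (\<rho> x) \<subseteq> U" by metis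
    define \<gamma> where "\<gamma> x = ball x (if x \<in> N then \<rho> x else d x)" for x
    have "gauge \<gamma>" unfolding \<gamma>_def using d(1) \<rho>(1) by (intro gauge_ball_dependent) auto
    moreover have est: "norm ((\<Sum>(x, K)\<in>p. measure lborel K *\<^sub>R \<psi> x) - (y b - y a)) < e"
      if p: "p tagged_division_of {a..b}" "\<gamma> fine p" for p
    proof -
      have fin: "finite p" using p(1) by auto
      have K: "\<exists>u v. K = {u..v} \<and> u \<le> v \<and> Inf K = u \<and> Sup K = v \<and> measure lborel K = v - u \<and> {u..v} \<subseteq> {a..b} \<and> x \<in> {u..v} \<and> {u..v} \<subseteq> \<gamma> x"
        if "(x, K) \<in> p" for x K
      proof -
        obtain u v where uv: "K = {u..v}" using tagged_division_ofD(4)[OF p(1) \<open>(x, K) \<in> p\<close>] by auto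
        moreover have "x \<in> K" "K \<subseteq> {a..b}" using p(1) that by blast+
        moreover have "K \<subseteq> \<gamma> x" using p(2) that by (auto simp: fine_def)
        ultimately show ?thesis by auto
      qed
      let ?N = "{z\<in>p. fst z \<in> N}" and ?G = "{z\<in>p. fst z \<notin> N}"
      let ?D = "\<lambda>(x, K). y (Sup K) - y (Inf K)"
      have len: "(\<Sum>(x, K)\<in>p. Sup K - Inf K) = b - a"
        using additive_tagged_division_1[OF ab p(1), of "\<lambda>x. x"] by simp
      have yy: "y b - y a = (\<Sum>z\<in>p. ?D z)"
        using additive_tagged_division_1[OF ab p(1), of y] by simp
      have int: "interior K = {Inf K<..<Sup K}" if "(x, K) \<in> p" for x K
      proof -
        obtain u v where "K = {u..v}" "Inf K = u" "Sup K = v" using K[OF \<open>(x, K) \<in> p\<close>] by blast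
        then show ?thesis by simp
      qed
      have disj: "{Inf K<..<Sup K} \<inter> {Inf K'<..<Sup K'} = {}"
        if "(x, K) \<in> p" "(x', K') \<in> p" "(x, K) \<noteq> (x', K')" for x K x' K'
        using p(1) that int by (metis tagged_division_ofD(5))
      have bad: "(\<Sum>(x, K)\<in>?N. norm (y (Sup K) - y (Inf K))) < e / 2"
      proof (rule abs_cont_on_tagged_sum[OF r(2)])
        show "Inf K \<in> {a..b} \<and> Sup K \<in> {a..b} \<and> Inf K \<le> Sup K" if "(x, K) \<in> ?N" for x K
          using K[of x K] that by auto
        have "(\<Sum>(x, K)\<in>?N. Sup K - Inf K) = (\<Sum>z\<in>?N. measure lebesgue {Inf (snd z)<..<Sup (snd z)})"
        proof (rule sum.cong[OF refl], clarify)
          fix x K assume "(x, K) \<in> p" "fst (x, K) \<in> N"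
          then show "Sup K - Inf K = measure lebesgue {Inf (snd (x, K))<..<Sup (snd (x, K))}"
            using K[of x K] by (auto simp: measure_completion)
        qed
        also have "\<dots> = measure lebesgue (\<Union>z\<in>?N. {Inf (snd z)<..<Sup (snd z)})"
        proof (rule measure_finite_Union[symmetric])
          show "disjoint_family_on (\<lambda>z. {Inf (snd z)<..<Sup (snd z)}) ?N"
            using disj unfolding disjoint_family_on_def by (metis (no_types, lifting) mem_Collect_eq prod.collapse)
          show "emeasure lebesgue {Inf (snd z)<..<Sup (snd z)} \<noteq> \<infinity>" if "z \<in> ?N" for z
          proof -
            have "Inf (snd z) \<le> Sup (snd z)" using K[of "fst z" "snd z"] that by auto
            then show ?thesis by simp
          qed
        qed (use fin in auto)
        also have "\<dots> \<le> measure lebesgue U"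
        proof (rule measure_mono_fmeasurable)
          show "(\<Union>z\<in>?N. {Inf (snd z)<..<Sup (snd z)}) \<subseteq> U"
          proof safe
            fix x K t assume xK: "(x, K) \<in> p" "fst (x, K) \<in> N" "t \<in> {Inf (snd (x, K))<..<Sup (snd (x, K))}"
            obtain u v where "Inf K = u" "Sup K = v" "{u..v} \<subseteq> \<gamma> x" using K[OF xK(1)] by blast
            moreover have "\<gamma> x \<subseteq> U" using \<rho>(2)[of x] xK(2) by (simp add: \<gamma>_def)
            moreover from calculation have "t \<in> {u..v}" using xK(3) by simp
            ultimately show "t \<in> U" by blast
          qed
        qed (use U(3) fin in auto)
        finally show "(\<Sum>(x, K)\<in>?N. Sup K - Inf K) < r" using U(4) by simp
      qed (use fin disj in auto)
      have good: "norm (measure lborel K *\<^sub>R \<psi> x - (y (Sup K) - y (Inf K))) \<le> e' * (Sup K - Inf K)"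
        if xK: "(x, K) \<in> p" "x \<notin> N" for x K
      proof -
        obtain u v where uv: "u \<le> v" "Inf K = u" "Sup K = v" "measure lborel K = v - u"
            "{u..v} \<subseteq> {a..b}" "x \<in> {u..v}" "{u..v} \<subseteq> ball x (d x)"
          using K[OF xK(1)] xK(2) by (auto simp: \<gamma>_def)
        have x: "x \<in> {a..b} - N" using uv xK by auto
        have mem: "u \<in> {a..b}" "v \<in> {a..b}" "norm (u - x) < d x" "norm (v - x) < d x"
        proof -
          have "u \<in> {u..v}" "v \<in> {u..v}" using uv(1) by auto
          then have "u \<in> {a..b} \<inter> ball x (d x)" "v \<in> {a..b} \<inter> ball x (d x)" using uv(5,7) by blast+
          then show "u \<in> {a..b}" "v \<in> {a..b}" "norm (u - x) < d x" "norm (v - x) < d x"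
            by (auto simp: dist_real_def)
        qed
        have "norm ((v - u) *\<^sub>R \<phi> x - (y v - y u))
            = norm ((y u - y x - (u - x) *\<^sub>R \<phi> x) - (y v - y x - (v - x) *\<^sub>R \<phi> x))"
          by (auto simp: algebra_simps)
        also have "\<dots> \<le> e' * norm (u - x) + e' * norm (v - x)"
          using d(2)[OF x mem(1,3)] d(2)[OF x mem(2,4)] norm_triangle_ineq4 by (meson add_mono order_trans)
        also have "\<dots> = e' * (v - u)" using uv(6) by (simp add: algebra_simps)
        finally show ?thesis using uv xK by (simp add: \<psi>_def)
      qed
      have "(\<Sum>(x, K)\<in>p. measure lborel K *\<^sub>R \<psi> x) - (y b - y a)
          = (\<Sum>z\<in>p. measure lborel (snd z) *\<^sub>R \<psi> (fst z) - ?D z)"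
        by (simp add: yy sum_subtractf case_prod_beta')
      also have "norm \<dots> \<le> (\<Sum>z\<in>p. norm (measure lborel (snd z) *\<^sub>R \<psi> (fst z) - ?D z))"
        by (rule norm_sum)
      also have "\<dots> = (\<Sum>z\<in>?N. norm (measure lborel (snd z) *\<^sub>R \<psi> (fst z) - ?D z)) + (\<Sum>z\<in>?G. norm (measure lborel (snd z) *\<^sub>R \<psi> (fst z) - ?D z))"
        using fin by (subst sum.union_disjoint[symmetric]) (auto intro!: sum.cong)
      also have "(\<Sum>z\<in>?N. norm (measure lborel (snd z) *\<^sub>R \<psi> (fst z) - ?D z)) = (\<Sum>(x, K)\<in>?N. norm (y (Sup K) - y (Inf K)))"
        by (intro sum.cong) (auto simp: \<psi>_def norm_minus_commute)
      also have "(\<Sum>z\<in>?G. norm (measure lborel (snd z) *\<^sub>R \<psi> (fst z) - ?D z)) \<le> (\<Sum>(x, K)\<in>?G. e' * (Sup K - Inf K))"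
        using good by (intro sum_mono) auto
      also have "\<dots> \<le> (\<Sum>(x, K)\<in>p. e' * (Sup K - Inf K))"
      proof (intro sum_mono2 fin)
        fix z assume "z \<in> p - ?G"
        then show "0 \<le> (case z of (x, K) \<Rightarrow> e' * (Sup K - Inf K))"
          using K[of "fst z" "snd z"] e' by (auto simp: case_prod_beta')
      qed auto
      also have "\<dots> = e' * (b - a)" by (simp add: len[symmetric] sum_distrib_left case_prod_beta')
      also have "e' * (b - a) \<le> e / 2" using e ab by (simp add: e'_def field_simps)
      finally show ?thesis using bad by simp
    qed
    ultimately show "\<exists>\<gamma>. gauge \<gamma> \<and> (\<forall>\<D>. \<D> tagged_division_of {a..b} \<and> \<gamma> fine \<D> \<longrightarrow>
        norm ((\<Sum>(x, K)\<in>\<D>. measure lborel K *\<^sub>R \<psi> x) - (y b - y a)) < e)"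
      by (intro exI[of _ \<gamma>] conjI allI impI) (simp, elim conjE, rule est)
  qed
  then show ?thesis
    by (rule has_integral_spike[OF N(1), rotated]) (auto simp: \<psi>_def)
qed

lemma fundamental_theorem_of_calculus_abs_cont_interval:
  fixes y :: "real \<Rightarrow> 'b::euclidean_space"
  assumes ac: "abs_cont_on {a..b} y"
    and der: "AE t in lebesgue_on {a..b}. (y has_vector_derivative \<phi> t) (at t within {a..b})"
    and st: "a \<le> s" "s \<le> t" "t \<le> b"
  shows "(\<phi> has_integral (y t - y s)) {s..t}"
proof (rule fundamental_theorem_of_calculus_abs_cont[OF st(2)])
  have sub: "{s..t} \<subseteq> {a..b}" using st by auto
  show "abs_cont_on {s..t} y" by (rule abs_cont_on_subset[OF ac sub])
  obtain N where "negligible N" "\<And>t. t \<in> {a..b} - N \<Longrightarrow> (y has_vector_derivative \<phi> t) (at t within {a..b})"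
    using der by (auto simp: AE_lebesgue_on_iff_negligible)
  then show "AE r in lebesgue_on {s..t}. (y has_vector_derivative \<phi> r) (at r within {s..t})"
    using sub has_vector_derivative_within_subset[OF _ sub]
    by (subst AE_lebesgue_on_iff_negligible) (simp, blast)
qed

lemma integral_diff_interval:
  fixes f :: "real \<Rightarrow> 'b::banach"
  assumes "f integrable_on {a..b}" "a \<le> s" "s \<le> t" "t \<le> b"
  shows "integral {a..t} f - integral {a..s} f = integral {s..t} f"
  using Henstock_Kurzweil_Integration.integral_combine[of a s t f] assms integrable_subinterval_real[of f a b a t]
  by (simp add: algebra_simps)

text \<open>Absolute continuity of the integral: \<open>m\<close> is cut at a height
  \<open>k\<close> that leaves a remainder \<open>g\<close> of integral below \<open>e / 2\<close>.
  The bounded part is controlled by the total length of the intervals, the remainder by its integral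
  over all of \<open>{a..b}\<close>.\<close>

lemma abs_cont_on_dominated:
  fixes x :: "real \<Rightarrow> 'b::real_normed_vector"
  assumes m: "m integrable_on {a..b}" and m0: "\<And>t. t \<in> {a..b} \<Longrightarrow> 0 \<le> m t"
    and dom: "\<And>s t. a \<le> s \<Longrightarrow> s \<le> t \<Longrightarrow> t \<le> b \<Longrightarrow> norm (x t - x s) \<le> integral {s..t} m"
  shows "abs_cont_on {a..b} x"
  unfolding abs_cont_on_def
proof (intro allI impI)
  fix e :: real assume e: "0 < e"
  have min_int: "(\<lambda>t. min (m t) (real k)) integrable_on {a..b}" for k
  proof -
    have "m absolutely_integrable_on {a..b}"
      using m m0 by (intro nonnegative_absolutely_integrable_1) auto
    then show ?thesis
      by (intro set_lebesgue_integral_eq_integral(1) absolutely_integrable_min_1) auto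
  qed
  have "(\<lambda>k. integral {a..b} (\<lambda>t. min (m t) (real k))) \<longlonglongrightarrow> integral {a..b} m"
  proof (rule dominated_convergence(2)[OF min_int m])
    show "norm (min (m t) (real k)) \<le> m t" if "t \<in> {a..b}" for k t using m0[OF that] by auto
    show "(\<lambda>k. min (m t) (real k)) \<longlonglongrightarrow> m t" if "t \<in> {a..b}" for t
    proof (rule tendsto_eventually)
      obtain k0 :: nat where "m t \<le> k0" using real_arch_simple by blast
      then show "\<forall>\<^sub>F k in sequentially. min (m t) (real k) = m t"
        by (intro eventually_sequentiallyI[of k0]) (auto simp: min_def)
    qed
  qed
  then obtain k where k: "norm (integral {a..b} (\<lambda>t. min (m t) (real k)) - integral {a..b} m) < e / 2"
    using e LIMSEQ_D[of _ _ "e / 2"] by (metis half_gt_zero order_refl)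
  define g where "g t = m t - min (m t) (real k)" for t
  have g_int: "g integrable_on {a..b}" unfolding g_def by (intro integrable_diff m min_int)
  have g0: "0 \<le> g t" for t by (simp add: g_def)
  have "integral {a..b} g = integral {a..b} m - integral {a..b} (\<lambda>t. min (m t) (real k))"
    unfolding g_def using m min_int by (rule integral_diff)
  then have g_small: "integral {a..b} g < e / 2" using k by (simp add: abs_if split: if_splits)
  \<comment> \<open>Intervals of total length below \<open>d\<close> contribute at most
    \<open>real k * d \<le> e / 2\<close> from the bounded part.\<close>
  define d where "d = e / (2 * (real k + 1))"
  have d: "0 < d" using e by (simp add: d_def)
  have est: "(\<Sum>i<N. norm (x (v i) - x (u i))) < e"
    if A: "\<forall>i<N. u i \<in> {a..b} \<and> v i \<in> {a..b} \<and> u i \<le> v i"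
      and D: "\<forall>i<N. \<forall>j<N. i \<noteq> j \<longrightarrow> {u i<..<v i} \<inter> {u j<..<v j} = {}"
      and L: "(\<Sum>i<N. v i - u i) < d" for N :: nat and u v :: "nat \<Rightarrow> real"
  proof -
    have sub: "{u i..v i} \<subseteq> {a..b}" if "i < N" for i using A that by auto
    \<comment> \<open>The open intervals are the ones assumed disjoint: at each point at most one
      \<open>G i\<close> is nonzero, so the sum stays below \<open>g\<close>.\<close>
    define G where "G i t = (if t \<in> {u i<..<v i} then g t else 0)" for i t
    have G: "G i integrable_on {a..b}" "integral {a..b} (G i) = integral {u i..v i} g" if "i < N" for i
    proof -
      have eq: "{u i<..<v i} \<inter> {a..b} = {u i<..<v i}" using A that by auto
      show "G i integrable_on {a..b}"
        unfolding G_def integrable_restrict_Int eq integrable_on_open_interval_real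
        by (rule integrable_subinterval_real[OF g_int sub[OF that]])
      show "integral {a..b} (G i) = integral {u i..v i} g"
      proof -
        have "integral {a..b} (G i) = integral ({u i<..<v i} \<inter> {a..b}) g"
          unfolding G_def by (rule Henstock_Kurzweil_Integration.integral_restrict_Int)
        also have "\<dots> = integral {u i..v i} g"
          unfolding eq by (rule integral_open_interval_real[symmetric])
        finally show ?thesis .
      qed
    qed
    have le: "norm (x (v i) - x (u i)) \<le> integral {u i..v i} g + real k * (v i - u i)" if i: "i < N" for i
    proof -
      have "norm (x (v i) - x (u i)) \<le> integral {u i..v i} m" using A i by (intro dom) auto
      also have "\<dots> \<le> integral {u i..v i} (\<lambda>t. g t + real k)"
        using sub[OF i] by (intro integral_le integrable_add integrable_subinterval_real[OF m] integrable_subinterval_real[OF g_int])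
          (auto simp: g_def)
      also have "\<dots> = integral {u i..v i} g + integral {u i..v i} (\<lambda>t. real k)"
        using sub[OF i] by (intro integral_add integrable_subinterval_real[OF g_int]) auto
      finally show ?thesis using A i by (simp add: mult.commute)
    qed
    have "(\<Sum>i<N. norm (x (v i) - x (u i))) \<le> (\<Sum>i<N. integral {u i..v i} g + real k * (v i - u i))"
      using le by (intro sum_mono) auto
    also have "\<dots> = (\<Sum>i<N. integral {a..b} (G i)) + real k * (\<Sum>i<N. v i - u i)"
      using G by (simp add: sum.distrib sum_distrib_left)
    also have "(\<Sum>i<N. integral {a..b} (G i)) = integral {a..b} (\<lambda>t. \<Sum>i<N. G i t)"
      using G by (intro integral_sum[symmetric]) auto
    also have "\<dots> \<le> integral {a..b} g"
    proof (rule integral_le)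
      show "(\<lambda>t. \<Sum>i<N. G i t) integrable_on {a..b}" using G by (intro integrable_sum) auto
      show "(\<Sum>i<N. G i t) \<le> g t" for t
      proof (cases "\<exists>i<N. t \<in> {u i<..<v i}")
        case True
        then obtain i where i: "i < N" "t \<in> {u i<..<v i}" by blast
        have "G j t = 0" if "j < N" "j \<noteq> i" for j
        proof -
          have "{u i<..<v i} \<inter> {u j<..<v j} = {}" using D i(1) that by metis
          then have "t \<notin> {u j<..<v j}" using i(2) by blast
          then show ?thesis unfolding G_def by (rule if_not_P)
        qed
        then have "(\<Sum>j<N. G j t) = (\<Sum>j\<in>{i}. G j t)"
          using i(1) by (intro sum.mono_neutral_right) auto
        then show ?thesis using i by (simp add: G_def)
      next
        case False
        then have "(\<Sum>i<N. G i t) = 0" by (intro sum.neutral) (auto simp: G_def)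
        then show ?thesis using g0 by simp
      qed
    qed (rule g_int)
    also have "real k * (\<Sum>i<N. v i - u i) \<le> real k * d" using L by (intro mult_left_mono) auto
    also have "real k * d \<le> e / 2" using e by (simp add: d_def field_simps)
    finally show ?thesis using g_small by simp
  qed
  show "\<exists>d>0. \<forall>N::nat. \<forall>u v :: nat \<Rightarrow> real. (\<forall>i<N. u i \<in> {a..b} \<and> v i \<in> {a..b} \<and> u i \<le> v i) \<and>
      (\<forall>i<N. \<forall>j<N. i \<noteq> j \<longrightarrow> {u i<..<v i} \<inter> {u j<..<v j} = {}) \<and> (\<Sum>i<N. v i - u i) < d \<longrightarrow>
      (\<Sum>i<N. norm (x (v i) - x (u i))) < e"
  proof (intro exI[of _ d] conjI allI impI)
    show "0 < d" by (rule d)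
  next
    fix N :: nat and u v :: "nat \<Rightarrow> real"
    assume A: "(\<forall>i<N. u i \<in> {a..b} \<and> v i \<in> {a..b} \<and> u i \<le> v i) \<and>
      (\<forall>i<N. \<forall>j<N. i \<noteq> j \<longrightarrow> {u i<..<v i} \<inter> {u j<..<v j} = {}) \<and> (\<Sum>i<N. v i - u i) < d"
    show "(\<Sum>i<N. norm (x (v i) - x (u i))) < e"
      by (rule est[OF A[THEN conjunct1] A[THEN conjunct2, THEN conjunct1] A[THEN conjunct2, THEN conjunct2]])
  qed
qed

text \<open>The differentiation theorem \<open>integrable_ccontinuous_explicit\<close> averages over
  intervals to the right of a point. Applying it to the reflected function
  \<open>\<psi> (- t)\<close> gives the averages to the left.\<close>

lemma AE_integral_has_vector_derivative:
  fixes \<phi> :: "real \<Rightarrow> 'b::euclidean_space"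
  assumes "\<phi> integrable_on {a..b}"
  shows "AE t in lebesgue_on {a..b}. ((\<lambda>t. integral {a..t} \<phi>) has_vector_derivative \<phi> t) (at t within {a..b})"
proof -
  define \<psi> where "\<psi> t = (if t \<in> {a..b} then \<phi> t else 0)" for t
  have int: "\<psi> integrable_on {c..d}" for c d
    unfolding \<psi>_def integrable_restrict_Int Int_atLeastAtMost
    by (rule integrable_subinterval_real[OF assms]) auto
  have intr: "(\<lambda>t. \<psi> (- t)) integrable_on {c..d}" for c d
  proof -
    have "(\<lambda>t. \<psi> (- t)) integrable_on {- (- c)..- (- d)}"
      by (subst Henstock_Kurzweil_Integration.integrable_reflect_real) (rule int)
    then show ?thesis by simp
  qed
  obtain N1 where N1: "negligible N1" "\<And>x e. \<lbrakk>x \<notin> N1; 0 < e\<rbrakk> \<Longrightarrow>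
      \<exists>d>0. \<forall>h. 0 < h \<and> h < d \<longrightarrow> norm (integral {x..x + h} \<psi> /\<^sub>R h - \<psi> x) < e"
    using integrable_ccontinuous_explicit[of \<psi>] int by (auto simp: cbox_interval)
  obtain N2 where N2: "negligible N2" "\<And>x e. \<lbrakk>x \<notin> N2; 0 < e\<rbrakk> \<Longrightarrow>
      \<exists>d>0. \<forall>h. 0 < h \<and> h < d \<longrightarrow> norm (integral {x..x + h} (\<lambda>t. \<psi> (- t)) /\<^sub>R h - \<psi> (- x)) < e"
    using integrable_ccontinuous_explicit[of "\<lambda>t. \<psi> (- t)"] intr by (auto simp: cbox_interval)
  have N2': "negligible (uminus ` N2)"
    using N2(1) by (intro negligible_differentiable_image_negligible) (auto intro!: derivative_intros)
  have "((\<lambda>t. integral {a..t} \<phi>) has_vector_derivative \<phi> t) (at t within {a..b})"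
    if t: "t \<in> {a..b} - (N1 \<union> uminus ` N2)" for t
    unfolding has_vector_derivative_def has_derivative_within_alt
  proof (intro conjI allI impI bounded_linear_scaleR_left)
    fix e :: real assume e: "0 < e"
    obtain d1 where d1: "d1 > 0" "\<And>h. 0 < h \<Longrightarrow> h < d1 \<Longrightarrow> norm (integral {t..t + h} \<psi> /\<^sub>R h - \<psi> t) < e"
      using N1(2)[of t e] t e by auto
    have "- t \<notin> N2" using t by force
    then obtain d2 where d2: "d2 > 0" "\<And>h. 0 < h \<Longrightarrow> h < d2 \<Longrightarrow> norm (integral {- t..- t + h} (\<lambda>t. \<psi> (- t)) /\<^sub>R h - \<psi> t) < e"
      using N2(2)[of "- t" e] e by auto
    have refl: "integral {- t..- t + h} (\<lambda>t. \<psi> (- t)) = integral {t - h..t} \<psi>" for h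
      using Henstock_Kurzweil_Integration.integral_reflect_real[of t "t - h" \<psi>] by (simp add: algebra_simps)
    have scale: "norm (I - h *\<^sub>R \<psi> t) \<le> e * h" if "norm (I /\<^sub>R h - \<psi> t) < e" "0 < h" for I h
    proof -
      have "I - h *\<^sub>R \<psi> t = h *\<^sub>R (I /\<^sub>R h - \<psi> t)" using that(2) by (simp add: algebra_simps)
      then have "norm (I - h *\<^sub>R \<psi> t) = h * norm (I /\<^sub>R h - \<psi> t)" using that(2) by simp
      then show ?thesis using that by (simp add: mult.commute)
    qed
    have eq: "integral {s..s'} \<phi> = integral {s..s'} \<psi>" if "a \<le> s" "s' \<le> b" for s s'
      using that by (intro Henstock_Kurzweil_Integration.integral_cong) (auto simp: \<psi>_def)
    have pt: "\<psi> t = \<phi> t" using t by (simp add: \<psi>_def)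
    show "\<exists>d>0. \<forall>y\<in>{a..b}. norm (y - t) < d \<longrightarrow>
        norm (integral {a..y} \<phi> - integral {a..t} \<phi> - (y - t) *\<^sub>R \<phi> t) \<le> e * norm (y - t)"
    proof (intro exI[of _ "min d1 d2"] conjI ballI impI)
      fix y assume y: "y \<in> {a..b}" "norm (y - t) < min d1 d2"
      consider "y = t" | "t < y" | "y < t" by linarith
      then show "norm (integral {a..y} \<phi> - integral {a..t} \<phi> - (y - t) *\<^sub>R \<phi> t) \<le> e * norm (y - t)"
      proof cases
        case 2
        have "integral {a..y} \<phi> - integral {a..t} \<phi> = integral {t..y} \<psi>"
          using integral_diff_interval[OF assms, of t y] eq[of t y] t y 2 by auto
        then show ?thesis using scale[where I="integral {t..y} \<psi>" and h="y - t"] d1(2)[of "y - t"] y 2 pt by auto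
      next
        case 3
        have "integral {a..t} \<phi> - integral {a..y} \<phi> = integral {y..t} \<psi>"
          using integral_diff_interval[OF assms, of y t] eq[of y t] t y 3 by auto
        then have *: "integral {a..y} \<phi> - integral {a..t} \<phi> - (y - t) *\<^sub>R \<phi> t = - (integral {y..t} \<psi> - (t - y) *\<^sub>R \<psi> t)"
          using pt by (simp add: algebra_simps)
        have "norm (integral {y..t} \<psi> - (t - y) *\<^sub>R \<psi> t) \<le> e * (t - y)"
          using scale[where I="integral {y..t} \<psi>" and h="t - y"] d2(2)[of "t - y"] refl[of "t - y"] y 3 by auto
        then show ?thesis unfolding * norm_minus_cancel using 3 by simp
      qed simp
    qed (use d1 d2 in auto)
  qed
  then show ?thesis
    using negligible_Un[OF N1(1) N2'] by (subst AE_lebesgue_on_iff_negligible) (simp, metis)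
qed

text \<open>At a common differentiability point of the two primitives the averages over
  \<open>{t..t + h}\<close> approach \<open>\<phi> t\<close> and \<open>m t\<close>. The point
  \<open>b\<close>, which leaves no room on its right, joins the exceptional set.\<close>

lemma AE_norm_le_of_integral_le:
  fixes \<phi> :: "real \<Rightarrow> 'b::euclidean_space"
  assumes \<phi>: "\<phi> integrable_on {a..b}" and m: "m integrable_on {a..b}"
    and le: "\<And>s t. a \<le> s \<Longrightarrow> s \<le> t \<Longrightarrow> t \<le> b \<Longrightarrow> norm (integral {s..t} \<phi>) \<le> integral {s..t} m"
  shows "AE t in lebesgue_on {a..b}. norm (\<phi> t) \<le> m t"
proof -
  obtain N1 where N1: "negligible N1" "\<And>t. t \<in> {a..b} - N1 \<Longrightarrow> ((\<lambda>t. integral {a..t} \<phi>) has_vector_derivative \<phi> t) (at t within {a..b})"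
    using AE_integral_has_vector_derivative[OF \<phi>] by (auto simp: AE_lebesgue_on_iff_negligible)
  obtain N2 where N2: "negligible N2" "\<And>t. t \<in> {a..b} - N2 \<Longrightarrow> ((\<lambda>t. integral {a..t} m) has_vector_derivative m t) (at t within {a..b})"
    using AE_integral_has_vector_derivative[OF m] by (auto simp: AE_lebesgue_on_iff_negligible)
  have "norm (\<phi> t) \<le> m t" if t: "t \<in> {a..b} - (insert b (N1 \<union> N2))" for t
  proof (rule field_le_epsilon)
    fix e :: real assume e: "0 < e"
    then have e2: "0 < e / 2" by simp
    have t': "t \<in> {a..b} - N1" "t \<in> {a..b} - N2" "t < b" "a \<le> t" using t by auto
    obtain d1 where d1: "d1 > 0" "\<And>y. y \<in> {a..b} \<Longrightarrow> norm (y - t) < d1 \<Longrightarrow>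
        norm (integral {a..y} \<phi> - integral {a..t} \<phi> - (y - t) *\<^sub>R \<phi> t) \<le> e / 2 * norm (y - t)"
      using N1(2)[OF t'(1)] e2 unfolding has_vector_derivative_def has_derivative_within_alt by blast
    obtain d2 where d2: "d2 > 0" "\<And>y. y \<in> {a..b} \<Longrightarrow> norm (y - t) < d2 \<Longrightarrow>
        norm (integral {a..y} m - integral {a..t} m - (y - t) *\<^sub>R m t) \<le> e / 2 * norm (y - t)"
      using N2(2)[OF t'(2)] e2 unfolding has_vector_derivative_def has_derivative_within_alt by blast
    define h where "h = min (b - t) (min d1 d2 / 2)"
    have h: "0 < h" "h < d1" "h < d2" "t + h \<le> b" using t' d1 d2 by (auto simp: h_def)
    have y: "t + h \<in> {a..b}" using h t' by auto
    have I: "integral {a..t + h} \<phi> - integral {a..t} \<phi> = integral {t..t + h} \<phi>"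
        "integral {a..t + h} m - integral {a..t} m = integral {t..t + h} m"
      using h t' by (auto intro!: integral_diff_interval[OF \<phi>] integral_diff_interval[OF m])
    have A: "norm (integral {t..t + h} \<phi> - h *\<^sub>R \<phi> t) \<le> e / 2 * h"
      using d1(2)[OF y] h unfolding I by simp
    have B: "\<bar>integral {t..t + h} m - h * m t\<bar> \<le> e / 2 * h"
      using d2(2)[OF y] h unfolding I by simp
    have "h * norm (\<phi> t) = norm (h *\<^sub>R \<phi> t)" using h by simp
    also have "\<dots> \<le> norm (integral {t..t + h} \<phi>) + e / 2 * h"
      using A norm_triangle_sub[of "h *\<^sub>R \<phi> t" "integral {t..t + h} \<phi>"] by (simp add: norm_minus_commute)
    also have "norm (integral {t..t + h} \<phi>) \<le> integral {t..t + h} m" using h t' by (intro le) auto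
    also have "integral {t..t + h} m \<le> h * m t + e / 2 * h" using B by linarith
    finally have "h * norm (\<phi> t) \<le> h * (m t + e)" by (simp add: algebra_simps)
    then show "norm (\<phi> t) \<le> m t + e" using h(1) by simp
  qed
  moreover have "negligible (insert b (N1 \<union> N2))" using N1(1) N2(1) by (simp add: negligible_Un)
  ultimately show ?thesis by (subst AE_lebesgue_on_iff_negligible) (simp, metis)
qed

text \<open>The difference \<open>g - f\<close> is its own bound in the preceding lemma, and
  \<open>|g - f| \<le> g - f\<close> means that it is nonnegative.\<close>

lemma AE_le_of_integral_le:
  fixes f g :: "real \<Rightarrow> real"
  assumes f: "f integrable_on {a..b}" and g: "g integrable_on {a..b}"
    and le: "\<And>s t. a \<le> s \<Longrightarrow> s \<le> t \<Longrightarrow> t \<le> b \<Longrightarrow> integral {s..t} f \<le> integral {s..t} g"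
  shows "AE t in lebesgue_on {a..b}. f t \<le> g t"
proof -
  have "AE t in lebesgue_on {a..b}. norm (g t - f t) \<le> g t - f t"
  proof (rule AE_norm_le_of_integral_le)
    fix s t assume st: "a \<le> s" "s \<le> t" "t \<le> b"
    have "integral {s..t} (\<lambda>t. g t - f t) = integral {s..t} g - integral {s..t} f"
      using st by (intro integral_diff integrable_subinterval_real[OF f] integrable_subinterval_real[OF g]) auto
    then show "norm (integral {s..t} (\<lambda>t. g t - f t)) \<le> integral {s..t} (\<lambda>t. g t - f t)"
      using le[OF st] by simp
  qed (intro integrable_diff f g)+
  then show ?thesis by (rule eventually_mono) (auto simp: abs_le_iff)
qed

section \<open>Densities of functions whose increments are dominated by an integral\<close>

lemma emeasure_sum_measure:
  fixes M N :: "'t measure"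
  assumes "sets N = sets M"
  obtains S where "sets S = sets M" "\<And>A. A \<in> sets M \<Longrightarrow> emeasure S A = emeasure M A + emeasure N A"
proof
  let ?S = "measure_of (space M) (sets M) (\<lambda>A. emeasure M A + emeasure N A)"
  show "sets ?S = sets M" by simp
  show "emeasure ?S A = emeasure M A + emeasure N A" if "A \<in> sets M" for A
  proof (rule emeasure_measure_of[OF refl])
    show "countably_additive (sets ?S) (\<lambda>A. emeasure M A + emeasure N A)"
    proof (rule countably_additiveI)
      fix A :: "nat \<Rightarrow> 't set" assume A: "range A \<subseteq> sets ?S" "disjoint_family A"
      then have "range A \<subseteq> sets M" "range A \<subseteq> sets N" using assms by auto
      then show "(\<Sum>i. emeasure M (A i) + emeasure N (A i)) = emeasure M (\<Union>i. A i) + emeasure N (\<Union>i. A i)"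
        using A(2) by (subst suminf_add[symmetric]) (auto simp: suminf_emeasure)
    qed
  qed (use that sets.space_closed in \<open>auto simp: positive_def\<close>)
qed

lemma measure_eqI_Ioc:
  fixes M N :: "real measure"
  assumes sets: "sets M = sets borel" "sets N = sets borel"
    and fin: "\<And>s t. s \<le> t \<Longrightarrow> emeasure M {s<..t} \<noteq> \<infinity>"
    and eq: "\<And>s t. s \<le> t \<Longrightarrow> emeasure M {s<..t} = emeasure N {s<..t}"
  shows "M = N"
proof (rule measure_eqI_generator_eq_countable)
  let ?E = "range (\<lambda>(s, t). {s<..t::real})"
  show "Int_stable ?E"
  proof (rule Int_stableI)
    fix A B assume "A \<in> ?E" "B \<in> ?E"
    then obtain y z where "A = (case y of (s, t) \<Rightarrow> {s<..t})" "B = (case z of (s, t) \<Rightarrow> {s<..t})"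
      by (elim imageE)
    then obtain a b c d where "A = {a<..b}" "B = {c<..d}" by (simp add: case_prod_beta')
    then have "A \<inter> B = (\<lambda>(s, t). {s<..t}) (max a c, min b d)" by simp
    then show "A \<inter> B \<in> ?E" by (rule range_eqI)
  qed
  show "sets M = sigma_sets UNIV ?E" "sets N = sigma_sets UNIV ?E"
    using sets by (simp_all add: borel_sigma_sets_Ioc sets_measure_of)
  show "emeasure M X = emeasure N X" if "X \<in> ?E" for X
  proof -
    obtain z where "X = (case z of (s, t) \<Rightarrow> {s<..t})" using \<open>X \<in> ?E\<close> by (rule imageE)
    then obtain s t where X: "X = {s<..t}" by (simp add: case_prod_beta')
    show ?thesis
    proof (cases "s \<le> t")
      case False
      then show ?thesis by (simp add: X)
    qed (simp add: X eq)
  qed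
  show "(\<lambda>n::nat. {- real n<..real n}) ` UNIV \<subseteq> ?E" by auto
  show "\<Union> ((\<lambda>n::nat. {- real n<..real n}) ` UNIV) = UNIV"
  proof safe
    fix x :: real
    obtain n :: nat where "\<bar>x\<bar> < n" using reals_Archimedean2 by blast
    then have "x \<in> {- real n<..real n}" by auto
    then show "x \<in> \<Union> ((\<lambda>n::nat. {- real n<..real n}) ` UNIV)" by blast
  qed simp
  show "countable ((\<lambda>n::nat. {- real n<..real n}) ` UNIV)" by simp
  show "emeasure M A \<noteq> \<infinity>" if "A \<in> (\<lambda>n::nat. {- real n<..real n}) ` UNIV" for A
    using that fin by auto
qed simp

text \<open>\<open>F\<close> and \<open>2 \<integral> m - F\<close> are both nondecreasing, so the Stieltjes measure of \<open>F\<close> is dominated by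
  the measure with density \<open>2 m\<close>.\<close>
lemma real_dominated_has_density:
  fixes \<eta> m :: "real \<Rightarrow> real"
  assumes ab: "a \<le> b" and m: "m integrable_on {a..b}" and m0: "\<And>t. t \<in> {a..b} \<Longrightarrow> 0 \<le> m t"
    and dom: "\<And>s t. a \<le> s \<Longrightarrow> s \<le> t \<Longrightarrow> t \<le> b \<Longrightarrow> \<bar>\<eta> t - \<eta> s\<bar> \<le> integral {s..t} m"
  shows "\<exists>\<phi>. \<forall>s t. a \<le> s \<longrightarrow> s \<le> t \<longrightarrow> t \<le> b \<longrightarrow> (\<phi> has_integral (\<eta> t - \<eta> s)) {s..t}"
proof -
  \<comment> \<open>Clamping to \<open>{a..b}\<close> extends all functions by constants, so that
    Stieltjes measures can be formed on the whole line.\<close>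
  define p where "p t = max a (min b t)" for t :: real
  have p: "a \<le> p t" "p t \<le> b" "s \<le> t \<Longrightarrow> p s \<le> p t" for s t using ab by (auto simp: p_def)
  have pid: "p t = t" if "a \<le> t" "t \<le> b" for t using that by (auto simp: p_def)
  have p_cont: "continuous_on UNIV p" unfolding p_def by (intro continuous_intros)
  define M where "M t = integral {a..t} m" for t
  have Mdiff: "M t - M s = integral {s..t} m" if "a \<le> s" "s \<le> t" "t \<le> b" for s t
    using Henstock_Kurzweil_Integration.integral_combine[of a s t m] that integrable_subinterval_real[OF m, of a t] by (simp add: M_def)
  define \<psi> where "\<psi> t = (if t \<in> {a..b} then m t else 0)" for t
  have psi0: "0 \<le> \<psi> t" for t using m0 by (simp add: \<psi>_def)
  have psi_int: "\<psi> integrable_on {s..t}" for s t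
    unfolding \<psi>_def integrable_restrict_Int Int_atLeastAtMost
    by (rule integrable_subinterval_real[OF m]) auto
  have Mp: "M (p t) - M (p s) = integral {s..t} \<psi>" if "s \<le> t" for s t
  proof -
    have eq: "integral {s..t} \<psi> = integral {max a s..min b t} m"
      unfolding \<psi>_def Henstock_Kurzweil_Integration.integral_restrict_Int Int_atLeastAtMost ..
    consider "t < a" | "b < s" | "a \<le> t" "s \<le> b" by linarith
    then show ?thesis
    proof cases
      case 3
      then have "p s = max a s" "p t = min b t" "max a s \<le> min b t" using ab that by (auto simp: p_def)
      then show ?thesis using Mdiff[of "p s" "p t"] p eq by auto
    qed (use that ab eq in \<open>auto simp: p_def\<close>)
  qed
  have M_cont: "continuous_on {a..b} M"
    unfolding M_def using m by (rule indefinite_integral_continuous_1)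
  have Mp_cont: "continuous_on UNIV (\<lambda>t. M (p t))"
    by (rule continuous_on_compose2[OF M_cont p_cont]) (use p in auto)
  have eta_cont: "continuous_on UNIV (\<lambda>t. \<eta> (p t))"
    unfolding continuous_on_iff
  proof (intro ballI allI impI)
    fix t e :: real assume "0 < e"
    then obtain d where d: "d > 0" "\<And>s. dist s t < d \<Longrightarrow> dist (M (p s)) (M (p t)) < e"
      using Mp_cont unfolding continuous_on_iff by (metis UNIV_I)
    have "dist (\<eta> (p s)) (\<eta> (p t)) \<le> dist (M (p s)) (M (p t))" for s
      using dom[of "p s" "p t"] dom[of "p t" "p s"] Mdiff[of "p s" "p t"] Mdiff[of "p t" "p s"] p(1,2)
      by (cases "p s \<le> p t") (auto simp: dist_real_def abs_minus_commute)
    then show "\<exists>d>0. \<forall>s\<in>UNIV. dist s t < d \<longrightarrow> dist (\<eta> (p s)) (\<eta> (p t)) < e"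
      using d by (intro exI[of _ d]) (auto intro: le_less_trans)
  qed
  define F where "F t = M (p t) + \<eta> (p t)" for t
  define G where "G t = M (p t) - \<eta> (p t)" for t
  have mono: "F s \<le> F t" "G s \<le> G t" if "s \<le> t" for s t
    using dom[of "p s" "p t"] Mdiff[of "p s" "p t"] p that unfolding F_def G_def by (auto simp: abs_le_iff)
  have F_cont: "continuous_on UNIV F" "continuous_on UNIV G"
    unfolding F_def G_def by (intro continuous_intros Mp_cont eta_cont)+
  then have rc: "continuous (at_right t) F" "continuous (at_right t) G" for t
    by (auto simp: continuous_on_eq_continuous_at intro: continuous_at_imp_continuous_at_within)
  let ?F = "interval_measure F" and ?G = "interval_measure G"
  have F_Ioc: "emeasure ?F {s<..t} = ennreal (F t - F s)" and G_Ioc: "emeasure ?G {s<..t} = ennreal (G t - G s)"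
    if "s \<le> t" for s t
    using emeasure_interval_measure_Ioc[OF that mono(1) rc(1)] emeasure_interval_measure_Ioc[OF that mono(2) rc(2)] by auto
  \<comment> \<open>The densities of \<open>?F\<close> and \<open>?G\<close> are not known, but
    \<open>\<eta>\<close> cancels in \<open>F + G\<close>, so their sum has the density
    \<open>2 * \<psi>\<close>.\<close>
  obtain S where S: "sets S = sets borel" "\<And>A. A \<in> sets borel \<Longrightarrow> emeasure S A = emeasure ?F A + emeasure ?G A"
    using emeasure_sum_measure[of ?G ?F] by auto
  have "\<psi> \<in> borel_measurable lebesgue"
  proof -
    have "\<psi> integrable_on UNIV" unfolding \<psi>_def integrable_restrict_UNIV by (rule m)
    then show ?thesis using integrable_imp_measurable[of \<psi> UNIV] by (simp add: lebesgue_on_UNIV_eq)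
  qed
  \<comment> \<open>A density over \<open>lborel\<close> is taken of a Borel function;
    \<open>\<psi>\<close> is only Lebesgue measurable and is replaced by an almost everywhere equal
    one.\<close>
  then obtain m' where m' [measurable]: "m' \<in> borel_measurable borel" and mm': "AE x in lborel. \<psi> x = m' x"
    using completion_ex_borel_measurable_real[of \<psi> lborel] by auto
  define N where "N = density lborel (\<lambda>x. ennreal (2 * m' x))"
  have "S = N"
  proof (rule measure_eqI_Ioc)
    fix s t :: real assume st: "s \<le> t"
    have "emeasure S {s<..t} = ennreal (F t - F s) + ennreal (G t - G s)"
      using S(2) F_Ioc G_Ioc st by simp
    also have "\<dots> = ennreal (2 * integral {s..t} \<psi>)"
      using mono[OF st] Mp[OF st] by (subst ennreal_plus[symmetric]) (auto simp: F_def G_def)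
    finally have eS: "emeasure S {s<..t} = ennreal (2 * integral {s..t} \<psi>)" .
    then show "emeasure S {s<..t} \<noteq> \<infinity>" by simp
    have "emeasure N {s<..t} = (\<integral>\<^sup>+x. ennreal (2 * m' x) * indicator {s<..t} x \<partial>lborel)"
      unfolding N_def by (intro emeasure_density) measurable
    also have "\<dots> = (\<integral>\<^sup>+x. ennreal (2 * \<psi> x) * indicator {s..t} x \<partial>lborel)"
    proof (rule nn_integral_cong_AE)
      show "AE x in lborel. ennreal (2 * m' x) * indicator {s<..t} x = ennreal (2 * \<psi> x) * indicator {s..t} x"
        using mm' AE_lborel_singleton[of s] by eventually_elim (auto split: split_indicator)
    qed
    also have "\<dots> = ennreal (2 * integral {s..t} \<psi>)"
      using psi0 psi_int by (intro nn_integral_has_integral_lebesgue' has_integral_mult_right integrable_integral) auto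
    finally show "emeasure S {s<..t} = emeasure N {s<..t}" using eS by simp
  qed (simp_all add: S(1) N_def)
  \<comment> \<open>A null set has measure 0 for \<open>N\<close>, which is the sum of two
    nonnegative measures, so both vanish on it.\<close>
  have "absolutely_continuous lborel ?F"
    unfolding absolutely_continuous_def
  proof
    fix A :: "real set" assume A: "A \<in> null_sets lborel"
    have [simp]: "A \<in> sets borel" using A by auto
    have "absolutely_continuous lborel N" unfolding N_def
      by (rule absolutely_continuousI_density) measurable
    then have "emeasure N A = 0" using A by (auto simp: absolutely_continuous_def)
    then have "emeasure ?F A + emeasure ?G A = 0" using S(2)[of A] \<open>S = N\<close> by simp
    then show "A \<in> null_sets ?F" by (intro null_setsI) auto
  qed
  then obtain f where f [measurable]: "f \<in> borel_measurable borel" and fF: "density lborel f = ?F"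
    using sigma_finite_measure.Radon_Nikodym[OF sigma_finite_lborel, of ?F] by auto
  have f_Icc: "(\<integral>\<^sup>+x. f x * indicator {s..t} x \<partial>lborel) = ennreal (F t - F s)" if "s \<le> t" for s t
  proof -
    have "(\<integral>\<^sup>+x. f x * indicator {s..t} x \<partial>lborel) = emeasure ?F {s..t}"
      unfolding fF[symmetric] by (simp add: emeasure_density)
    also have "\<dots> = ennreal (F t - F s)"
      by (rule emeasure_interval_measure_Icc[OF that mono(1) F_cont(1)])
    finally show ?thesis .
  qed
  define \<delta> where "\<delta> x = enn2real (f x)" for x
  have [measurable]: "\<delta> \<in> borel_measurable borel" unfolding \<delta>_def by measurable
  have \<delta>: "(\<delta> has_integral (F t - F s)) {s..t}" if "s \<le> t" for s t
  proof -
    have "AE x in lborel. f x * indicator {s..t} x \<noteq> \<infinity>"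
      by (rule nn_integral_PInf_AE) (use f_Icc[OF that] in auto)
    then have "AE x in lborel. ennreal (indicator {s..t} x * \<delta> x) = f x * indicator {s..t} x"
      by eventually_elim (auto simp: \<delta>_def top.not_eq_extremum split: split_indicator)
    then have "(\<integral>\<^sup>+x. ennreal (indicator {s..t} x * \<delta> x) \<partial>lborel) = ennreal (F t - F s)"
      using f_Icc[OF that] by (subst nn_integral_cong_AE) auto
    then have "has_bochner_integral lborel (\<lambda>x. indicator {s..t} x * \<delta> x) (F t - F s)"
      using mono(1)[OF that] by (intro has_bochner_integral_nn_integral) (auto simp: \<delta>_def)
    then have "((\<lambda>x. indicator {s..t} x * \<delta> x) has_integral (F t - F s)) UNIV"
      using has_integral_integral_lborel has_bochner_integral_iff by metis
    moreover have "(\<lambda>x. indicator {s..t} x * \<delta> x) = (\<lambda>x. if x \<in> {s..t} then \<delta> x else 0)" by auto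
    ultimately show ?thesis by (simp only: has_integral_restrict_UNIV)
  qed
  \<comment> \<open>Inside the interval \<open>F\<close> is the primitive of \<open>m\<close> plus
    \<open>\<eta>\<close>, which is why \<open>m\<close> is subtracted from its density.\<close>
  show ?thesis
  proof (intro exI[of _ "\<lambda>t. \<delta> t - m t"] allI impI)
    fix s t assume st: "a \<le> s" "s \<le> t" "t \<le> b"
    have "((\<lambda>t. \<delta> t - m t) has_integral (F t - F s) - integral {s..t} m) {s..t}"
      using st by (intro has_integral_diff \<delta> integrable_integral integrable_subinterval_real[OF m]) auto
    also have "F t - F s - integral {s..t} m = \<eta> t - \<eta> s"
      using Mdiff[OF st] st by (simp add: F_def pid)
    finally show "((\<lambda>t. \<delta> t - m t) has_integral (\<eta> t - \<eta> s)) {s..t}" .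
  qed
qed

lemma dominated_has_density:
  fixes z :: "real \<Rightarrow> 'b::euclidean_space" and m :: "real \<Rightarrow> real"
  assumes ab: "a \<le> b" and m: "m integrable_on {a..b}" and m0: "\<And>t. t \<in> {a..b} \<Longrightarrow> 0 \<le> m t"
    and dom: "\<And>s t. a \<le> s \<Longrightarrow> s \<le> t \<Longrightarrow> t \<le> b \<Longrightarrow> norm (z t - z s) \<le> integral {s..t} m"
  obtains \<phi> where "\<And>s t. a \<le> s \<Longrightarrow> s \<le> t \<Longrightarrow> t \<le> b \<Longrightarrow> (\<phi> has_integral (z t - z s)) {s..t}"
proof -
  have "\<forall>i\<in>Basis. \<exists>\<phi>. \<forall>s t. a \<le> s \<longrightarrow> s \<le> t \<longrightarrow> t \<le> b \<longrightarrow> (\<phi> has_integral (z t \<bullet> i - z s \<bullet> i)) {s..t}"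
  proof
    fix i :: 'b assume i: "i \<in> Basis"
    show "\<exists>\<phi>. \<forall>s t. a \<le> s \<longrightarrow> s \<le> t \<longrightarrow> t \<le> b \<longrightarrow> (\<phi> has_integral (z t \<bullet> i - z s \<bullet> i)) {s..t}"
    proof (rule real_dominated_has_density[OF ab m m0])
      fix s t assume "a \<le> s" "s \<le> t" "t \<le> b"
      then show "\<bar>z t \<bullet> i - z s \<bullet> i\<bar> \<le> integral {s..t} m"
        using dom[of s t] Basis_le_norm[OF i, of "z t - z s"] by (simp add: inner_diff_left)
    qed
  qed
  then obtain \<phi> where \<phi>: "\<And>i s t. i \<in> Basis \<Longrightarrow> a \<le> s \<Longrightarrow> s \<le> t \<Longrightarrow> t \<le> b \<Longrightarrow>
      (\<phi> i has_integral (z t \<bullet> i - z s \<bullet> i)) {s..t}"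
    by metis
  show ?thesis
  proof
    fix s t assume st: "a \<le> s" "s \<le> t" "t \<le> b"
    have "((\<lambda>x. \<Sum>i\<in>Basis. \<phi> i x *\<^sub>R i) has_integral (\<Sum>i\<in>Basis. (z t \<bullet> i - z s \<bullet> i) *\<^sub>R i)) {s..t}"
      using st by (intro has_integral_sum has_integral_scaleR_left \<phi>) auto
    also have "(\<Sum>i\<in>Basis. (z t \<bullet> i - z s \<bullet> i) *\<^sub>R i) = z t - z s"
      by (simp add: inner_diff_left[symmetric] euclidean_representation)
    finally show "((\<lambda>x. \<Sum>i\<in>Basis. \<phi> i x *\<^sub>R i) has_integral (z t - z s)) {s..t}" .
  qed
qed

section \<open>Caratheodory differential equations\<close>

text \<open>The chain rule holds almost everywhere, and \<open>1 + x \<le> exp x\<close> bounds the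
  increments of the exponential by integrals of a multiple of \<open>\<kappa>\<close>, hence
  absolute continuity. The case \<open>c = 1\<close> serves Gronwall's inequality, the case
  \<open>c = 2\<close> the weighted contraction.\<close>

lemma exp_integral_has_integral:
  fixes \<kappa> :: "real \<Rightarrow> real"
  assumes ab: "a \<le> b" and \<kappa>: "\<kappa> integrable_on {a..b}" and \<kappa>0: "\<And>t. t \<in> {a..b} \<Longrightarrow> 0 \<le> \<kappa> t" and c: "0 < c"
  shows "((\<lambda>s. \<kappa> s * exp (c * integral {a..s} \<kappa>)) has_integral ((exp (c * integral {a..b} \<kappa>) - 1) / c)) {a..b}"
proof -
  define \<Lambda> where "\<Lambda> t = integral {a..t} \<kappa>" for t
  have diff: "\<Lambda> t - \<Lambda> s = integral {s..t} \<kappa>" if "a \<le> s" "s \<le> t" "t \<le> b" for s t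
    unfolding \<Lambda>_def using integral_diff_interval[OF \<kappa>] that by simp
  have mono: "\<Lambda> s \<le> \<Lambda> t" if "a \<le> s" "s \<le> t" "t \<le> b" for s t
  proof -
    have "0 \<le> integral {s..t} \<kappa>"
      using that by (intro Henstock_Kurzweil_Integration.integral_nonneg integrable_subinterval_real[OF \<kappa>] \<kappa>0) auto
    then show ?thesis using diff[OF that] by simp
  qed
  let ?y = "\<lambda>t. exp (c * \<Lambda> t) / c"
  have "((\<lambda>s. \<kappa> s * exp (c * \<Lambda> s)) has_integral (?y b - ?y a)) {a..b}"
  proof (rule fundamental_theorem_of_calculus_abs_cont[OF ab])
    show "abs_cont_on {a..b} ?y"
    proof (rule abs_cont_on_dominated)
      show "(\<lambda>t. exp (c * \<Lambda> b) * \<kappa> t) integrable_on {a..b}"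
        using \<kappa> by (rule integrable_on_mult_right)
      show "0 \<le> exp (c * \<Lambda> b) * \<kappa> t" if "t \<in> {a..b}" for t using \<kappa>0[OF that] by simp
      fix s t assume st: "a \<le> s" "s \<le> t" "t \<le> b"
      have le: "c * \<Lambda> s \<le> c * \<Lambda> t" "c * \<Lambda> t \<le> c * \<Lambda> b" using mono st c by (auto intro!: mult_left_mono)
      have "1 + (c * \<Lambda> s - c * \<Lambda> t) \<le> exp (c * \<Lambda> s - c * \<Lambda> t)" by (rule exp_ge_add_one_self)
      then have "exp (c * \<Lambda> t) * (1 + (c * \<Lambda> s - c * \<Lambda> t)) \<le> exp (c * \<Lambda> t) * exp (c * \<Lambda> s - c * \<Lambda> t)"
        by (intro mult_left_mono) auto
      also have "exp (c * \<Lambda> t) * exp (c * \<Lambda> s - c * \<Lambda> t) = exp (c * \<Lambda> s)" by (simp add: exp_diff)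
      finally have "exp (c * \<Lambda> t) - exp (c * \<Lambda> s) \<le> exp (c * \<Lambda> t) * (c * (\<Lambda> t - \<Lambda> s))"
        by (simp add: algebra_simps)
      also have "\<dots> \<le> exp (c * \<Lambda> b) * (c * (\<Lambda> t - \<Lambda> s))"
        using le mono[OF st] c by (intro mult_right_mono) auto
      finally have "(exp (c * \<Lambda> t) - exp (c * \<Lambda> s)) / c \<le> exp (c * \<Lambda> b) * (\<Lambda> t - \<Lambda> s)"
        using c by (simp add: field_simps)
      moreover have "norm (?y t - ?y s) = (exp (c * \<Lambda> t) - exp (c * \<Lambda> s)) / c"
        using le c by (simp add: diff_divide_distrib[symmetric])
      ultimately show "norm (?y t - ?y s) \<le> integral {s..t} (\<lambda>t. exp (c * \<Lambda> b) * \<kappa> t)"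
        using diff[OF st] by simp
    qed
    show "AE t in lebesgue_on {a..b}. (?y has_vector_derivative \<kappa> t * exp (c * \<Lambda> t)) (at t within {a..b})"
      using AE_integral_has_vector_derivative[OF \<kappa>]
    proof (rule eventually_mono)
      fix t assume "((\<lambda>t. integral {a..t} \<kappa>) has_vector_derivative \<kappa> t) (at t within {a..b})"
      then have "(\<Lambda> has_field_derivative \<kappa> t) (at t within {a..b})"
        by (simp add: has_real_derivative_iff_has_vector_derivative \<Lambda>_def[abs_def])
      then have "(?y has_field_derivative \<kappa> t * exp (c * \<Lambda> t)) (at t within {a..b})"
        using c by (auto intro!: derivative_eq_intros)
      then show "(?y has_vector_derivative \<kappa> t * exp (c * \<Lambda> t)) (at t within {a..b})"
        by (simp add: has_real_derivative_iff_has_vector_derivative)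
    qed
  qed
  then show ?thesis by (simp add: \<Lambda>_def diff_divide_distrib)
qed

lemma integrable_mult_continuous_real:
  fixes \<kappa> e :: "real \<Rightarrow> real"
  assumes \<kappa>: "\<kappa> integrable_on {a..b}" and \<kappa>0: "\<And>t. t \<in> {a..b} \<Longrightarrow> 0 \<le> \<kappa> t" and e: "continuous_on {a..b} e"
  shows "(\<lambda>t. \<kappa> t * e t) integrable_on {a..b}"
proof -
  have "bounded (e ` {a..b})" using e by (intro compact_imp_bounded compact_continuous_image) auto
  then obtain B where "\<forall>t\<in>{a..b}. \<bar>e t\<bar> \<le> B" by (auto simp: bounded_iff)
  then have B: "\<bar>e t\<bar> \<le> B" if "t \<in> {a..b}" for t using that by blast
  show ?thesis
  proof (rule measurable_bounded_by_integrable_imp_integrable)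
    show "(\<lambda>t. \<kappa> t * e t) \<in> borel_measurable (lebesgue_on {a..b})"
      using integrable_imp_measurable[OF \<kappa>] integrable_imp_measurable[OF integrable_continuous_real[OF e]]
      by (rule borel_measurable_times)
    show "(\<lambda>t. \<kappa> t * B) integrable_on {a..b}" using \<kappa> by (rule integrable_on_mult_left)
    show "norm (\<kappa> t * e t) \<le> \<kappa> t * B" if "t \<in> {a..b}" for t
      using \<kappa>0[OF that] B[OF that] by (simp add: abs_mult mult_left_mono)
  qed simp
qed

text \<open>Evaluate the inequality where \<open>e t * exp (- \<integral> \<kappa>)\<close> is maximal.\<close>
lemma gronwall:
  fixes \<kappa> e :: "real \<Rightarrow> real"
  assumes \<kappa>: "\<kappa> integrable_on {a..b}" and \<kappa>0: "\<And>t. t \<in> {a..b} \<Longrightarrow> 0 \<le> \<kappa> t" and e: "continuous_on {a..b} e"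
    and le: "\<And>t. t \<in> {a..b} \<Longrightarrow> e t \<le> A + integral {a..t} (\<lambda>s. \<kappa> s * e s)" and t: "t \<in> {a..b}"
  shows "e t \<le> A * exp (integral {a..t} \<kappa>)"
proof -
  define \<Lambda> where "\<Lambda> t = integral {a..t} \<kappa>" for t
  have "continuous_on {a..b} \<Lambda>" unfolding \<Lambda>_def using \<kappa> by (rule indefinite_integral_continuous_1)
  then have "continuous_on {a..b} (\<lambda>t. e t * exp (- \<Lambda> t))" by (intro continuous_intros e)
  then obtain r where r: "r \<in> {a..b}" "\<And>s. s \<in> {a..b} \<Longrightarrow> e s * exp (- \<Lambda> s) \<le> e r * exp (- \<Lambda> r)"
    using continuous_attains_sup[of "{a..b}" "\<lambda>t. e t * exp (- \<Lambda> t)"] t by auto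
  define m where "m = e r * exp (- \<Lambda> r)"
  have em: "e s \<le> m * exp (\<Lambda> s)" if "s \<in> {a..b}" for s
  proof -
    have "e s = e s * exp (- \<Lambda> s) * exp (\<Lambda> s)" by (simp add: exp_minus)
    also have "\<dots> \<le> m * exp (\<Lambda> s)"
      using r(2)[OF that] unfolding m_def by (intro mult_right_mono) auto
    finally show ?thesis .
  qed
  have sub: "{a..r} \<subseteq> {a..b}" using r(1) by auto
  have I: "((\<lambda>s. \<kappa> s * exp (\<Lambda> s)) has_integral (exp (\<Lambda> r) - 1)) {a..r}"
    using exp_integral_has_integral[of a r \<kappa> 1] integrable_subinterval_real[OF \<kappa> sub] \<kappa>0 r(1) by (auto simp: \<Lambda>_def)
  have "e r \<le> A + integral {a..r} (\<lambda>s. \<kappa> s * e s)" by (rule le[OF r(1)])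
  also have "integral {a..r} (\<lambda>s. \<kappa> s * e s) \<le> integral {a..r} (\<lambda>s. m * (\<kappa> s * exp (\<Lambda> s)))"
  proof (rule integral_le)
    show "(\<lambda>s. \<kappa> s * e s) integrable_on {a..r}"
      using integrable_subinterval_real[OF integrable_mult_continuous_real[OF \<kappa> \<kappa>0 e] sub] by simp
    show "(\<lambda>s. m * (\<kappa> s * exp (\<Lambda> s))) integrable_on {a..r}"
      using has_integral_mult_right[OF I] by blast
    show "\<kappa> s * e s \<le> m * (\<kappa> s * exp (\<Lambda> s))" if "s \<in> {a..r}" for s
      using mult_left_mono[OF em \<kappa>0, of s] that sub by (auto simp: mult_ac)
  qed
  also have "integral {a..r} (\<lambda>s. m * (\<kappa> s * exp (\<Lambda> s))) = m * (exp (\<Lambda> r) - 1)"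
    using has_integral_mult_right[OF I] by (rule integral_unique)
  finally have "e r \<le> A + m * (exp (\<Lambda> r) - 1)" by simp
  moreover have "e r = m * exp (\<Lambda> r)" by (simp add: m_def exp_minus)
  \<comment> \<open>At the maximum point the inequality reads
    \<open>m * exp (\<Lambda> r) \<le> A + m * (exp (\<Lambda> r) - 1)\<close>, where the
    exponentials cancel.\<close>
  ultimately have "m \<le> A" by (simp add: algebra_simps)
  have "e t \<le> m * exp (\<Lambda> t)" by (rule em[OF t])
  also have "\<dots> \<le> A * exp (\<Lambda> t)" using \<open>m \<le> A\<close> by (intro mult_right_mono) auto
  finally show ?thesis by (simp add: \<Lambda>_def)
qed

text \<open>Picard iteration; the iterates contract by \<open>1/2\<close> in the norm weighted by \<open>exp (- 2 \<integral> \<kappa>)\<close>.\<close>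
lemma caratheodory_ode_exists:
  fixes F :: "real \<Rightarrow> 'b::euclidean_space \<Rightarrow> 'b"
  assumes ab: "a \<le> b" and \<kappa>: "\<kappa> integrable_on {a..b}" and \<kappa>0: "\<And>t. t \<in> {a..b} \<Longrightarrow> 0 \<le> \<kappa> t"
    and int: "\<And>u. continuous_on {a..b} u \<Longrightarrow> (\<lambda>t. F t (u t)) integrable_on {a..b}"
    and lip: "\<And>t x y. t \<in> {a..b} \<Longrightarrow> norm (F t x - F t y) \<le> \<kappa> t * norm (x - y)"
  obtains z where "continuous_on {a..b} z" "\<And>t. t \<in> {a..b} \<Longrightarrow> z t = x0 + integral {a..t} (\<lambda>s. F s (z s))"
proof -
  define \<Lambda> where "\<Lambda> t = integral {a..t} \<kappa>" for t
  have L0: "0 \<le> \<Lambda> t" "\<Lambda> t \<le> \<Lambda> b" if "t \<in> {a..b}" for t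
  proof -
    have sub: "{a..t} \<subseteq> {a..b}" using that by auto
    show "0 \<le> \<Lambda> t" unfolding \<Lambda>_def
      using sub by (intro Henstock_Kurzweil_Integration.integral_nonneg integrable_subinterval_real[OF \<kappa>] \<kappa>0) auto
    show "\<Lambda> t \<le> \<Lambda> b" unfolding \<Lambda>_def
      using \<kappa>0 by (intro integral_subset_le[OF sub] integrable_subinterval_real[OF \<kappa>] \<kappa>) (use sub in auto)
  qed
  have diff_le: "norm (integral {a..t} (\<lambda>s. F s (u s)) - integral {a..t} (\<lambda>s. F s (w s))) \<le> I"
    if uw: "continuous_on {a..b} u" "continuous_on {a..b} w" and t: "t \<in> {a..b}"
      and E: "\<And>s. s \<in> {a..t} \<Longrightarrow> norm (u s - w s) \<le> E s" and I: "((\<lambda>s. \<kappa> s * E s) has_integral I) {a..t}" for u w t E I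
  proof -
    have sub: "{a..t} \<subseteq> {a..b}" using t by auto
    have iu: "(\<lambda>s. F s (u s)) integrable_on {a..t}" "(\<lambda>s. F s (w s)) integrable_on {a..t}"
      using integrable_subinterval_real[OF int[OF uw(1)] sub] integrable_subinterval_real[OF int[OF uw(2)] sub] .
    have "norm (integral {a..t} (\<lambda>s. F s (u s) - F s (w s))) \<le> integral {a..t} (\<lambda>s. \<kappa> s * E s)"
    proof (rule Henstock_Kurzweil_Integration.integral_norm_bound_integral)
      show "norm (F s (u s) - F s (w s)) \<le> \<kappa> s * E s" if "s \<in> {a..t}" for s
        using lip[of s "u s" "w s"] mult_left_mono[OF E \<kappa>0, of s] that sub by (meson order_trans subsetD)
    qed (use iu I in \<open>auto intro: integrable_diff\<close>)
    then show ?thesis using integral_unique[OF I] Henstock_Kurzweil_Integration.integral_diff[OF iu] by simp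
  qed
  define Z where "Z = rec_nat (\<lambda>t. x0) (\<lambda>n u t. x0 + integral {a..t} (\<lambda>s. F s (u s)))"
  have Z0: "Z 0 t = x0" and ZS: "Z (Suc n) t = x0 + integral {a..t} (\<lambda>s. F s (Z n s))" for n t
    by (simp_all add: Z_def)
  have Zc: "continuous_on {a..b} (Z n)" for n
  proof (induction n)
    case 0
    then show ?case by (simp add: Z0[abs_def])
  next
    case (Suc n)
    show ?case unfolding ZS[abs_def]
      by (intro continuous_intros indefinite_integral_continuous_1 int Suc.IH)
  qed
  have "bounded ((\<lambda>t. Z 1 t - Z 0 t) ` {a..b})"
    by (intro compact_imp_bounded compact_continuous_image continuous_intros Zc) auto
  then obtain D where "\<forall>t\<in>{a..b}. norm (Z 1 t - Z 0 t) \<le> D" by (auto simp: bounded_iff)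
  then have D: "norm (Z 1 t - Z 0 t) \<le> D" if "t \<in> {a..b}" for t using that by blast
  have D0: "0 \<le> D" using D[of a] ab by (meson atLeastAtMost_iff norm_ge_zero order_refl order_trans)
  have step: "norm (Z (Suc n) t - Z n t) \<le> D / 2 ^ n * exp (2 * \<Lambda> t)" if "t \<in> {a..b}" for n t
    using that
  proof (induction n arbitrary: t)
    case 0
    have "D * 1 \<le> D * exp (2 * \<Lambda> t)" using D0 L0[OF 0] by (intro mult_left_mono) auto
    then show ?case using D[OF 0] by simp
  next
    case (Suc n)
    have sub: "{a..t} \<subseteq> {a..b}" and at: "a \<le> t" using Suc.prems by auto
    have "((\<lambda>s. \<kappa> s * exp (2 * \<Lambda> s)) has_integral ((exp (2 * \<Lambda> t) - 1) / 2)) {a..t}"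
      unfolding \<Lambda>_def using sub by (intro exp_integral_has_integral integrable_subinterval_real[OF \<kappa>] \<kappa>0 at) auto
    then have "((\<lambda>s. D / 2 ^ n * (\<kappa> s * exp (2 * \<Lambda> s))) has_integral (D / 2 ^ n * ((exp (2 * \<Lambda> t) - 1) / 2))) {a..t}"
      by (rule has_integral_mult_right)
    then have I: "((\<lambda>s. \<kappa> s * (D / 2 ^ n * exp (2 * \<Lambda> s))) has_integral (D / 2 ^ n * ((exp (2 * \<Lambda> t) - 1) / 2))) {a..t}"
      by (simp add: mult_ac)
    have "norm (integral {a..t} (\<lambda>s. F s (Z (Suc n) s)) - integral {a..t} (\<lambda>s. F s (Z n s))) \<le> D / 2 ^ n * ((exp (2 * \<Lambda> t) - 1) / 2)"
      using sub by (intro diff_le[OF Zc Zc Suc.prems Suc.IH I]) auto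
    also have "\<dots> \<le> D / 2 ^ Suc n * exp (2 * \<Lambda> t)"
    proof -
      have "D / 2 ^ n * ((exp (2 * \<Lambda> t) - 1) / 2) = D / 2 ^ Suc n * exp (2 * \<Lambda> t) - D / 2 ^ Suc n"
        by (simp add: field_simps)
      then show ?thesis using D0 by simp
    qed
    finally show ?case by (simp add: ZS)
  qed
  \<comment> \<open>Replacing the weight by its value at \<open>b\<close> turns the weighted
    contraction into a geometric bound uniform in \<open>t\<close>, as the Weierstrass test
    requires.\<close>
  define K where "K = D * exp (2 * \<Lambda> b)"
  have stepK: "norm (Z (Suc n) t - Z n t) \<le> K * (1 / 2) ^ n" if "t \<in> {a..b}" for n t
  proof -
    have "D / 2 ^ n * exp (2 * \<Lambda> t) \<le> D / 2 ^ n * exp (2 * \<Lambda> b)"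
      using L0[OF that] D0 by (intro mult_left_mono) auto
    then show ?thesis using step[OF that, of n] by (simp add: K_def power_divide)
  qed
  define z where "z t = x0 + (\<Sum>i. Z (Suc i) t - Z i t)" for t
  have "uniform_limit {a..b} (\<lambda>n t. \<Sum>i<n. Z (Suc i) t - Z i t) (\<lambda>t. \<Sum>i. Z (Suc i) t - Z i t) sequentially"
    by (rule Weierstrass_m_test[OF stepK]) (auto intro!: summable_mult summable_geometric)
  then have ul: "uniform_limit {a..b} (\<lambda>n t. x0 + (\<Sum>i<n. Z (Suc i) t - Z i t)) z sequentially"
    unfolding z_def by (intro uniform_limit_intros)
  have tele: "x0 + (\<Sum>i<n. Z (Suc i) t - Z i t) = Z n t" for n t
    using sum_lessThan_telescope[of "\<lambda>i. Z i t" n] by (simp add: Z0)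
  have ulZ: "uniform_limit {a..b} Z z sequentially" using ul unfolding tele .
  have zc: "continuous_on {a..b} z"
    by (rule uniform_limit_theorem[OF _ ulZ]) (simp_all add: Zc)
  have "z t = x0 + integral {a..t} (\<lambda>s. F s (z s))" if t: "t \<in> {a..b}" for t
  proof -
    have "norm (z t - (x0 + integral {a..t} (\<lambda>s. F s (z s)))) \<le> 0 + e" if e: "0 < e" for e
    proof -
      define d where "d = e / (1 + \<Lambda> t)"
      have d: "0 < d" using e L0[OF t] by (simp add: d_def)
      obtain N where "\<forall>n\<ge>N. \<forall>s\<in>{a..b}. dist (Z n s) (z s) < d"
        using uniform_limitD[OF ulZ d] by (auto simp: eventually_sequentially)
      then have N: "dist (Z n s) (z s) < d" if "n \<ge> N" "s \<in> {a..b}" for n s using that by blast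
      have at: "{a..t} \<subseteq> {a..b}" using t by auto
      have "norm (integral {a..t} (\<lambda>s. F s (Z N s)) - integral {a..t} (\<lambda>s. F s (z s))) \<le> \<Lambda> t * d"
      proof (rule diff_le[OF Zc zc t])
        show "norm (Z N s - z s) \<le> d" if "s \<in> {a..t}" for s using N[of N s] that at by (auto simp: dist_norm)
        show "((\<lambda>s. \<kappa> s * d) has_integral \<Lambda> t * d) {a..t}"
          unfolding \<Lambda>_def by (intro has_integral_mult_left integrable_integral integrable_subinterval_real[OF \<kappa> at])
      qed
      then have "norm (Z (Suc N) t - (x0 + integral {a..t} (\<lambda>s. F s (z s)))) \<le> \<Lambda> t * d" by (simp add: ZS)
      moreover have "norm (z t - Z (Suc N) t) \<le> d" using N[of "Suc N" t] t by (simp add: dist_norm norm_minus_commute)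
      ultimately have "norm (z t - (x0 + integral {a..t} (\<lambda>s. F s (z s)))) \<le> d + \<Lambda> t * d"
        by (rule norm_diff_triangle_le[rotated])
      also have "\<dots> = (1 + \<Lambda> t) * d" by (simp add: algebra_simps)
      also have "\<dots> = e" using L0[OF t] by (simp add: d_def)
      finally show ?thesis by simp
    qed
    then have "norm (z t - (x0 + integral {a..t} (\<lambda>s. F s (z s)))) \<le> 0" by (rule field_le_epsilon)
    then show ?thesis by simp
  qed
  then show ?thesis using that zc by blast
qed

section \<open>The Steiner representation of a Hamiltonian\<close>

text \<open>The function is regarded as a family over the one-point time set \<open>{0}\<close>, to
  which the uniform statement for \<open>local_lipschitz\<close> families on compact sets
  applies.\<close>

lemma loc_lipschitz_imp_lipschitz_on_compact:
  fixes g :: "'b::metric_space \<Rightarrow> 'c::metric_space"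
  assumes g: "loc_lipschitz g" and K: "compact K"
  obtains L where "L-lipschitz_on K g"
proof -
  have "local_lipschitz {0::real} K (\<lambda>_. g)"
  proof (rule local_lipschitzI)
    fix t :: real and x assume "x \<in> K"
    obtain u L where "u > 0" "L-lipschitz_on (cball x u) g" using g unfolding loc_lipschitz_def by blast
    then have "\<forall>t\<in>cball t u \<inter> {0::real}. L-lipschitz_on (cball x u \<inter> K) g"
      by (auto intro: lipschitz_on_subset)
    then show "\<exists>u>0. \<exists>L. \<forall>t\<in>cball t u \<inter> {0::real}. L-lipschitz_on (cball x u \<inter> K) g"
      using \<open>u > 0\<close> by blast
  qed
  then obtain L where "\<And>t. t \<in> {0::real} \<Longrightarrow> L-lipschitz_on K g"
    using local_lipschitz_compact_implies_lipschitz[where X=K and T="{0::real}" and f="\<lambda>_. g"] K by auto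
  then show ?thesis using that by blast
qed

section \<open>Standing hypotheses and regularity of the selection\<close>

locale hamiltonian =
  fixes H :: "real \<Rightarrow> 'a::euclidean_space \<Rightarrow> 'a \<Rightarrow> real"
    and T :: real and c :: "real \<Rightarrow> real" and k :: "real \<Rightarrow> real \<Rightarrow> real"
  assumes H1: "\<And>x p. (\<lambda>t. H t x p) \<in> borel_measurable (lebesgue_on {0..T})"
    and H2: "\<And>t. t \<in> {0..T} \<Longrightarrow> continuous_on UNIV (\<lambda>(x, p). H t x p)"
    and H3: "\<And>t x. t \<in> {0..T} \<Longrightarrow> convex_on UNIV (H t x)"
    and H4_nonneg: "\<And>t. t \<in> {0..T} \<Longrightarrow> c t \<ge> 0"
    and H4: "\<And>t x p q. t \<in> {0..T} \<Longrightarrow> \<bar>H t x p - H t x q\<bar> \<le> c t * (1 + norm x) * norm (p - q)"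
    and HLC_nonneg: "\<And>R t. R > 0 \<Longrightarrow> t \<in> {0..T} \<Longrightarrow> k R t \<ge> 0"
    and HLC: "\<And>R t x y p. R > 0 \<Longrightarrow> t \<in> {0..T} \<Longrightarrow> x \<in> cball 0 R \<Longrightarrow> y \<in> cball 0 R \<Longrightarrow>
               \<bar>H t x p - H t y p\<bar> \<le> k R t * (1 + norm p) * norm (x - y)"
    and c_int: "integrable (lebesgue_on {0..T}) c"
    and k_int: "\<And>R. R > 0 \<Longrightarrow> integrable (lebesgue_on {0..T}) (k R)"
    and H00_int: "integrable (lebesgue_on {0..T}) (\<lambda>t. H t 0 0)"
begin

definition steiner :: "real \<Rightarrow> 'a \<Rightarrow> 'a \<times> real \<Rightarrow> 'a \<times> real" where
  "steiner t x a = steiner_point (local_part (conj_epi (H t x)) a)"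

lemma steiner_f_eq: "steiner_f H t x a = fst (steiner t x a)"
  and steiner_l_eq: "steiner_l H t x a = snd (steiner t x a)"
  by (simp_all add: steiner_f_def steiner_l_def steiner_def Phi_eq_local_part)

lemma H_continuous:
  assumes "t \<in> {0..T}"
  shows "continuous_on UNIV (H t x)" and "continuous_on UNIV (\<lambda>x. H t x p)"
proof -
  have "continuous_on UNIV (\<lambda>p. (x, p))" "continuous_on UNIV (\<lambda>x. (x, p))"
    by (intro continuous_on_Pair continuous_on_const continuous_on_id)+
  then show "continuous_on UNIV (H t x)" "continuous_on UNIV (\<lambda>x. H t x p)"
    using continuous_on_compose2[OF H2[OF assms], of UNIV] by fastforce+
qed

lemma conj_epi_H_nonempty: "t \<in> {0..T} \<Longrightarrow> conj_epi (H t x) \<noteq> {}"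
  using conj_epi_subgradient[OF H3 H_continuous(1)] by blast

lemma steiner_mem_local_part:
  "t \<in> {0..T} \<Longrightarrow> steiner t x a \<in> local_part (conj_epi (H t x)) a"
  unfolding steiner_def
  by (intro steiner_point_local_part_mem closed_conj_epi convex_conj_epi conj_epi_H_nonempty)

lemma steiner_mem: "t \<in> {0..T} \<Longrightarrow> steiner t x a \<in> conj_epi (H t x)"
  using steiner_mem_local_part unfolding local_part_def by blast

lemma steiner_fixed: "a \<in> conj_epi (H t x) \<Longrightarrow> steiner t x a = a"
  unfolding steiner_def by (simp add: local_part_member closed_conj_epi steiner_point_singleton)

lemma conj_epi_H_norm_fst_le:
  assumes "t \<in> {0..T}" "u \<in> conj_epi (H t x)"
  shows "norm (fst u) \<le> c t * (1 + norm x)"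
  using conj_epi_norm_le[of "H t x" "c t * (1 + norm x)" "fst u" "snd u"] H4[OF assms(1)] assms(2) by simp

lemma conj_epi_H_snd_ge: "u \<in> conj_epi (H t x) \<Longrightarrow> - H t x 0 \<le> snd u"
  using conj_epiD[of "fst u" "snd u" "H t x" 0] by simp

text \<open>The local part of the origin lies in the ball of twice its distance to the epigraph, and
  a subgradient bounds that distance. So the control \<open>0\<close> has bounded cost wherever the
  state is bounded.\<close>

lemma norm_steiner_zero_le:
  assumes t: "t \<in> {0..T}"
  shows "norm (steiner t x 0) \<le> 2 * (c t * (1 + norm x) + \<bar>H t x 0\<bar>)"
proof -
  have "norm (steiner t x 0) \<le> 2 * infdist 0 (conj_epi (H t x))"
    using steiner_mem_local_part[OF t, of x 0] by (simp add: local_part_def)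
  also have "infdist 0 (conj_epi (H t x)) \<le> c t * (1 + norm x) + \<bar>H t x 0\<bar>"
    by (intro infdist_conj_epi_zero_le H3 H_continuous H4 t)
  finally show ?thesis by simp
qed

text \<open>The factors are 10 from comparing local parts, 2 from comparing epigraphs and the
  dimension from the Steiner point. The factor 2 is also granted to the control variable, so that
  one constant covers both.\<close>

definition lip_const :: real where "lip_const = 20 * DIM('a \<times> real)"

lemma lip_const_pos: "0 < lip_const" by (simp add: lip_const_def)

lemma steiner_lipschitz:
  assumes R: "0 < R" and t: "t \<in> {0..T}" and x: "x \<in> cball 0 R" and y: "y \<in> cball 0 R"
  shows "norm (steiner t x a - steiner t y b) \<le> lip_const * (k R t * norm (x - y) + norm (a - b))"
proof -
  define d where "d = 2 * (k R t * norm (x - y))"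
  have k0: "0 \<le> k R t * norm (x - y)" using HLC_nonneg[OF R t] by simp
  have near: "\<exists>v\<in>conj_epi (H t y'). norm (u - v) \<le> d"
    if "u \<in> conj_epi (H t x')" "x' \<in> cball 0 R" "y' \<in> cball 0 R" "norm (x' - y') = norm (x - y)" for x' y' u
    unfolding d_def
  proof (rule conj_epi_hausdorff[OF H3[OF t] H_continuous(1)[OF t] _ k0 that(1)])
    show "\<bar>H t x' p - H t y' p\<bar> \<le> k R t * norm (x - y) * (1 + norm p)" for p
      using HLC[OF R t that(2,3), of p] that(4) by (simp add: mult_ac)
  qed
  have "norm (steiner t x a - steiner t y b) \<le> DIM('a \<times> real) * (10 * (d + norm (a - b)))"
    unfolding steiner_def
    using near[of _ x y] near[of _ y x] x y
    by (intro steiner_point_local_part_lipschitz closed_conj_epi convex_conj_epi conj_epi_H_nonempty t)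
       (auto simp: norm_minus_commute)
  also have "\<dots> \<le> DIM('a \<times> real) * (10 * (d + 2 * norm (a - b)))"
    by (intro mult_left_mono) auto
  also have "\<dots> = lip_const * (k R t * norm (x - y) + norm (a - b))"
    unfolding d_def lip_const_def by (simp add: algebra_simps)
  finally show ?thesis .
qed

lemma continuous_steiner:
  assumes t: "t \<in> {0..T}"
  shows "continuous_on UNIV (\<lambda>(x, a). steiner t x a)"
proof (subst continuous_on_eq_continuous_at[OF open_UNIV], rule ballI)
  fix z :: "'a \<times> ('a \<times> real)"
  obtain x a where z: "z = (x, a)" by (rule prod.exhaust)
  define R where "R = norm x + 1"
  have R: "0 < R" by (simp add: R_def add_nonneg_pos)
  have sub: "y \<in> cball 0 R" if "(y, b) \<in> cball z 1" for y and b :: "'a \<times> real"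
  proof -
    have "norm (x - y) \<le> 1" using that norm_fst_le[of "x - y" "a - b"] by (simp add: z dist_norm)
    then show ?thesis using norm_triangle_sub[of y x] by (simp add: R_def norm_minus_commute)
  qed
  have "(lip_const * (k R t + 1))-lipschitz_on (cball z 1) (\<lambda>(x, a). steiner t x a)"
  proof (rule lipschitz_onI)
    fix u v :: "'a \<times> ('a \<times> real)" assume uv: "u \<in> cball z 1" "v \<in> cball z 1"
    obtain x1 a1 x2 a2 where eq: "u = (x1, a1)" "v = (x2, a2)" by (metis prod.exhaust)
    have "norm (steiner t x1 a1 - steiner t x2 a2) \<le> lip_const * (k R t * norm (x1 - x2) + norm (a1 - a2))"
      using uv sub eq by (intro steiner_lipschitz R t) auto
    also have "\<dots> \<le> lip_const * (k R t * dist u v + dist u v)"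
      using norm_fst_le[of "x1 - x2" "a1 - a2"] norm_snd_le[of "a1 - a2" "x1 - x2"] HLC_nonneg[OF R t] lip_const_pos
      by (intro mult_left_mono add_mono) (auto simp: eq dist_norm)
    finally show "dist (case u of (x, a) \<Rightarrow> steiner t x a) (case v of (x, a) \<Rightarrow> steiner t x a) \<le> lip_const * (k R t + 1) * dist u v"
      by (simp add: eq dist_norm algebra_simps)
  qed (use HLC_nonneg[OF R t] lip_const_pos in auto)
  then have "continuous_on (ball z 1) (\<lambda>(x, a). steiner t x a)"
    by (meson ball_subset_cball continuous_on_subset lipschitz_on_continuous_on)
  then show "isCont (\<lambda>(x, a). steiner t x a) z"
    by (simp add: continuous_on_eq_continuous_at)
qed

lemma borel_measurable_steiner:
  assumes s: "0 \<le> s" and x: "x \<in> borel_measurable (lebesgue_on {s..T})" and a: "a \<in> borel_measurable (lebesgue_on {s..T})"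
  shows "(\<lambda>t. steiner t (x t) (a t)) \<in> borel_measurable (lebesgue_on {s..T})"
proof -
  have sub: "{s..T} \<subseteq> {0..T}" using s by auto
  have "(\<lambda>t. (\<lambda>(x, a). steiner t x a) (x t, a t)) \<in> borel_measurable (lebesgue_on {s..T})"
  proof (rule borel_measurable_caratheodory[where F="\<lambda>t (x, a). steiner t x a" and u="\<lambda>t. (x t, a t)"])
    show "(\<lambda>t. case z of (x, a) \<Rightarrow> steiner t x a) \<in> borel_measurable (lebesgue_on {s..T})" for z
    proof -
      obtain x a where z: "z = (x, a)" by (rule prod.exhaust)
      have "(\<lambda>t. H t x p) \<in> borel_measurable (lebesgue_on {s..T})" for p
        by (rule measurable_restrict_mono[OF H1 sub])
      then show ?thesis unfolding z steiner_def prod.case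
        by (intro borel_measurable_steiner_point_local_part H_continuous H3) (use sub in auto)
    qed
    show "continuous_on UNIV (\<lambda>(x, a). steiner t x a)" if "t \<in> space (lebesgue_on {s..T})" for t
      using that sub by (intro continuous_steiner) auto
  qed (use x a in measurable)
  then show ?thesis by simp
qed

lemma borel_measurable_H:
  assumes s: "0 \<le> s" and x: "x \<in> borel_measurable (lebesgue_on {s..T})"
  shows "(\<lambda>t. H t (x t) p) \<in> borel_measurable (lebesgue_on {s..T})"
proof -
  have sub: "{s..T} \<subseteq> {0..T}" using s by auto
  show ?thesis
    by (rule borel_measurable_caratheodory[where F="\<lambda>t x. H t x p", OF measurable_restrict_mono[OF H1 sub] _ x])
       (use sub H_continuous(2) in auto)
qed

lemma H_zero_le:
  assumes "0 < R" "t \<in> {0..T}" "x \<in> cball 0 R"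
  shows "\<bar>H t x 0\<bar> \<le> \<bar>H t 0 0\<bar> + k R t * R"
proof -
  have "\<bar>H t x 0 - H t 0 0\<bar> \<le> k R t * norm x" using HLC[OF assms(1,2,3), of 0 0] assms by simp
  also have "\<dots> \<le> k R t * R" using assms HLC_nonneg by (intro mult_left_mono) auto
  finally show ?thesis by linarith
qed

end

section \<open>A priori bounds and existence of trajectories\<close>

context hamiltonian
begin

text \<open>Gronwall bound for \<open>1 + |x|\<close> under
  \<open>|x'| \<le> c t * (1 + |x|)\<close>. It depends neither on the control nor on the initial
  time.\<close>

definition radius :: "real \<Rightarrow> real" where "radius M = (1 + M) * exp (integral {0..T} c)"

lemma c_integrable_on: "0 \<le> s \<Longrightarrow> t \<le> T \<Longrightarrow> c integrable_on {s..t}"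
  by (rule integrable_subinterval_real[OF integrable_on_lebesgue_on[OF c_int]]) auto

lemma k_integrable_on: "0 < R \<Longrightarrow> 0 \<le> s \<Longrightarrow> t \<le> T \<Longrightarrow> k R integrable_on {s..t}"
  by (rule integrable_subinterval_real[OF integrable_on_lebesgue_on[OF k_int]]) auto

lemma trajectory_norm_le:
  fixes y \<phi> :: "real \<Rightarrow> 'a"
  assumes s: "0 \<le> s" and M: "0 \<le> M" "norm x0 \<le> M"
    and y: "continuous_on {s..T} y" "\<And>t. t \<in> {s..T} \<Longrightarrow> (\<phi> has_integral (y t - x0)) {s..t}"
    and \<phi>: "\<And>t. t \<in> {s..T} \<Longrightarrow> norm (\<phi> t) \<le> c t * (1 + norm (y t))"
    and t: "t \<in> {s..T}"
  shows "norm (y t) \<le> radius M"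
proof -
  have c0: "0 \<le> c r" if "r \<in> {s..T}" for r using H4_nonneg that s by auto
  have "1 + norm (y t) \<le> (1 + M) * exp (integral {s..t} c)"
  proof (rule gronwall[OF c_integrable_on[OF s order_refl] c0 _ _ t])
    show cont: "continuous_on {s..T} (\<lambda>t. 1 + norm (y t))" by (intro continuous_intros y)
    fix r assume r: "r \<in> {s..T}"
    have sub: "{s..r} \<subseteq> {s..T}" using r by auto
    have "norm (integral {s..r} \<phi>) \<le> integral {s..r} (\<lambda>t. c t * (1 + norm (y t)))"
    proof (rule Henstock_Kurzweil_Integration.integral_norm_bound_integral)
      show "(\<lambda>t. c t * (1 + norm (y t))) integrable_on {s..r}"
        using sub c_integrable_on[OF s, of r] r
        by (intro integrable_mult_continuous_real continuous_on_subset[OF cont sub] c0) auto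
    qed (use y(2)[OF r] \<phi> sub in auto)
    moreover have "y r = x0 + integral {s..r} \<phi>" using integral_unique[OF y(2)[OF r]] by simp
    ultimately show "1 + norm (y r) \<le> 1 + M + integral {s..r} (\<lambda>t. c t * (1 + norm (y t)))"
      using norm_triangle_ineq[of x0 "integral {s..r} \<phi>"] M(2) by simp
  qed
  also have "integral {s..t} c \<le> integral {0..T} c"
    using s t H4_nonneg by (intro integral_subset_le c_integrable_on) auto
  then have "(1 + M) * exp (integral {s..t} c) \<le> radius M"
    unfolding radius_def using M(1) by (intro mult_left_mono) auto
  finally show ?thesis by simp
qed

text \<open>The Lipschitz constant in the state is available on balls only. The state is therefore
  projected to a ball before it enters the dynamics, and the a priori bound shows that the
  projection has no effect along the solution.\<close>

lemma controlled_trajectory_exists: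
  assumes s: "0 \<le> s" "s \<le> T" and M: "0 \<le> M" "norm x0 \<le> M"
    and a: "a \<in> borel_measurable (lebesgue_on {s..T})"
  obtains z where "continuous_on {s..T} z" "\<And>t. t \<in> {s..T} \<Longrightarrow> norm (z t) \<le> radius M"
    "\<And>t. t \<in> {s..T} \<Longrightarrow> ((\<lambda>t. fst (steiner t (z t) (a t))) has_integral (z t - x0)) {s..t}"
proof -
  define R where "R = radius M"
  have R: "0 < R" using M(1) by (simp add: R_def radius_def add_pos_nonneg)
  have sT: "t \<in> {0..T}" if "t \<in> {s..T}" for t using that s by auto
  define p where "p = closest_point (cball (0::'a) R)"
  have p_in: "p x \<in> cball 0 R" for x
    unfolding p_def using R by (intro closest_point_in_set) auto
  have p_lip: "norm (p x - p y) \<le> norm (x - y)" for x y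
    unfolding p_def dist_norm[symmetric] using R by (intro closest_point_lipschitz) auto
  have p_id: "p x = x" if "norm x \<le> R" for x
    unfolding p_def using that by (intro closest_point_self) simp
  have p_norm: "norm (p x) \<le> norm x" for x using p_lip[of x 0] p_id[of 0] R by simp
  have p_cont: "continuous_on UNIV p"
    by (rule lipschitz_on_continuous_on[of 1]) (use p_lip in \<open>auto intro!: lipschitz_onI simp: dist_norm\<close>)
  define F where "F t x = fst (steiner t (p x) (a t))" for t x
  have F_norm: "norm (F t x) \<le> c t * (1 + norm (p x))" if "t \<in> {s..T}" for t x
    unfolding F_def using sT[OF that] by (intro conj_epi_H_norm_fst_le steiner_mem)
  have F_norm_R: "norm (F t x) \<le> c t * (1 + R)" if "t \<in> {s..T}" for t x
    using F_norm[OF that, of x] p_in[of x] H4_nonneg[OF sT[OF that]]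
    by (smt (verit) mem_cball_0 mult_left_mono)
  have F_meas: "(\<lambda>t. F t (u t)) integrable_on {s..T}" if u: "continuous_on {s..T} u" for u
  proof (rule measurable_bounded_by_integrable_imp_integrable)
    have "(\<lambda>t. p (u t)) \<in> borel_measurable (lebesgue_on {s..T})"
      by (intro continuous_imp_measurable_on_sets_lebesgue continuous_on_compose2[OF p_cont u]) auto
    then have "(\<lambda>t. steiner t (p (u t)) (a t)) \<in> borel_measurable (lebesgue_on {s..T})"
      by (intro borel_measurable_steiner s a)
    then show "(\<lambda>t. F t (u t)) \<in> borel_measurable (lebesgue_on {s..T})"
      unfolding F_def by (rule measurable_compose) (simp add: borel_measurable_continuous_onI continuous_on_fst)
    show "(\<lambda>t. c t * (1 + R)) integrable_on {s..T}"
      by (intro integrable_on_mult_left c_integrable_on s order_refl)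
  qed (use F_norm_R in auto)
  obtain z where z: "continuous_on {s..T} z" "\<And>t. t \<in> {s..T} \<Longrightarrow> z t = x0 + integral {s..t} (\<lambda>r. F r (z r))"
  proof (rule caratheodory_ode_exists[where ?x0.0=x0, OF s(2) _ _ F_meas])
    show "(\<lambda>t. lip_const * k R t) integrable_on {s..T}"
      by (intro integrable_on_mult_right k_integrable_on R s order_refl)
    show "0 \<le> lip_const * k R t" if "t \<in> {s..T}" for t
      using HLC_nonneg[OF R sT[OF that]] lip_const_pos by simp
    show "norm (F t x - F t y) \<le> lip_const * k R t * norm (x - y)" if t: "t \<in> {s..T}" for t x y
    proof -
      have "norm (F t x - F t y) \<le> norm (steiner t (p x) (a t) - steiner t (p y) (a t))"
        unfolding F_def fst_diff[symmetric] by (metis norm_fst_le prod.collapse)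
      also have "\<dots> \<le> lip_const * (k R t * norm (p x - p y) + norm (a t - a t))"
        by (rule steiner_lipschitz[OF R sT[OF t] p_in p_in])
      also have "\<dots> \<le> lip_const * (k R t * norm (x - y) + norm (a t - a t))"
        using p_lip HLC_nonneg[OF R sT[OF t]] lip_const_pos by (intro mult_left_mono add_mono) auto
      finally show ?thesis by simp
    qed
  qed (blast intro: that)+
  have zI: "((\<lambda>r. F r (z r)) has_integral (z t - x0)) {s..t}" if t: "t \<in> {s..T}" for t
  proof -
    have "(\<lambda>r. F r (z r)) integrable_on {s..t}"
      using t by (intro integrable_subinterval_real[OF F_meas[OF z(1)]]) auto
    then show ?thesis using z(2)[OF t] by (simp add: has_integral_integral)
  qed
  \<comment> \<open>Linear growth survives the truncation because \<open>|p x| \<le> |x|\<close>, so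
    \<open>trajectory_norm_le\<close> applies to the truncated equation.\<close>
  have zR: "norm (z t) \<le> radius M" if t: "t \<in> {s..T}" for t
  proof (rule trajectory_norm_le[OF s(1) M z(1) zI _ t])
    show "norm (F r (z r)) \<le> c r * (1 + norm (z r))" if "r \<in> {s..T}" for r
      using F_norm[OF that, of "z r"] p_norm[of "z r"] H4_nonneg[OF sT[OF that]]
      by (smt (verit) mult_left_mono)
  qed
  show ?thesis
  proof (rule that[OF z(1) zR])
    fix t assume t: "t \<in> {s..T}"
    show "((\<lambda>t. fst (steiner t (z t) (a t))) has_integral (z t - x0)) {s..t}"
      using zI[OF t]
      by (rule has_integral_eq[rotated]) (use t zR in \<open>auto simp: F_def p_id R_def\<close>)
  qed
qed

end

section \<open>Reduction to trajectories with bounded running cost\<close>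

lemma integral_fst_snd:
  fixes \<psi> :: "real \<Rightarrow> 'b::euclidean_space \<times> 'c::euclidean_space"
  assumes "(\<psi> has_integral I) S"
  shows "((\<lambda>t. fst (\<psi> t)) has_integral fst I) S" "((\<lambda>t. snd (\<psi> t)) has_integral snd I) S"
  using has_integral_linear[OF assms bounded_linear_fst] has_integral_linear[OF assms bounded_linear_snd]
  by (simp_all add: o_def)

context hamiltonian
begin

text \<open>Bound for velocity and running cost of the control \<open>0\<close> at states of norm at
  most \<open>radius M\<close>, the value to which a switched control falls back.\<close>

definition rest_bound :: "real \<Rightarrow> real \<Rightarrow> real" where
  "rest_bound M t = 2 * (c t * (1 + radius M) + (\<bar>H t 0 0\<bar> + k (radius M) t * radius M))"

text \<open>It has two roles: exponent in the Gronwall estimate of the displacement, and integral of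
  the Lipschitz constant of the running cost.\<close>

definition total_k :: "real \<Rightarrow> real" where
  "total_k M = integral {0..T} (\<lambda>t. lip_const * k (radius M) t)"

text \<open>\<open>exp (total_k M) * (L + total_k M)\<close> bounds the change of cost per unit of trajectory
  displacement, and \<open>2 * (1 + radius M) * c t\<close> the speed of displacement.\<close>
definition threshold :: "real \<Rightarrow> real \<Rightarrow> real \<Rightarrow> real" where
  "threshold L M t = exp (total_k M) * (L + total_k M) * (2 * (1 + radius M) * c t) + rest_bound M t"

text \<open>Where a control is kept, its cost was at most the threshold and changes by at most the
  Lipschitz constant times \<open>2 * radius M\<close>, the largest distance of two states in the
  ball. The last summand covers the velocity and the lower bound of the cost.\<close>

definition velocity_bound :: "real \<Rightarrow> real \<Rightarrow> real \<Rightarrow> real" where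
  "velocity_bound L M t = threshold L M t + 2 * lip_const * radius M * k (radius M) t + rest_bound M t"

lemma radius_pos: "0 \<le> M \<Longrightarrow> 0 < radius M"
  by (simp add: radius_def add_pos_nonneg)

lemma rest_bound_nonneg: "0 \<le> M \<Longrightarrow> t \<in> {0..T} \<Longrightarrow> 0 \<le> rest_bound M t"
  using radius_pos[of M] H4_nonneg[of t] HLC_nonneg[of "radius M" t] by (simp add: rest_bound_def)

lemma total_k_nonneg: "0 \<le> M \<Longrightarrow> 0 \<le> total_k M"
  unfolding total_k_def using radius_pos[of M] lip_const_pos HLC_nonneg
  by (intro Henstock_Kurzweil_Integration.integral_nonneg integrable_on_mult_right k_integrable_on) auto

lemma integrable_threshold:
  assumes "0 \<le> M"
  shows "integrable (lebesgue_on {0..T}) (threshold L M)"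
  unfolding threshold_def[abs_def] rest_bound_def[abs_def]
  by (intro Bochner_Integration.integrable_add integrable_mult_right integrable_mult_left
      integrable_abs c_int k_int[OF radius_pos[OF assms]] H00_int)

lemma integrable_velocity_bound:
  assumes "0 \<le> M"
  shows "integrable (lebesgue_on {0..T}) (velocity_bound L M)"
  unfolding velocity_bound_def[abs_def] rest_bound_def[abs_def]
  by (intro Bochner_Integration.integrable_add integrable_mult_right integrable_mult_left
      integrable_abs integrable_threshold c_int k_int[OF radius_pos[OF assms]] H00_int assms)

lemma continuous_velocity_bound:
  assumes "0 \<le> M" "continuous_on {0..T} c" "continuous_on {0..T} (k (radius M))" "continuous_on {0..T} (\<lambda>t. H t 0 0)"
  shows "continuous_on {0..T} (velocity_bound L M)"
  unfolding velocity_bound_def[abs_def] threshold_def[abs_def] rest_bound_def[abs_def]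
  by (intro continuous_intros assms)

text \<open>The velocity is bounded by linear growth and the cost is bounded below by
  \<open>- H t x 0\<close>, so an upper bound of the cost controls the whole point of the
  epigraph.\<close>

lemma conj_epi_H_norm_le:
  assumes M: "0 \<le> M" and t: "t \<in> {0..T}" and x: "norm x \<le> radius M" and u: "u \<in> conj_epi (H t x)"
    and L: "0 \<le> L" and le: "snd u \<le> threshold L M t + 2 * lip_const * radius M * k (radius M) t"
  shows "norm u \<le> velocity_bound L M t"
proof -
  let ?R = "radius M"
  have R: "0 < ?R" using M by (rule radius_pos)
  have c0: "0 \<le> c t" and k0: "0 \<le> k ?R t" using H4_nonneg[OF t] HLC_nonneg[OF R t] .
  have "norm (fst u) \<le> c t * (1 + norm x)" by (rule conj_epi_H_norm_fst_le[OF t u])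
  also have "\<dots> \<le> c t * (1 + ?R)" using x c0 by (intro mult_left_mono) auto
  finally have 1: "norm (fst u) \<le> c t * (1 + ?R)" .
  define P where "P = \<bar>H t 0 0\<bar> + k ?R t * ?R"
  define D where "D = c t * (1 + ?R)"
  define K where "K = 2 * lip_const * ?R * k ?R t"
  have nonneg: "0 \<le> P" "0 \<le> D" "0 \<le> K" using c0 k0 R lip_const_pos by (auto simp: P_def D_def K_def)
  have "0 \<le> exp (total_k M) * (L + total_k M) * (2 * (1 + ?R) * c t)"
    using total_k_nonneg[OF M] L R c0 by (intro mult_nonneg_nonneg) auto
  then have thr: "0 \<le> threshold L M t" using rest_bound_nonneg[OF M t] by (simp add: threshold_def)
  have "- P \<le> snd u"
    using conj_epi_H_snd_ge[OF u] H_zero_le[OF R t, of x] x by (simp add: P_def)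
  then have 2: "\<bar>snd u\<bar> \<le> threshold L M t + K + P"
    using le thr nonneg unfolding K_def[symmetric] by (intro abs_leI) linarith+
  have "norm u \<le> norm (fst u) + \<bar>snd u\<bar>" using norm_Pair_le[of "fst u" "snd u"] by simp
  also have "\<dots> \<le> D + (threshold L M t + K + P)"
    using 1 2 unfolding D_def[symmetric] by (rule add_mono)
  also have "\<dots> \<le> threshold L M t + K + 2 * (D + P)" using nonneg by (simp add: algebra_simps)
  also have "\<dots> = velocity_bound L M t"
    by (simp add: velocity_bound_def rest_bound_def D_def P_def K_def)
  finally show ?thesis .
qed

lemma steiner_zero_le_rest_bound:
  assumes M: "0 \<le> M" and t: "t \<in> {0..T}" and x: "norm x \<le> radius M"
  shows "norm (steiner t x 0) \<le> rest_bound M t"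
proof -
  have R: "0 < radius M" using M by (rule radius_pos)
  have "c t * (1 + norm x) \<le> c t * (1 + radius M)" using x H4_nonneg[OF t] by (intro mult_left_mono) auto
  then show ?thesis
    using norm_steiner_zero_le[OF t, of x] H_zero_le[OF R t, of x] x unfolding rest_bound_def by simp
qed

lemma rest_bound_le_threshold:
  assumes "0 \<le> M" "0 \<le> L" "t \<in> {0..T}"
  shows "rest_bound M t \<le> threshold L M t"
  unfolding threshold_def
  using total_k_nonneg radius_pos H4_nonneg assms by (auto intro!: mult_nonneg_nonneg add_nonneg_nonneg simp: less_imp_le)

text \<open>Generalized trajectories started at \<open>x0\<close>: the velocity and the running cost are given by a
  selection \<open>\<psi>\<close> of the epigraph.\<close>
definition bounded_process :: "real \<Rightarrow> real \<Rightarrow> real \<Rightarrow> 'a \<Rightarrow> (real \<Rightarrow> 'a) \<Rightarrow> (real \<Rightarrow> 'a \<times> real) \<Rightarrow> bool" where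
  "bounded_process L M s x0 z \<psi> \<longleftrightarrow>
     \<psi> integrable_on {s..T} \<and>
     (\<forall>t\<in>{s..T}. norm (z t) \<le> radius M \<and> \<psi> t \<in> conj_epi (H t (z t)) \<and> norm (\<psi> t) \<le> velocity_bound L M t \<and>
        z t = x0 + fst (integral {s..t} \<psi>))"

lemma bounded_process_of_control:
  assumes s: "0 \<le> s" "s \<le> T" and M: "0 \<le> M" and L: "0 \<le> L"
    and a: "a \<in> borel_measurable (lebesgue_on {s..T})"
    and z: "continuous_on {s..T} z" "\<And>t. t \<in> {s..T} \<Longrightarrow> norm (z t) \<le> radius M"
    "\<And>t. t \<in> {s..T} \<Longrightarrow> ((\<lambda>t. fst (steiner t (z t) (a t))) has_integral (z t - x0)) {s..t}"
    and le: "\<And>t. t \<in> {s..T} \<Longrightarrow> snd (steiner t (z t) (a t)) \<le> threshold L M t + 2 * lip_const * radius M * k (radius M) t"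
  shows "bounded_process L M s x0 z (\<lambda>t. steiner t (z t) (a t))"
proof -
  let ?\<psi> = "\<lambda>t. steiner t (z t) (a t)"
  have sT: "t \<in> {0..T}" if "t \<in> {s..T}" for t using that s by auto
  have mem: "?\<psi> t \<in> conj_epi (H t (z t))" if "t \<in> {s..T}" for t using steiner_mem[OF sT[OF that]] .
  have bd: "norm (?\<psi> t) \<le> velocity_bound L M t" if "t \<in> {s..T}" for t
    by (rule conj_epi_H_norm_le[OF M sT[OF that] z(2)[OF that] mem[OF that] L le[OF that]])
  have vb: "velocity_bound L M integrable_on {s..T}"
    using s by (intro integrable_subinterval_real[OF integrable_on_lebesgue_on[OF integrable_velocity_bound[OF M]]]) auto
  have int: "?\<psi> integrable_on {s..T}"
  proof (rule measurable_bounded_by_integrable_imp_integrable[OF _ vb])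
    show "?\<psi> \<in> borel_measurable (lebesgue_on {s..T})"
      by (intro borel_measurable_steiner s a continuous_imp_measurable_on_sets_lebesgue z) simp
    show "norm (?\<psi> t) \<le> velocity_bound L M t" if "t \<in> {s..T}" for t by (rule bd[OF that])
  qed simp
  moreover have "z t = x0 + fst (integral {s..t} ?\<psi>)" if t: "t \<in> {s..T}" for t
  proof -
    have "?\<psi> integrable_on {s..t}" using t by (intro integrable_subinterval_real[OF int]) auto
    from integral_fst_snd(1)[OF integrable_integral[OF this]] z(3)[OF t] have "fst (integral {s..t} ?\<psi>) = z t - x0"
      by (rule has_integral_unique)
    then show ?thesis by simp
  qed
  ultimately show ?thesis using mem bd z(2) unfolding bounded_process_def by blast
qed

text \<open>The control \<open>0\<close> provides a process, so the infimum in the existence proof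
  is taken over a nonempty set.\<close>

lemma bounded_process_exists:
  assumes s: "0 \<le> s" "s \<le> T" and M: "0 \<le> M" "norm x0 \<le> M" and L: "0 \<le> L"
  shows "\<exists>z \<psi>. bounded_process L M s x0 z \<psi>"
proof -
  have meas: "(\<lambda>t. 0 :: 'a \<times> real) \<in> borel_measurable (lebesgue_on {s..T})" by simp
  obtain z where z: "continuous_on {s..T} z" "\<And>t. t \<in> {s..T} \<Longrightarrow> norm (z t) \<le> radius M"
      "\<And>t. t \<in> {s..T} \<Longrightarrow> ((\<lambda>t. fst (steiner t (z t) 0)) has_integral (z t - x0)) {s..t}"
    using controlled_trajectory_exists[OF s M meas] by blast
  have "bounded_process L M s x0 z (\<lambda>t. steiner t (z t) 0)"
  proof (rule bounded_process_of_control[OF s M(1) L meas z])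
    fix t assume t: "t \<in> {s..T}"
    then have t0: "t \<in> {0..T}" using s by auto
    have "snd (steiner t (z t) 0) \<le> norm (steiner t (z t) 0)"
      by (metis abs_ge_self norm_snd_le order_trans prod.collapse real_norm_def)
    also have "\<dots> \<le> rest_bound M t" by (rule steiner_zero_le_rest_bound[OF M(1) t0 z(2)[OF t]])
    also have "\<dots> \<le> threshold L M t" by (rule rest_bound_le_threshold[OF M(1) L t0])
    also have "\<dots> \<le> threshold L M t + 2 * lip_const * radius M * k (radius M) t"
      using lip_const_pos radius_pos[OF M(1)] HLC_nonneg[OF radius_pos[OF M(1)] t0] by simp
    finally show "snd (steiner t (z t) 0) \<le> threshold L M t + 2 * lip_const * radius M * k (radius M) t" .
  qed
  then show ?thesis by blast
qed

lemma admissible_trajectory: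
  assumes s: "0 \<le> s" "s \<le> T" and M: "0 \<le> M" "norm x0 \<le> M" and adm: "admissible H T s x0 y b"
  shows "b \<in> borel_measurable (lebesgue_on {s..T})"
    and "continuous_on {s..T} y" "\<And>t. t \<in> {s..T} \<Longrightarrow> norm (y t) \<le> radius M"
    and "\<And>t. t \<in> {s..T} \<Longrightarrow> ((\<lambda>t. fst (steiner t (y t) (b t))) has_integral (y t - x0)) {s..t}"
    and "(\<lambda>t. snd (steiner t (y t) (b t))) integrable_on {s..T}"
    and "cost H g T s y b = g (y T) + integral {s..T} (\<lambda>t. snd (steiner t (y t) (b t)))"
proof -
  have adm': "abs_cont_on {s..T} y" "y s = x0" "integrable (lebesgue_on {s..T}) b"
      "integrable (lebesgue_on {s..T}) (\<lambda>t. snd (steiner t (y t) (b t)))"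
      "AE t in lebesgue_on {s..T}. (y has_vector_derivative fst (steiner t (y t) (b t))) (at t within {s..T})"
    using adm unfolding admissible_def steiner_f_eq steiner_l_eq by auto
  show "b \<in> borel_measurable (lebesgue_on {s..T})" using adm'(3) by (rule borel_measurable_integrable)
  have I: "((\<lambda>t. fst (steiner t (y t) (b t))) has_integral (y t - x0)) {s..t}" if "t \<in> {s..T}" for t
    using fundamental_theorem_of_calculus_abs_cont_interval[OF adm'(1,5), of s t] that adm'(2) by auto
  show cont: "continuous_on {s..T} y"
  proof -
    have "(\<lambda>t. fst (steiner t (y t) (b t))) integrable_on {s..T}" using I[of T] s by auto
    then have "continuous_on {s..T} (\<lambda>t. x0 + integral {s..t} (\<lambda>t. fst (steiner t (y t) (b t))))"
      by (intro continuous_intros indefinite_integral_continuous_1)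
    then show ?thesis
      by (rule continuous_on_eq) (use integral_unique[OF I] in auto)
  qed
  show "norm (y t) \<le> radius M" if t: "t \<in> {s..T}" for t
  proof (rule trajectory_norm_le[OF s(1) M cont I _ t])
    show "norm (fst (steiner r (y r) (b r))) \<le> c r * (1 + norm (y r))" if "r \<in> {s..T}" for r
      using that s by (intro conj_epi_H_norm_fst_le steiner_mem) auto
  qed
  show "((\<lambda>t. fst (steiner t (y t) (b t))) has_integral (y t - x0)) {s..t}" if "t \<in> {s..T}" for t
    using I[OF that] .
  show "(\<lambda>t. snd (steiner t (y t) (b t))) integrable_on {s..T}"
    using adm'(4) by (rule integrable_on_lebesgue_on) simp
  show "cost H g T s y b = g (y T) + integral {s..T} (\<lambda>t. snd (steiner t (y t) (b t)))"
    unfolding cost_def steiner_l_eq using lebesgue_integral_eq_integral[OF adm'(4)] by simp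
qed

text \<open>Switching the control to zero on the set where the running cost exceeds the threshold
  does not increase the total cost.\<close>
lemma admissible_improvement:
  assumes s: "0 \<le> s" "s \<le> T" and M: "0 \<le> M" "norm x0 \<le> M" and g: "L-lipschitz_on (cball 0 (radius M)) g"
    and adm: "admissible H T s x0 y b"
  shows "\<exists>z \<psi>. bounded_process L M s x0 z \<psi> \<and> g (z T) + integral {s..T} (\<lambda>t. snd (\<psi> t)) \<le> cost H g T s y b"
proof -
  note y = admissible_trajectory[OF s M adm]
  define R where "R = radius M"
  have R: "0 < R" unfolding R_def using M(1) by (rule radius_pos)
  have L: "0 \<le> L" using g by (rule lipschitz_on_nonneg)
  have sT: "t \<in> {0..T}" if "t \<in> {s..T}" for t using that s by auto
  have [measurable]: "b \<in> borel_measurable (lebesgue_on {s..T})" by (rule y(1))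
  have [measurable]: "y \<in> borel_measurable (lebesgue_on {s..T})"
    using y(2) by (rule continuous_imp_measurable_on_sets_lebesgue) simp
  have "(\<lambda>t. steiner t (y t) (b t)) \<in> borel_measurable (lebesgue_on {s..T})"
    by (rule borel_measurable_steiner[OF s(1)]) measurable
  then have snd_meas: "(\<lambda>t. snd (steiner t (y t) (b t))) \<in> borel_measurable (lebesgue_on {s..T})"
    by (rule measurable_compose) (simp add: borel_measurable_continuous_onI continuous_on_snd)
  have int_on: "f integrable_on {s..T}" if "integrable (lebesgue_on {0..T}) f" for f :: "real \<Rightarrow> real"
    using integrable_subinterval_real[OF integrable_on_lebesgue_on[OF that], of s T] s by auto
  have thr_meas: "threshold L M \<in> borel_measurable (lebesgue_on {s..T})"
    using integrable_imp_measurable[OF int_on[OF integrable_threshold[OF M(1)]]] .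
  have c_meas [measurable]: "c \<in> borel_measurable (lebesgue_on {s..T})"
    using integrable_imp_measurable[OF int_on[OF c_int]] .
  define bad where "bad t \<longleftrightarrow> threshold L M t < snd (steiner t (y t) (b t))" for t
  have [measurable]: "Measurable.pred (lebesgue_on {s..T}) bad"
    unfolding bad_def pred_def by (rule borel_measurable_less[OF thr_meas snd_meas])
  define a where "a t = (if bad t then 0 else b t)" for t
  have a [measurable]: "a \<in> borel_measurable (lebesgue_on {s..T})" unfolding a_def by measurable
  obtain z where z: "continuous_on {s..T} z" "\<And>t. t \<in> {s..T} \<Longrightarrow> norm (z t) \<le> radius M"
      "\<And>t. t \<in> {s..T} \<Longrightarrow> ((\<lambda>t. fst (steiner t (z t) (a t))) has_integral (z t - x0)) {s..t}"
    using controlled_trajectory_exists[OF s M a] by blast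
  define \<psi> where "\<psi> t = steiner t (z t) (a t)" for t
  define \<kappa> where "\<kappa> t = lip_const * k R t" for t
  have kap0: "0 \<le> \<kappa> t" if "t \<in> {s..T}" for t using HLC_nonneg[OF R sT[OF that]] lip_const_pos by (simp add: \<kappa>_def)
  have kap_int: "\<kappa> integrable_on {s..T}" unfolding \<kappa>_def
    by (intro integrable_on_mult_right k_integrable_on R s order_refl)
  have close: "norm (\<psi> t - steiner t (y t) (b t)) \<le> \<kappa> t * norm (y t - z t)" if "t \<in> {s..T}" "\<not> bad t" for t
    using steiner_lipschitz[OF R sT[OF that(1)], of "z t" "y t" "a t" "b t"] z(2)[OF that(1)] y(3)[OF that(1)] that(2)
    by (simp add: \<psi>_def a_def \<kappa>_def R_def norm_minus_commute mult.assoc)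
  have psi_bad: "norm (\<psi> t) \<le> rest_bound M t" if "t \<in> {s..T}" "bad t" for t
    using steiner_zero_le_rest_bound[OF M(1) sT[OF that(1)] z(2)[OF that(1)]] that(2) by (simp add: \<psi>_def a_def)
  have snd_le: "\<bar>snd u\<bar> \<le> norm u" for u :: "'a \<times> real" by (metis norm_snd_le prod.collapse real_norm_def)
  have proc: "bounded_process L M s x0 z \<psi>"
    unfolding \<psi>_def
  proof (rule bounded_process_of_control[OF s M(1) L a z])
    fix t assume t: "t \<in> {s..T}"
    have "snd (\<psi> t) \<le> threshold L M t + 2 * lip_const * radius M * k (radius M) t"
    proof (cases "bad t")
      case True
      have "snd (\<psi> t) \<le> rest_bound M t" using psi_bad[OF t True] snd_le[of "\<psi> t"] by linarith
      also have "\<dots> \<le> threshold L M t" by (rule rest_bound_le_threshold[OF M(1) L sT[OF t]])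
      also have "\<dots> \<le> threshold L M t + 2 * lip_const * radius M * k (radius M) t"
        using lip_const_pos R HLC_nonneg[OF R sT[OF t]] by (simp add: R_def)
      finally show ?thesis .
    next
      case False
      have "snd (\<psi> t) \<le> snd (steiner t (y t) (b t)) + \<kappa> t * norm (y t - z t)"
        using close[OF t False] snd_le[of "\<psi> t - steiner t (y t) (b t)"] by simp
      also have "norm (y t - z t) \<le> 2 * R"
        using norm_triangle_ineq4[of "y t" "z t"] y(3)[OF t] z(2)[OF t] by (simp add: R_def)
      then have "\<kappa> t * norm (y t - z t) \<le> \<kappa> t * (2 * R)" using kap0[OF t] by (rule mult_left_mono)
      finally show ?thesis using False by (simp add: bad_def \<kappa>_def R_def mult_ac)
    qed
    then show "snd (steiner t (z t) (a t)) \<le> threshold L M t + 2 * lip_const * radius M * k (radius M) t"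
      by (simp add: \<psi>_def)
  qed
  \<comment> \<open>On the bad set the two controls are unrelated and only the sum of the two
    velocity bounds is available; elsewhere the controls agree and the Lipschitz estimate
    applies.\<close>
  define w where "w t = (if bad t then 2 * (1 + R) * c t else 0)" for t
  have w0: "0 \<le> w t" if "t \<in> {s..T}" for t using H4_nonneg[OF sT[OF that]] R by (simp add: w_def)
  have w_int: "w integrable_on {s..T}"
  proof (rule measurable_bounded_by_integrable_imp_integrable)
    show "w \<in> borel_measurable (lebesgue_on {s..T})" unfolding w_def by measurable
    show "(\<lambda>t. 2 * (1 + R) * c t) integrable_on {s..T}"
      by (intro integrable_on_mult_right c_integrable_on s order_refl)
    show "norm (w t) \<le> 2 * (1 + R) * c t" if "t \<in> {s..T}" for t
      using H4_nonneg[OF sT[OF that]] R by (simp add: w_def)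
  qed simp
  define A where "A = integral {s..T} w"
  have A0: "0 \<le> A" unfolding A_def using w_int w0 by (rule Henstock_Kurzweil_Integration.integral_nonneg)
  have e_cont: "continuous_on {s..T} (\<lambda>t. norm (y t - z t))" by (intro continuous_intros y z)
  have prod_int: "(\<lambda>t. \<kappa> t * norm (y t - z t)) integrable_on {s..T}"
    by (rule integrable_mult_continuous_real[OF kap_int kap0 e_cont])
  have fst_bound: "norm (fst u) \<le> c t * (1 + R)" if "t \<in> {s..T}" "norm x \<le> R" "u \<in> conj_epi (H t x)" for t x u
  proof -
    have "norm (fst u) \<le> c t * (1 + norm x)" using that by (intro conj_epi_H_norm_fst_le sT)
    also have "\<dots> \<le> c t * (1 + R)" using that H4_nonneg[OF sT[OF that(1)]] by (intro mult_left_mono) auto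
    finally show ?thesis .
  qed
  \<comment> \<open>Displacement is created on the bad set only, in total at most \<open>A\<close>;
    elsewhere it is propagated at rate \<open>\<kappa>\<close>, whence the exponential
    factor.\<close>
  have e_le: "norm (y t - z t) \<le> A * exp (total_k M)" if t: "t \<in> {s..T}" for t
  proof -
    have "norm (y t - z t) \<le> A * exp (integral {s..t} \<kappa>)"
    proof (rule gronwall[OF kap_int kap0 e_cont _ t])
      fix r assume r: "r \<in> {s..T}"
      have sub: "{s..r} \<subseteq> {s..T}" using r by auto
      have I: "((\<lambda>t. fst (steiner t (y t) (b t)) - fst (\<psi> t)) has_integral (y r - z r)) {s..r}"
        using has_integral_diff[OF y(4)[OF r] z(3)[OF r]] by (simp add: \<psi>_def)
      have "norm (integral {s..r} (\<lambda>t. fst (steiner t (y t) (b t)) - fst (\<psi> t)))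
          \<le> integral {s..r} (\<lambda>t. w t + \<kappa> t * norm (y t - z t))"
      proof (rule Henstock_Kurzweil_Integration.integral_norm_bound_integral)
        show "(\<lambda>t. w t + \<kappa> t * norm (y t - z t)) integrable_on {s..r}"
          using integrable_subinterval_real[OF w_int sub] integrable_subinterval_real[OF prod_int sub] by (rule integrable_add)
        fix t assume "t \<in> {s..r}"
        then have t: "t \<in> {s..T}" using sub by blast
        show "norm (fst (steiner t (y t) (b t)) - fst (\<psi> t)) \<le> w t + \<kappa> t * norm (y t - z t)"
        proof (cases "bad t")
          case True
          have "norm (fst (steiner t (y t) (b t)) - fst (\<psi> t)) \<le> c t * (1 + R) + c t * (1 + R)"
            using fst_bound[OF t _ steiner_mem[OF sT[OF t]], of "y t" "b t"] fst_bound[OF t _ steiner_mem[OF sT[OF t]], of "z t" "a t"]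
              y(3)[OF t] z(2)[OF t] norm_triangle_ineq4[of "fst (steiner t (y t) (b t))" "fst (\<psi> t)"]
            by (simp add: R_def \<psi>_def)
          also have "\<dots> = w t" using True by (simp add: w_def)
          finally show ?thesis using kap0[OF t] by (simp add: add_increasing2)
        next
          case False
          have "norm (fst (\<psi> t - steiner t (y t) (b t))) \<le> norm (\<psi> t - steiner t (y t) (b t))"
            by (metis norm_fst_le prod.collapse)
          then show ?thesis using close[OF t False] False by (simp add: w_def norm_minus_commute)
        qed
      qed (use I in auto)
      also have "\<dots> = integral {s..r} w + integral {s..r} (\<lambda>t. \<kappa> t * norm (y t - z t))"
        using integrable_subinterval_real[OF w_int sub] integrable_subinterval_real[OF prod_int sub]
        by (rule Henstock_Kurzweil_Integration.integral_add)
      also have "integral {s..r} w \<le> A"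
        unfolding A_def using w0 by (intro integral_subset_le[OF sub] integrable_subinterval_real[OF w_int sub] w_int) auto
      finally show "norm (y r - z r) \<le> A + integral {s..r} (\<lambda>t. \<kappa> t * norm (y t - z t))"
        using integral_unique[OF I] by simp
    qed
    also have "integral {s..t} \<kappa> \<le> total_k M"
      unfolding total_k_def \<kappa>_def R_def using s t lip_const_pos HLC_nonneg[OF radius_pos[OF M(1)]]
      by (intro integral_subset_le integrable_on_mult_right k_integrable_on radius_pos M) auto
    then have "A * exp (integral {s..t} \<kappa>) \<le> A * exp (total_k M)" using A0 by (intro mult_left_mono) auto
    finally show ?thesis .
  qed
  define E where "E = A * exp (total_k M)"
  have E0: "0 \<le> E" using A0 by (simp add: E_def)
  have psi_int: "\<psi> integrable_on {s..T}" using proc by (simp add: bounded_process_def)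
  then have snd_int: "(\<lambda>t. snd (\<psi> t)) integrable_on {s..T}"
    using integral_fst_snd(2)[OF integrable_integral] by blast
  \<comment> \<open>Price of a unit of \<open>A\<close>: the displacement is at most
    \<open>A * exp (total_k M)\<close>, and a unit of it changes the terminal cost by at most
    \<open>L\<close> and the integral cost by at most \<open>total_k M\<close>.\<close>
  define Q where "Q = exp (total_k M) * (L + total_k M)"
  have "integral {s..T} (\<lambda>t. snd (\<psi> t)) \<le> integral {s..T} (\<lambda>t. snd (steiner t (y t) (b t)) + (\<kappa> t * E - Q * w t))"
  proof (rule integral_le[OF snd_int])
    show "(\<lambda>t. snd (steiner t (y t) (b t)) + (\<kappa> t * E - Q * w t)) integrable_on {s..T}"
      by (intro integrable_add integrable_diff y(5) integrable_on_mult_left integrable_on_mult_right kap_int w_int)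
    fix t assume t: "t \<in> {s..T}"
    have kE: "\<kappa> t * norm (y t - z t) \<le> \<kappa> t * E" using e_le[OF t] kap0[OF t] unfolding E_def by (rule mult_left_mono)
    show "snd (\<psi> t) \<le> snd (steiner t (y t) (b t)) + (\<kappa> t * E - Q * w t)"
    proof (cases "bad t")
      case True
      have "snd (\<psi> t) \<le> rest_bound M t" using psi_bad[OF t True] snd_le[of "\<psi> t"] by linarith
      \<comment> \<open>By its definition the threshold lies exactly \<open>Q * w t\<close> above
        the rest cost on the bad set; this gap is the saving.\<close>
      also have "\<dots> = threshold L M t - Q * w t" using True by (simp add: threshold_def Q_def w_def R_def)
      also have "threshold L M t \<le> snd (steiner t (y t) (b t))" using True by (simp add: bad_def)
      finally show ?thesis using mult_nonneg_nonneg[OF kap0[OF t] E0] by linarith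
    next
      case False
      then have "w t = 0" by (simp add: w_def)
      moreover have "snd (\<psi> t) \<le> snd (steiner t (y t) (b t)) + \<kappa> t * norm (y t - z t)"
        using close[OF t False] snd_le[of "\<psi> t - steiner t (y t) (b t)"] by simp
      ultimately show ?thesis using kE by simp
    qed
  qed
  also have "\<dots> = integral {s..T} (\<lambda>t. snd (steiner t (y t) (b t))) + (integral {s..T} \<kappa> * E - Q * A)"
    unfolding A_def
    by (intro integral_unique has_integral_add has_integral_diff has_integral_mult_left has_integral_mult_right integrable_integral
        y(5) kap_int w_int)
  also have "integral {s..T} \<kappa> * E \<le> total_k M * E"
  proof (rule mult_right_mono[OF _ E0])
    show "integral {s..T} \<kappa> \<le> total_k M"
      unfolding total_k_def \<kappa>_def R_def using s lip_const_pos HLC_nonneg[OF radius_pos[OF M(1)]]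
      by (intro integral_subset_le integrable_on_mult_right k_integrable_on radius_pos M) auto
  qed
  finally have "integral {s..T} (\<lambda>t. snd (\<psi> t)) \<le> integral {s..T} (\<lambda>t. snd (steiner t (y t) (b t))) + (total_k M * E - Q * A)"
    by simp
  moreover have "g (z T) \<le> g (y T) + L * E"
  proof -
    have T: "T \<in> {s..T}" using s by simp
    have "dist (g (z T)) (g (y T)) \<le> L * dist (z T) (y T)"
      using lipschitz_onD[OF g] z(2)[OF T] y(3)[OF T] by simp
    also have "\<dots> \<le> L * E"
      using e_le[OF T] L by (intro mult_left_mono) (auto simp: dist_norm norm_minus_commute E_def)
    finally show ?thesis by (simp add: dist_real_def)
  qed
  \<comment> \<open>The guaranteed saving \<open>Q * A\<close> equals the bound on the additional
    terminal and running cost; the threshold was designed for this balance.\<close>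
  moreover have "L * E + (total_k M * E - Q * A) = 0" by (simp add: E_def Q_def algebra_simps)
  ultimately have "g (z T) + integral {s..T} (\<lambda>t. snd (\<psi> t)) \<le> g (y T) + integral {s..T} (\<lambda>t. snd (steiner t (y t) (b t)))"
    by linarith
  then show ?thesis using proc y(6)[of g] by auto
qed

end

section \<open>Existence of optimal pairs\<close>

context hamiltonian
begin

text \<open>Integrating the defining inequalities of the epigraph makes them stable under uniform
  convergence of the primitives.\<close>
lemma conj_epi_closure:
  fixes z :: "real \<Rightarrow> 'a" and Z :: "real \<Rightarrow> 'a \<times> real"
  assumes s: "0 \<le> s" "s \<le> T" and R: "0 < R"
    and \<psi>: "\<And>n. \<psi> n integrable_on {s..T}" "\<And>n t. t \<in> {s..T} \<Longrightarrow> \<psi> n t \<in> conj_epi (H t (x n t))"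
    and x: "\<And>n. continuous_on {s..T} (x n)" "\<And>n t. t \<in> {s..T} \<Longrightarrow> norm (x n t) \<le> R"
    and z: "continuous_on {s..T} z" "\<And>t. t \<in> {s..T} \<Longrightarrow> norm (z t) \<le> R"
    and lim_x: "\<And>t. t \<in> {s..T} \<Longrightarrow> (\<lambda>n. x n t) \<longlonglongrightarrow> z t"
    and lim_Z: "\<And>t. t \<in> {s..T} \<Longrightarrow> (\<lambda>n. integral {s..t} (\<psi> n)) \<longlonglongrightarrow> Z t"
    and \<phi>: "\<And>r t. s \<le> r \<Longrightarrow> r \<le> t \<Longrightarrow> t \<le> T \<Longrightarrow> (\<phi> has_integral (Z t - Z r)) {r..t}"
  shows "AE t in lebesgue_on {s..T}. \<phi> t \<in> conj_epi (H t (z t))"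
proof -
  have sT: "t \<in> {0..T}" if "t \<in> {s..T}" for t using that s by auto
  \<comment> \<open>For fixed \<open>q\<close> this dominates \<open>H\<close> along every curve in
    the ball; it gives integrability and later justifies dominated convergence.\<close>
  have H_le: "norm (H t y q) \<le> \<bar>H t 0 0\<bar> + k R t * R + c t * ((1 + R) * norm q)"
    if t: "t \<in> {s..T}" and y: "norm y \<le> R" for t y q
  proof -
    have "\<bar>H t y q - H t y 0\<bar> \<le> c t * (1 + norm y) * norm (q - 0)" by (rule H4[OF sT[OF t]])
    also have "\<dots> \<le> c t * (1 + R) * norm (q - 0)"
      using y H4_nonneg[OF sT[OF t]] by (intro mult_right_mono mult_left_mono) auto
    finally have "\<bar>H t y q - H t y 0\<bar> \<le> c t * ((1 + R) * norm q)" by (simp add: mult.assoc)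
    then show ?thesis using H_zero_le[OF R sT[OF t], of y] y by simp
  qed
  have dom_int: "(\<lambda>t. \<bar>H t 0 0\<bar> + k R t * R + c t * ((1 + R) * norm q)) integrable_on {r..t}"
    if "{r..t} \<subseteq> {s..T}" for r t q
  proof (rule integrable_subinterval_real[OF integrable_on_lebesgue_on])
    show "integrable (lebesgue_on {0..T}) (\<lambda>t. \<bar>H t 0 0\<bar> + k R t * R + c t * ((1 + R) * norm q))"
      by (intro Bochner_Integration.integrable_add integrable_mult_left integrable_abs c_int k_int R H00_int)
  qed (use that sT in auto)
  have H_int: "(\<lambda>t. H t (y t) q) integrable_on {r..t}"
    if y: "continuous_on {s..T} y" "\<And>t. t \<in> {s..T} \<Longrightarrow> norm (y t) \<le> R" and sub: "{r..t} \<subseteq> {s..T}" for y q r t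
  proof (rule integrable_subinterval_real[OF _ sub])
    show "(\<lambda>t. H t (y t) q) integrable_on {s..T}"
    proof (rule measurable_bounded_by_integrable_imp_integrable[OF _ dom_int[OF order_refl, of q]])
      show "(\<lambda>t. H t (y t) q) \<in> borel_measurable (lebesgue_on {s..T})"
        by (intro borel_measurable_H s continuous_imp_measurable_on_sets_lebesgue y) simp
    qed (use H_le y in auto)
  qed
  have ineq: "AE t in lebesgue_on {s..T}. (q, -1) \<bullet> \<phi> t - H t (z t) q \<le> 0" for q
  proof -
    have \<phi>q: "((\<lambda>t. (q, -1) \<bullet> \<phi> t) has_integral (q, -1) \<bullet> (Z t - Z r)) {r..t}" if "s \<le> r" "r \<le> t" "t \<le> T" for r t
      using has_integral_linear[OF \<phi>[OF that] bounded_linear_inner_right[of "(q, -1)"]] by (simp add: o_def)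
    have "AE t in lebesgue_on {s..T}. (q, -1) \<bullet> \<phi> t \<le> H t (z t) q"
    proof (rule AE_le_of_integral_le)
      show "(\<lambda>t. (q, -1) \<bullet> \<phi> t) integrable_on {s..T}" using \<phi>q[of s T] s by blast
      show "(\<lambda>t. H t (z t) q) integrable_on {s..T}" by (rule H_int[OF z order_refl])
      fix r t assume rt: "s \<le> r" "r \<le> t" "t \<le> T"
      then have mem: "r \<in> {s..T}" "t \<in> {s..T}" and sub: "{r..t} \<subseteq> {s..T}" by auto
      have "(\<lambda>n. integral {r..t} (\<lambda>u. H u (x n u) q)) \<longlonglongrightarrow> integral {r..t} (\<lambda>u. H u (z u) q)"
      proof (rule dominated_convergence(2)[OF H_int[OF x sub] dom_int[OF sub]])
        show "norm (H u (x n u) q) \<le> \<bar>H u 0 0\<bar> + k R u * R + c u * ((1 + R) * norm q)" if "u \<in> {r..t}" for n u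
          using H_le x(2) that sub by blast
        show "(\<lambda>n. H u (x n u) q) \<longlonglongrightarrow> H u (z u) q" if "u \<in> {r..t}" for u
          using continuous_on_tendsto_compose[OF H_continuous(2)[OF sT] lim_x, of u u q] that sub by auto
      qed
      moreover have "(\<lambda>n. (q, -1) \<bullet> (integral {s..t} (\<psi> n) - integral {s..r} (\<psi> n))) \<longlonglongrightarrow> (q, -1) \<bullet> (Z t - Z r)"
        by (intro tendsto_intros lim_Z mem)
      moreover have "(q, -1) \<bullet> (integral {s..t} (\<psi> n) - integral {s..r} (\<psi> n)) \<le> integral {r..t} (\<lambda>u. H u (x n u) q)" for n
      proof -
        have I: "((\<lambda>t. (q, -1) \<bullet> \<psi> n t) has_integral (q, -1) \<bullet> (integral {s..t} (\<psi> n) - integral {s..r} (\<psi> n))) {r..t}"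
          using has_integral_linear[OF integrable_integral[OF integrable_subinterval_real[OF \<psi>(1) sub]] bounded_linear_inner_right[of "(q, -1)"], of n]
            integral_diff_interval[OF \<psi>(1) rt, of n]
          by (simp add: o_def)
        show ?thesis
        proof (rule has_integral_le[OF I integrable_integral[OF H_int[OF x sub]]])
          fix u assume "u \<in> {r..t}"
          then have "\<psi> n u \<in> conj_epi (H u (x n u))" using \<psi>(2) sub by blast
          then show "(q, -1) \<bullet> \<psi> n u \<le> H u (x n u) q"
            using conj_epiD[of "fst (\<psi> n u)" "snd (\<psi> n u)" "H u (x n u)" q] by (simp add: inner_prod_def inner_commute)
        qed
      qed
      ultimately have "(q, -1) \<bullet> (Z t - Z r) \<le> integral {r..t} (\<lambda>u. H u (z u) q)"
        by (meson LIMSEQ_le)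
      then show "integral {r..t} (\<lambda>t. (q, -1) \<bullet> \<phi> t) \<le> integral {r..t} (\<lambda>u. H u (z u) q)"
        using integral_unique[OF \<phi>q[OF rt]] by simp
    qed
    then show ?thesis by (rule eventually_mono) simp
  qed
  \<comment> \<open>The exceptional null set of \<open>ineq\<close> depends on \<open>q\<close>, so
    only countably many halfspaces are imposed at once; a dense sequence of them determines the
    epigraph.\<close>
  obtain q :: "nat \<Rightarrow> 'a" where q: "\<forall>U. open U \<longrightarrow> U \<noteq> {} \<longrightarrow> (\<exists>i. q i \<in> U)"
    using dense_sequence_exists by blast
  have "AE t in lebesgue_on {s..T}. \<forall>i. (q i, -1) \<bullet> \<phi> t - H t (z t) (q i) \<le> 0"
    unfolding AE_all_countable using ineq by blast
  moreover have "AE t in lebesgue_on {s..T}. t \<in> {s..T}"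
    by (rule AE_I2) simp
  ultimately show ?thesis
  proof eventually_elim
    case (elim t)
    show ?case
      unfolding conj_epi_dense_sequence[OF q H_continuous(1)[OF sT[OF elim(2)]]] by (rule elim(1))
  qed
qed

lemma optimal_pair_exists:
  assumes s: "0 \<le> s" "s \<le> T" and M: "0 \<le> M" "norm x0 \<le> M" and g: "L-lipschitz_on (cball 0 (radius M)) g"
  shows "\<exists>z a. optimal_pair H g T s x0 z a \<and>
    (AE t in lebesgue_on {s..T}. norm (vector_derivative z (at t within {s..T}), a t) \<le> 2 * velocity_bound L M t)"
proof -
  let ?m = "velocity_bound L M"
  define R where "R = radius M"
  have R: "0 < R" unfolding R_def using M(1) by (rule radius_pos)
  have L: "0 \<le> L" using g by (rule lipschitz_on_nonneg)
  have Tin: "T \<in> {s..T}" "s \<in> {s..T}" using s by auto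
  have m_leb: "integrable (lebesgue_on {s..T}) ?m"
    using s by (intro integrable_subinterval[OF integrable_velocity_bound[OF M(1)]]) auto
  have m_int: "?m integrable_on {r..t}" if "{r..t} \<subseteq> {s..T}" for r t
    by (rule integrable_subinterval_real[OF integrable_on_lebesgue_on[OF m_leb] that]) simp
  define J where "J z \<psi> = g (z T) + integral {s..T} (\<lambda>t. snd (\<psi> t))" for z :: "real \<Rightarrow> 'a" and \<psi> :: "real \<Rightarrow> 'a \<times> real"
  define P where "P = bounded_process L M s x0"
  define V where "V = {J z \<psi> |z \<psi>. P z \<psi>}"
  have P: "\<psi> integrable_on {s..T}" "\<And>t. t \<in> {s..T} \<Longrightarrow> norm (z t) \<le> R"
      "\<And>t. t \<in> {s..T} \<Longrightarrow> \<psi> t \<in> conj_epi (H t (z t))" "\<And>t. t \<in> {s..T} \<Longrightarrow> norm (\<psi> t) \<le> ?m t"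
      "\<And>t. t \<in> {s..T} \<Longrightarrow> z t = x0 + fst (integral {s..t} \<psi>)" if "P z \<psi>" for z \<psi>
    using that unfolding P_def bounded_process_def R_def by blast+
  have P_int: "norm (integral {r..t} \<psi>) \<le> integral {r..t} ?m" if "P z \<psi>" "s \<le> r" "t \<le> T" for z \<psi> r t
  proof -
    have sub: "{r..t} \<subseteq> {s..T}" using that by auto
    show ?thesis
      using P(4)[OF that(1)] sub
      by (intro Henstock_Kurzweil_Integration.integral_norm_bound_integral m_int sub integrable_subinterval_real[OF P(1)[OF that(1)] sub]) auto
  qed
  have J_eq: "J z \<psi> = g (z T) + snd (integral {s..T} \<psi>)" if "P z \<psi>" for z \<psi>
    unfolding J_def using integral_fst_snd(2)[OF integrable_integral[OF P(1)[OF that]]] by (simp add: integral_unique)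
  have V_ne: "V \<noteq> {}" using bounded_process_exists[OF s M L] unfolding V_def P_def by blast
  have V_bdd: "bdd_below V"
  proof (rule bdd_belowI)
    fix v assume "v \<in> V"
    then obtain z \<psi> where z: "P z \<psi>" and v: "v = J z \<psi>" unfolding V_def by blast
    have "dist (g 0) (g (z T)) \<le> L * dist 0 (z T)"
      using lipschitz_onD[OF g, of 0 "z T"] P(2)[OF z Tin(1)] R by (simp add: R_def)
    also have "\<dots> \<le> L * R" using P(2)[OF z Tin(1)] L by (intro mult_left_mono) auto
    finally have "g 0 - L * R \<le> g (z T)" by (simp add: dist_real_def)
    moreover have "\<bar>snd (integral {s..T} \<psi>)\<bar> \<le> integral {s..T} ?m"
      using P_int[OF z, of s T] by (metis norm_snd_le order_refl order_trans prod.collapse real_norm_def)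
    ultimately show "g 0 - L * R - integral {s..T} ?m \<le> v" using J_eq[OF z] v by simp
  qed
  have "\<exists>z \<psi>. P z \<psi> \<and> J z \<psi> < Inf V + 1 / real (Suc n)" for n
  proof -
    have "Inf V < Inf V + 1 / real (Suc n)" by simp
    then show ?thesis using cInf_less_iff[OF V_ne V_bdd] unfolding V_def by blast
  qed
  then obtain x \<psi> where x\<psi>: "\<And>n. P (x n) (\<psi> n)" "\<And>n. J (x n) (\<psi> n) < Inf V + 1 / real (Suc n)"
    by metis
  have lim_J: "(\<lambda>n. J (x n) (\<psi> n)) \<longlonglongrightarrow> Inf V"
  proof (rule tendsto_sandwich)
    show "\<forall>\<^sub>F n in sequentially. Inf V \<le> J (x n) (\<psi> n)"
      using x\<psi>(1) by (intro always_eventually allI cInf_lower[OF _ V_bdd]) (auto simp: V_def)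
    show "\<forall>\<^sub>F n in sequentially. J (x n) (\<psi> n) \<le> Inf V + 1 / real (Suc n)"
      using x\<psi>(2) by (intro always_eventually allI) (simp add: less_imp_le)
    show "(\<lambda>n. Inf V + 1 / real (Suc n)) \<longlonglongrightarrow> Inf V"
      using tendsto_add[OF tendsto_const[of "Inf V"] LIMSEQ_Suc[OF lim_1_over_n]] by simp
  qed simp
  \<comment> \<open>The pairs of velocity and cost may oscillate along the minimizing sequence;
    compactness is sought for their primitives.\<close>
  define Zn where "Zn n t = integral {s..t} (\<psi> n)" for n t
  have Zn_diff: "norm (Zn n t - Zn n r) \<le> integral {r..t} ?m" if "s \<le> r" "r \<le> t" "t \<le> T" for n r t
    using integral_diff_interval[OF P(1)[OF x\<psi>(1)] that] P_int[OF x\<psi>(1) that(1,3)] by (simp add: Zn_def)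
  define I where "I t = integral {s..t} ?m" for t
  have I_cont: "continuous_on {s..T} I"
    \<comment> \<open>Continuity of the primitive of the common bound provides one modulus of
      continuity for all \<open>Zn n\<close>.\<close>
    unfolding I_def by (intro indefinite_integral_continuous_1 m_int order_refl)
  have I_diff: "I t - I r = integral {r..t} ?m" if "s \<le> r" "r \<le> t" "t \<le> T" for r t
    unfolding I_def by (rule integral_diff_interval[OF m_int[OF order_refl] that])
  have Zn_I: "norm (Zn n r - Zn n t) \<le> \<bar>I r - I t\<bar>" if "r \<in> {s..T}" "t \<in> {s..T}" for n r t
    using that
  proof (induction r t rule: linorder_wlog)
    case (le r t)
    then show ?case using Zn_diff[of r t n] I_diff[of r t] by (simp add: norm_minus_commute)
  next
    case (sym r t)
    then show ?case by (simp add: norm_minus_commute abs_minus_commute)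
  qed
  have Zn0: "Zn n s = 0" for n by (simp add: Zn_def)
  obtain Z r where Z: "continuous_on {s..T} Z" and r: "strict_mono (r :: nat \<Rightarrow> nat)"
    and unif: "\<And>e. 0 < e \<Longrightarrow> \<exists>N. \<forall>n t. n \<ge> N \<and> t \<in> {s..T} \<longrightarrow> norm (Zn (r n) t - Z t) < e"
  proof (rule Arzela_Ascoli[of "{s..T}" Zn "I T"])
    show "norm (Zn n t) \<le> I T" if "t \<in> {s..T}" for n t
    proof -
      have "norm (Zn n t) \<le> integral {s..t} ?m" using Zn_diff[of s t n] Zn0 that by simp
      also have "\<dots> = I t" by (simp add: I_def)
      also have "I t \<le> I T"
      proof -
        have "0 \<le> norm (Zn n T - Zn n t)" by simp
        also have "\<dots> \<le> integral {t..T} ?m" using that by (intro Zn_diff) auto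
        finally show ?thesis using I_diff[of t T] that by simp
      qed
      finally show ?thesis .
    qed
    fix t e :: real assume te: "t \<in> {s..T}" "0 < e"
    then obtain d where d: "d > 0" "\<forall>y\<in>{s..T}. dist y t < d \<longrightarrow> dist (I y) (I t) < e"
      using I_cont unfolding continuous_on_iff by blast
    show "\<exists>d>0. \<forall>n y. y \<in> {s..T} \<and> norm (t - y) < d \<longrightarrow> norm (Zn n t - Zn n y) < e"
    proof (intro exI[of _ d] conjI allI impI)
      fix n y assume y: "y \<in> {s..T} \<and> norm (t - y) < d"
      then have "dist y t < d" by (simp add: dist_real_def abs_minus_commute)
      then have "dist (I y) (I t) < e" using d(2) y by blast
      then have "\<bar>I t - I y\<bar> < e" by (simp add: dist_real_def abs_minus_commute)
      then show "norm (Zn n t - Zn n y) < e" using Zn_I[OF te(1), of y n] y by simp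
    qed (fact d(1))
  qed auto
  have lim_Zn: "(\<lambda>n. Zn (r n) t) \<longlonglongrightarrow> Z t" if "t \<in> {s..T}" for t
    using unif that by (intro LIMSEQ_I) blast
  have Zs: "Z s = 0" using lim_Zn[OF Tin(2)] by (simp add: Zn0 LIMSEQ_const_iff)
  \<comment> \<open>In this integrated form the pointwise bound on the integrands passes to the
    limit. It yields both the existence of the density and, by differentiation, its bound.\<close>
  have Z_dom: "norm (Z t - Z u) \<le> integral {u..t} ?m" if ut: "s \<le> u" "u \<le> t" "t \<le> T" for u t
  proof (rule LIMSEQ_le_const2)
    show "(\<lambda>n. norm (Zn (r n) t - Zn (r n) u)) \<longlonglongrightarrow> norm (Z t - Z u)"
      using ut by (intro tendsto_intros lim_Zn) auto
    show "\<exists>N. \<forall>n\<ge>N. norm (Zn (r n) t - Zn (r n) u) \<le> integral {u..t} ?m" using Zn_diff[OF ut] by blast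
  qed
  have m0: "0 \<le> ?m t" if "t \<in> {s..T}" for t using P(4)[OF x\<psi>(1)[of 0] that] norm_ge_zero order_trans by blast
  obtain \<phi> where \<phi>: "\<And>u t. s \<le> u \<Longrightarrow> u \<le> t \<Longrightarrow> t \<le> T \<Longrightarrow> (\<phi> has_integral (Z t - Z u)) {u..t}"
    using dominated_has_density[OF s(2) m_int[OF order_refl] m0 Z_dom] by blast
  have \<phi>_int: "\<phi> integrable_on {s..T}" using \<phi>[of s T] s by blast
  have \<phi>_Z: "integral {s..t} \<phi> = Z t" if "t \<in> {s..T}" for t
    using integral_unique[OF \<phi>[of s t]] that Zs by simp
  have \<phi>_m: "AE t in lebesgue_on {s..T}. norm (\<phi> t) \<le> ?m t"
    using Z_dom integral_unique[OF \<phi>] by (intro AE_norm_le_of_integral_le \<phi>_int m_int order_refl) simp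
  define z where "z t = x0 + fst (Z t)" for t
  have z_cont: "continuous_on {s..T} z" unfolding z_def by (intro continuous_intros Z)
  have x_eq: "x n t = x0 + fst (Zn n t)" if "t \<in> {s..T}" for n t
    using P(5)[OF x\<psi>(1) that] by (simp add: Zn_def)
  have x_cont: "continuous_on {s..T} (x n)" for n
  proof (rule continuous_on_eq)
    show "continuous_on {s..T} (\<lambda>t. x0 + fst (Zn n t))"
      unfolding Zn_def by (intro continuous_intros indefinite_integral_continuous_1 P(1)[OF x\<psi>(1)])
  qed (simp add: x_eq)
  have lim_x: "(\<lambda>n. x (r n) t) \<longlonglongrightarrow> z t" if "t \<in> {s..T}" for t
    unfolding x_eq[OF that] z_def by (intro tendsto_intros lim_Zn that)
  have z_R: "norm (z t) \<le> R" if "t \<in> {s..T}" for t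
    using LIMSEQ_le_const2[OF tendsto_norm[OF lim_x[OF that]]] P(2)[OF x\<psi>(1) that] by blast
  have \<phi>_mem: "AE t in lebesgue_on {s..T}. \<phi> t \<in> conj_epi (H t (z t))"
    by (rule conj_epi_closure[OF s R P(1)[OF x\<psi>(1)] P(3)[OF x\<psi>(1)] x_cont P(2)[OF x\<psi>(1)] z_cont z_R lim_x lim_Zn[unfolded Zn_def] \<phi>])
  then have st_eq: "AE t in lebesgue_on {s..T}. steiner t (z t) (\<phi> t) = \<phi> t"
    by (rule eventually_mono) (rule steiner_fixed)
  have \<phi>_meas: "\<phi> \<in> borel_measurable (lebesgue_on {s..T})" using \<phi>_int by (rule integrable_imp_measurable)
  have \<phi>_leb: "integrable (lebesgue_on {s..T}) \<phi>"
    using \<phi>_m by (intro Bochner_Integration.integrable_bound[OF m_leb \<phi>_meas]) (auto elim!: eventually_mono)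
  have snd_leb: "integrable (lebesgue_on {s..T}) (\<lambda>t. snd (\<phi> t))"
    using integrable_bounded_linear[OF bounded_linear_snd \<phi>_leb] .
  have "(\<lambda>t. steiner t (z t) (\<phi> t)) \<in> borel_measurable (lebesgue_on {s..T})"
    by (intro borel_measurable_steiner s \<phi>_meas continuous_imp_measurable_on_sets_lebesgue z_cont) simp
  then have l_meas: "(\<lambda>t. snd (steiner t (z t) (\<phi> t))) \<in> borel_measurable (lebesgue_on {s..T})"
    by (rule measurable_compose) (simp add: borel_measurable_continuous_onI continuous_on_snd)
  have l_eq: "AE t in lebesgue_on {s..T}. snd (steiner t (z t) (\<phi> t)) = snd (\<phi> t)"
    using st_eq by (rule eventually_mono) simp
  have der: "AE t in lebesgue_on {s..T}. (z has_vector_derivative fst (\<phi> t)) (at t within {s..T})"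
  proof -
    have "AE t in lebesgue_on {s..T}. t \<in> {s..T}" by (rule AE_I2) simp
    with AE_integral_has_vector_derivative[OF \<phi>_int] show ?thesis
    proof eventually_elim
      case (elim t)
      have "((\<lambda>t. fst (integral {s..t} \<phi>)) has_vector_derivative fst (\<phi> t)) (at t within {s..T})"
        by (rule bounded_linear.has_vector_derivative[OF bounded_linear_fst elim(1)])
      then have "((\<lambda>t. x0 + fst (integral {s..t} \<phi>)) has_vector_derivative fst (\<phi> t)) (at t within {s..T})"
        by (auto intro!: derivative_eq_intros)
      then show ?case
        by (rule has_vector_derivative_transform[OF elim(2), rotated]) (simp add: z_def \<phi>_Z)
    qed
  qed
  have adm: "admissible H T s x0 z \<phi>"
    unfolding admissible_def steiner_f_eq steiner_l_eq
  proof (intro conjI)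
    show "abs_cont_on {s..T} z"
    proof (rule abs_cont_on_dominated[OF m_int[OF order_refl] m0])
      fix u t assume ut: "s \<le> u" "u \<le> t" "t \<le> T"
      have "norm (z t - z u) \<le> norm (Z t - Z u)"
      proof -
        have "z t - z u = fst (Z t - Z u)" by (simp add: z_def)
        then show ?thesis by (metis norm_fst_le prod.collapse)
      qed
      then show "norm (z t - z u) \<le> integral {u..t} ?m" using Z_dom[OF ut] by simp
    qed
    show "z s = x0" by (simp add: z_def Zs)
    show "integrable (lebesgue_on {s..T}) \<phi>" by (rule \<phi>_leb)
    show "integrable (lebesgue_on {s..T}) (\<lambda>t. snd (steiner t (z t) (\<phi> t)))"
      using snd_leb integrable_cong_AE[OF l_meas borel_measurable_integrable[OF snd_leb] l_eq] by simp
    show "AE t in lebesgue_on {s..T}. (z has_vector_derivative fst (steiner t (z t) (\<phi> t))) (at t within {s..T})"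
      using der st_eq by eventually_elim simp
  qed
  have cost_eq: "cost H g T s z \<phi> = Inf V"
  proof -
    have "cost H g T s z \<phi> = g (z T) + integral\<^sup>L (lebesgue_on {s..T}) (\<lambda>t. snd (\<phi> t))"
      unfolding cost_def steiner_l_eq
      using integral_cong_AE[OF l_meas borel_measurable_integrable[OF snd_leb] l_eq] by simp
    also have "integral\<^sup>L (lebesgue_on {s..T}) (\<lambda>t. snd (\<phi> t)) = integral {s..T} (\<lambda>t. snd (\<phi> t))"
      by (rule lebesgue_integral_eq_integral[OF snd_leb]) simp
    also have "\<dots> = snd (Z T)"
      using integral_fst_snd(2)[OF integrable_integral[OF \<phi>_int]] \<phi>_Z[OF Tin(1)] by (simp add: integral_unique)
    finally have c: "cost H g T s z \<phi> = g (z T) + snd (Z T)" .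
    \<comment> \<open>All end points and their limit lie in the ball on which \<open>g\<close> is
      Lipschitz.\<close>
    have "(\<lambda>n. g (x (r n) T)) \<longlonglongrightarrow> g (z T)"
      using lipschitz_on_continuous_on[OF g] lim_x[OF Tin(1)] z_R[OF Tin(1)] P(2)[OF x\<psi>(1) Tin(1)]
      by (intro continuous_on_tendsto_compose[of "cball 0 R" g]) (auto simp: R_def)
    then have "(\<lambda>n. J (x (r n)) (\<psi> (r n))) \<longlonglongrightarrow> g (z T) + snd (Z T)"
      unfolding J_eq[OF x\<psi>(1)] Zn_def[symmetric] by (intro tendsto_add tendsto_snd lim_Zn Tin)
    moreover have "(\<lambda>n. J (x (r n)) (\<psi> (r n))) \<longlonglongrightarrow> Inf V"
      using LIMSEQ_subseq_LIMSEQ[OF lim_J r] by (simp add: o_def)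
    ultimately show ?thesis using c LIMSEQ_unique by metis
  qed
  have "optimal_pair H g T s x0 z \<phi>"
    unfolding optimal_pair_def
  proof (intro conjI adm allI impI)
    fix y b assume "admissible H T s x0 y b"
    from admissible_improvement[OF s M g this] obtain z' \<psi>'
      where "P z' \<psi>'" "J z' \<psi>' \<le> cost H g T s y b" unfolding P_def J_def by blast
    moreover from this(1) have "Inf V \<le> J z' \<psi>'" by (intro cInf_lower V_bdd) (auto simp: V_def)
    ultimately show "cost H g T s z \<phi> \<le> cost H g T s y b" using cost_eq by simp
  qed
  moreover have "AE t in lebesgue_on {s..T}. norm (vector_derivative z (at t within {s..T}), \<phi> t) \<le> 2 * ?m t"
  proof (cases "s = T")
    \<comment> \<open>The derivative within a one-point interval is not determined, but such an
      interval is a null set.\<close>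
    case True
    have "negligible {s..T}" using True by simp
    then show ?thesis by (subst AE_lebesgue_on_iff_negligible) auto
  next
    case False
    then have sT: "s < T" using s by simp
    have "AE t in lebesgue_on {s..T}. t \<in> {s..T}" by (rule AE_I2) simp
    with der \<phi>_m show ?thesis
    proof eventually_elim
      case (elim t)
      have "vector_derivative z (at t within {s..T}) = fst (\<phi> t)"
        using vector_derivative_within_cbox[OF sT, of t z "fst (\<phi> t)"] elim by (simp add: cbox_interval)
      moreover have "norm (fst (\<phi> t)) \<le> norm (\<phi> t)" by (metis norm_fst_le prod.collapse)
      \<comment> \<open>The control is \<open>\<phi>\<close> and the velocity its first component;
        each is bounded by \<open>|\<phi>|\<close>, which explains the factor 2.\<close>
      ultimately show ?case using norm_Pair_le[of "fst (\<phi> t)" "\<phi> t"] elim by simp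
    qed
  qed
  ultimately show ?thesis by blast
qed

end

theorem theorem4p7:
  fixes H :: "real \<Rightarrow> 'a::euclidean_space \<Rightarrow> 'a \<Rightarrow> real"
    and T :: real
    and c :: "real \<Rightarrow> real"
    and k :: "real \<Rightarrow> real \<Rightarrow> real"
    and g :: "'a \<Rightarrow> real"
  assumes H1: "\<And>x p. (\<lambda>t. H t x p) \<in> borel_measurable (lebesgue_on {0..T})"
    and H2: "\<And>t. t \<in> {0..T} \<Longrightarrow> continuous_on UNIV (\<lambda>(x, p). H t x p)"
    and H3: "\<And>t x. t \<in> {0..T} \<Longrightarrow> convex_on UNIV (H t x)"
    and H4_meas: "c \<in> borel_measurable (lebesgue_on {0..T})"
    and H4_nonneg: "\<And>t. t \<in> {0..T} \<Longrightarrow> c t \<ge> 0"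
    and H4: "\<And>t x p q. t \<in> {0..T} \<Longrightarrow> \<bar>H t x p - H t x q\<bar> \<le> c t * (1 + norm x) * norm (p - q)"
    and HLC_meas: "\<And>R. R > 0 \<Longrightarrow> k R \<in> borel_measurable (lebesgue_on {0..T})"
    and HLC_nonneg: "\<And>R t. R > 0 \<Longrightarrow> t \<in> {0..T} \<Longrightarrow> k R t \<ge> 0"
    and HLC: "\<And>R t x y p. R > 0 \<Longrightarrow> t \<in> {0..T} \<Longrightarrow> x \<in> cball 0 R \<Longrightarrow> y \<in> cball 0 R \<Longrightarrow>
               \<bar>H t x p - H t y p\<bar> \<le> k R t * (1 + norm p) * norm (x - y)"
    and c_int: "integrable (lebesgue_on {0..T}) c"
    and k_int: "\<And>R. R > 0 \<Longrightarrow> integrable (lebesgue_on {0..T}) (k R)"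
    and H00_int: "integrable (lebesgue_on {0..T}) (\<lambda>t. H t 0 0)"
    and g_loclip: "loc_lipschitz g"
  shows "(\<forall>M>0. \<exists>lam :: real \<Rightarrow> real. integrable (lebesgue_on {0..T}) lam \<and>
            (\<forall>t0 \<in> {0..T}. \<forall>x0 \<in> cball 0 M. \<exists>x a. optimal_pair H g T t0 x0 x a \<and>
               (AE t in lebesgue_on {t0..T}.
                  norm (vector_derivative x (at t within {t0..T}), a t) \<le> lam t)))
       \<and> ((continuous_on ({0..T} \<times> UNIV) (\<lambda>(t, x, p). H t x p) \<and> continuous_on {0..T} c \<and>
            (\<forall>R>0. continuous_on {0..T} (k R)))
          \<longrightarrow> (\<forall>M>0. \<exists>lam :: real \<Rightarrow> real. continuous_on {0..T} lam \<and>
                 integrable (lebesgue_on {0..T}) lam \<and>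
            (\<forall>t0 \<in> {0..T}. \<forall>x0 \<in> cball 0 M. \<exists>x a. optimal_pair H g T t0 x0 x a \<and>
               (AE t in lebesgue_on {t0..T}.
                  norm (vector_derivative x (at t within {t0..T}), a t) \<le> lam t))))"
proof -
  interpret hamiltonian H T c k
    by unfold_locales (fact H1 H2 H3 H4_nonneg H4 HLC_nonneg HLC c_int k_int H00_int)+
  have bound: "\<exists>L. \<forall>t0 \<in> {0..T}. \<forall>x0 \<in> cball 0 M. \<exists>x a. optimal_pair H g T t0 x0 x a \<and>
      (AE t in lebesgue_on {t0..T}.
        norm (vector_derivative x (at t within {t0..T}), a t) \<le> 2 * velocity_bound L M t)" if "0 < M" for M
  proof -
    \<comment> \<open>The ball contains the end points of all trajectories starting in the ball of
      radius \<open>M\<close>, so one constant, and with it one bound, serves every initial time and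
      state.\<close>
    obtain L where L: "L-lipschitz_on (cball 0 (radius M)) g"
      using loc_lipschitz_imp_lipschitz_on_compact[OF g_loclip compact_cball] by blast
    show ?thesis
    proof (intro exI[of _ L] ballI)
      fix t0 x0 assume t0: "t0 \<in> {0..T}" and x0: "x0 \<in> cball (0 :: 'a) M"
      show "\<exists>x a. optimal_pair H g T t0 x0 x a \<and>
        (AE t in lebesgue_on {t0..T}.
          norm (vector_derivative x (at t within {t0..T}), a t) \<le> 2 * velocity_bound L M t)"
        using t0 x0 that by (intro optimal_pair_exists L) auto
    qed
  qed
  have int: "integrable (lebesgue_on {0..T}) (\<lambda>t. 2 * velocity_bound L M t)" if "0 < M" for L M
    using integrable_velocity_bound[of M L] that by (intro integrable_mult_right) auto
  have cont: "continuous_on {0..T} (\<lambda>t. 2 * velocity_bound L M t)"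
    if "0 < M" and "continuous_on ({0..T} \<times> UNIV) (\<lambda>(t, x, p). H t x p)" "continuous_on {0..T} c"
      "\<forall>R>0. continuous_on {0..T} (k R)" for L M
  proof -
    have "continuous_on {0..T} (\<lambda>t. case (t, 0, 0) of (t, x, p) \<Rightarrow> H t x p)"
      by (rule continuous_on_compose2[OF that(2)]) (auto intro!: continuous_intros)
    then have "continuous_on {0..T} (\<lambda>t. H t 0 0)" by simp
    then show ?thesis
      using that radius_pos[of M] by (intro continuous_on_mult_left continuous_velocity_bound) auto
  qed
  show ?thesis
  proof (intro conjI allI impI)
    fix M :: real assume M: "0 < M"
    then show "\<exists>lam :: real \<Rightarrow> real. integrable (lebesgue_on {0..T}) lam \<and>
            (\<forall>t0 \<in> {0..T}. \<forall>x0 \<in> cball 0 M. \<exists>x a. optimal_pair H g T t0 x0 x a \<and>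
               (AE t in lebesgue_on {t0..T}.
                  norm (vector_derivative x (at t within {t0..T}), a t) \<le> lam t))"
      using bound[OF M] int[OF M] by meson
  next
    fix M :: real
    assume *: "continuous_on ({0..T} \<times> UNIV) (\<lambda>(t, x, p). H t x p) \<and> continuous_on {0..T} c \<and>
            (\<forall>R>0. continuous_on {0..T} (k R))" and M: "0 < M"
    show "\<exists>lam :: real \<Rightarrow> real. continuous_on {0..T} lam \<and>
                 integrable (lebesgue_on {0..T}) lam \<and>
            (\<forall>t0 \<in> {0..T}. \<forall>x0 \<in> cball 0 M. \<exists>x a. optimal_pair H g T t0 x0 x a \<and>
               (AE t in lebesgue_on {t0..T}.
                  norm (vector_derivative x (at t within {t0..T}), a t) \<le> lam t))"
      using bound[OF M] int[OF M] cont[OF M] * by meson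
  qed
qed

end
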